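(* Let $n\ge 3$. The equation $$\left(1+L/2\right)^{2n-2}-(n-1)\left(1+L/2\right)^n-(n-1)^2\left(1+L/2\right)^{n-2}+n-1=0$$ has a unique real positive solution $L=L_1$. Setting $$B_n := \frac{(n-2)\left(1+\frac{L_1}{2}\right)^{n-2}}{\left(1+\frac{L_1}{2}\right)^{n-2}-1} < \infty,$$ every $n$-dimensional hypersurface of revolution $(M,g)$ (of arbitrary meridian length $L>0$) satisfies $$\sigma_1(M,g) < B_n.$$ Moreover, this bound is sharp: for each $\varepsilon>0$ there exists an $n$-dimensional hypersurface of revolution $(M_\varepsilon,g_\varepsilon)$ such that $\sigma_1(M_\varepsilon,g_\varepsilon)>B_n-\varepsilon$.
   Context: Hypersurface of revolution: for $L>0$ and $M=[0,L]\times\mathbb{S}^{n-1}$, a metric of revolution on $M$ is a Riemannian metric of the form $g(r,p) = dr^2 + h^2(r) g_0(p)$, $(r,p)\in[0,L]\times\mathbb{S}^{n-1}$, where $g_0$ is the canonical metric of the unit $(n-1)$-sphere and $h:[0,L]\to(0,\infty)$ is a smooth function satisfying (1) $|h'(r)|\le 1$ for all $r\in[0,L]$ and (2) $h(0)=h(L)=1$. Then $(M,g)$ is called an $n$-dimensional hypersurface of revolution (in Euclidean space, with two boundary components each isometric to $\mathbb{S}^{n-1}$), and $L$ is its meridian length. Steklov eigenvalues: for a smooth compact connected Riemannian manifold $(M,g)$ with smooth boundary $\Sigma$, these are the real numbers $\sigma$ for which there is a nonzero harmonic function $f:M\to\mathbb{R}$ with $\partial_\nu f = \sigma f$ on $\Sigma$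 ($\nu$ the outward unit normal). They form a sequence $0=\sigma_0(M,g)<\sigma_1(M,g)\le\sigma_2(M,g)\le\dots\nearrow\infty$, repeated according to multiplicity. *)

theory Defs
  imports "HOL-Analysis.Analysis"
begin

section \<open>Smooth functions\<close>

primrec Ck_on :: "nat \<Rightarrow> 'a::euclidean_space set \<Rightarrow> ('a \<Rightarrow> real) \<Rightarrow> bool" where
  "Ck_on 0 U f \<longleftrightarrow> continuous_on U f"
| "Ck_on (Suc k) U f \<longleftrightarrow>
     (\<forall>x\<in>U. f differentiable at x) \<and> (\<forall>v. Ck_on k U (\<lambda>x. frechet_derivative f (at x) v))"

text \<open>On an arbitrary subset of a Euclidean space (such as a compact interval, or a compact
  submanifold with boundary), smooth means: the restriction of a smooth function defined on an
  open neighbourhood.  The predicate \<^const>\<open>Ck_on\<close> is only meant for open sets.\<close>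

definition smooth_on :: "'a::euclidean_space set \<Rightarrow> ('a \<Rightarrow> real) \<Rightarrow> bool" where
  "smooth_on S f \<longleftrightarrow>
     (\<exists>U F. open U \<and> S \<subseteq> U \<and> (\<forall>k. Ck_on k U F) \<and> (\<forall>x\<in>S. F x = f x))"


section \<open>The Laplace--Beltrami operator in coordinates\<close>

definition partial :: "'n::finite \<Rightarrow> (real^'n \<Rightarrow> real) \<Rightarrow> real^'n \<Rightarrow> real" where
  "partial i u x = frechet_derivative u (at x) (axis i 1)"

text \<open>\<open>G\<close> is the matrix field of the metric in the given coordinates.\<close>

definition laplace_beltrami ::
    "(real^'n \<Rightarrow> real^'n^'n) \<Rightarrow> (real^'n \<Rightarrow> real) \<Rightarrow> real^'n::finite \<Rightarrow> real" where
  "laplace_beltrami G u x =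
     (\<Sum>i\<in>UNIV. partial i
        (\<lambda>y. sqrt (det (G y)) * (\<Sum>j\<in>UNIV. matrix_inv (G y) $ i $ j * partial j u y)) x)
     / sqrt (det (G x))"


section \<open>Hypersurfaces of revolution\<close>

text \<open>The cylinder \<open>[0,L] \<times> S\<^sup>n\<^sup>-\<^sup>1\<close> is a submanifold with boundary of \<open>\<real> \<times> \<real>\<^sup>n\<close>, where \<open>n = CARD('n)\<close>.
  The tangent vectors at \<open>(r, p)\<close> are the pairs \<open>(s, v)\<close> with \<open>v\<close> orthogonal to \<open>p\<close>.  A metric
  \<open>g\<close> takes a point and two tangent vectors; its values elsewhere are irrelevant.\<close>

type_synonym 'n metric = "real \<times> (real^'n) \<Rightarrow> real \<times> (real^'n) \<Rightarrow> real \<times> (real^'n) \<Rightarrow> real"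

definition cylinder :: "real \<Rightarrow> (real \<times> (real^'n::finite)) set" where
  "cylinder L = {0..L} \<times> sphere 0 1"

definition cylinder_boundary :: "real \<Rightarrow> (real \<times> (real^'n::finite)) set" where
  "cylinder_boundary L = {0, L} \<times> sphere 0 1"

definition tangent :: "real \<times> (real^'n::finite) \<Rightarrow> (real \<times> (real^'n)) set" where
  "tangent q = {(s, v). v \<bullet> snd q = 0}"

definition hypersurface_of_revolution :: "real \<Rightarrow> 'n::finite metric \<Rightarrow> bool" where
  "hypersurface_of_revolution L g \<longleftrightarrow> L > 0 \<and>
     (\<exists>h. smooth_on {0..L} h \<and> (\<forall>r\<in>{0..L}. h r > 0) \<and>
        (\<forall>r\<in>{0..L}. \<exists>d. (h has_real_derivative d) (at r within {0..L}) \<and> \<bar>d\<bar> \<le> 1) \<and>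
        h 0 = 1 \<and> h L = 1 \<and>
        (\<forall>(r, p)\<in>cylinder L. \<forall>(s, v)\<in>tangent (r, p). \<forall>(t, w)\<in>tangent (r, p).
           g (r, p) (s, v) (t, w) = s * t + (h r)\<^sup>2 * (v \<bullet> w)))"


section \<open>Steklov eigenvalues\<close>

text \<open>Polar coordinates: a single global chart, a diffeomorphism from the annulus
  \<open>1 \<le> |x| \<le> 1 + L\<close> in \<open>\<real>\<^sup>n\<close> onto the cylinder.\<close>

definition polar :: "real^'n::finite \<Rightarrow> real \<times> (real^'n)" where
  "polar x = (norm x - 1, (1 / norm x) *\<^sub>R x)"

definition metric_matrix :: "'n::finite metric \<Rightarrow> real^'n \<Rightarrow> real^'n^'n" where
  "metric_matrix g x = (\<chi> i j. g (polar x) (frechet_derivative polar (at x) (axis i 1))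
                                            (frechet_derivative polar (at x) (axis j 1)))"

definition harmonic :: "real \<Rightarrow> 'n::finite metric \<Rightarrow> (real \<times> (real^'n) \<Rightarrow> real) \<Rightarrow> bool" where
  "harmonic L g f \<longleftrightarrow> smooth_on (cylinder L) f \<and>
     (\<forall>x. 1 < norm x \<and> norm x < 1 + L \<longrightarrow> laplace_beltrami (metric_matrix g) (f \<circ> polar) x = 0)"

definition outward_unit_normal ::
    "real \<Rightarrow> 'n::finite metric \<Rightarrow> real \<times> (real^'n) \<Rightarrow> real \<times> (real^'n) \<Rightarrow> bool" where
  "outward_unit_normal L g q \<nu> \<longleftrightarrow> \<nu> \<in> tangent q \<and> g q \<nu> \<nu> = 1 \<and>
     (\<forall>v. (0, v) \<in> tangent q \<longrightarrow> g q \<nu> (0, v) = 0) \<and>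
     (if fst q = 0 then fst \<nu> < 0 else fst \<nu> > 0)"

text \<open>A derivative \<open>D\<close> of \<open>f\<close> at \<open>q\<close> within the cylinder is not unique as a linear map on
  \<open>\<real> \<times> \<real>\<^sup>n\<close>, but its values on tangent vectors are.\<close>

definition steklov_eigenfunction ::
    "real \<Rightarrow> 'n::finite metric \<Rightarrow> real \<Rightarrow> (real \<times> (real^'n) \<Rightarrow> real) \<Rightarrow> bool" where
  "steklov_eigenfunction L g \<sigma> f \<longleftrightarrow> harmonic L g f \<and> (\<exists>q\<in>cylinder L. f q \<noteq> 0) \<and>
     (\<forall>q\<in>cylinder_boundary L. \<exists>\<nu> D. outward_unit_normal L g q \<nu> \<and>
        (f has_derivative D) (at q within cylinder L) \<and> D \<nu> = \<sigma> * f q)"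

text \<open>The \<open>k\<close>-th eigenvalue, counted from \<open>0\<close> and with multiplicity: eigenfunctions for distinct
  eigenvalues are linearly independent, so the eigenvalues \<open>\<le> x\<close> have total multiplicity at
  least \<open>k + 1\<close> iff there are \<open>k + 1\<close> linearly independent eigenfunctions with eigenvalues \<open>\<le> x\<close>.\<close>

definition steklov_eigenvalue :: "real \<Rightarrow> 'n::finite metric \<Rightarrow> nat \<Rightarrow> real" where
  "steklov_eigenvalue L g k = Inf {x. \<exists>f \<sigma>.
     (\<forall>i\<le>k. \<sigma> i \<le> x \<and> steklov_eigenfunction L g (\<sigma> i) (f i)) \<and>
     (\<forall>c. (\<forall>q\<in>cylinder L. (\<Sum>i\<le>k. c i * f i q) = 0) \<longrightarrow> (\<forall>i\<le>k. c i = 0))}"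


section \<open>The critical length and the bound\<close>

definition critical_equation :: "nat \<Rightarrow> real \<Rightarrow> bool" where
  "critical_equation n L \<longleftrightarrow>
     (1 + L/2) ^ (2*n - 2) - (real n - 1) * (1 + L/2) ^ n
       - (real n - 1)\<^sup>2 * (1 + L/2) ^ (n - 2) + real n - 1 = 0"

definition critical_length :: "nat \<Rightarrow> real" where
  "critical_length n = (THE L. L > 0 \<and> critical_equation n L)"

definition steklov_bound :: "nat \<Rightarrow> real" where
  "steklov_bound n = (real n - 2) * (1 + critical_length n / 2) ^ (n - 2)
     / ((1 + critical_length n / 2) ^ (n - 2) - 1)"

end

theory Submission
  imports Defs
begin

text \<open>Write \<open>m = n - 1\<close> and \<open>M = 1 + L/2\<close>.  For a metric of revolution there are two kinds of
  separated eigenfunctions that compete for \<open>\<sigma>\<^sub>1\<close>: a radial one, with eigenvalue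
  \<open>2 / \<integral> h\<^sup>1\<^sup>-\<^sup>n\<close>, and \<open>y(r) (p \<bullet> e)\<close>, where \<open>y\<close> solves
  \<open>(h\<^sup>m y')' = m h\<^sup>n\<^sup>-\<^sup>3 y\<close>.  Since \<open>h\<close> lies below the tent \<open>1 + min r (L - r)\<close>, their eigenvalues are at most
  the values for the tent, \<open>(n - 2) M\<^sup>n\<^sup>-\<^sup>2 / (M\<^sup>n\<^sup>-\<^sup>2 - 1)\<close> and
  \<open>m (M\<^sup>n - 1) / (M\<^sup>n + m)\<close>; for the second one this is Picone's identity.  The former decreases and the
  latter increases in \<open>L\<close>, and they agree exactly at the critical length.  The inequality is
  strict because a differentiable \<open>h\<close> cannot reach the tip of the tent.

  For the sharpness the tent of critical length is smoothed at its tip, and all eigenvalues have to be bounded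
  from below.  This needs no integration over the sphere: if an eigenfunction \<open>f\<close> is not
  radial, then for some reflection \<open>R\<close> the function \<open>f - f \<circ> R\<close> is positive somewhere on a half of
  the manifold and vanishes on the mirror, and the maximum of its quotient with a positive
  strict supersolution can only be attained if the eigenvalue is at least the Robin constant of
  that supersolution.  Radial eigenfunctions are found by solving the differential equation.\<close>

section \<open>Smooth functions\<close>

text \<open>\<open>steklov_eigenvalue\<close> is an infimum over genuine eigenfunctions, so there is
  no Rayleigh quotient to test. An upper bound therefore requires exact eigenfunctions of the given
  profile: the radial one is explicit, the first mode is produced by a linear differential equation
  and shooting, and only then compared with the tent. The infimum says something only after the
  eigenvalues are bounded below, which the same maximum principle gives with a crude constant. A
  lower bound must hold for every nonconstant eigenfunction; as no expansion in spherical harmonics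
  is made, a reflection replaces the projection onto higher modes. Strictness of the supersolution
  lets an elementary second derivative test take the place of the strong maximum principle. The
  price is that the first spherical harmonic t, which solves its equation exactly and vanishes on
  the mirror, has to be perturbed; the room for this is the \<delta> of
  \<open>nonradial_eigenvalue_ge\<close>. Both halves of the tent are flat, which is why the
  comparison functions for the first mode are built from x and x^(1 - n).\<close>

lemma frechet_derivative_cong_open:
  assumes "open U" "x \<in> U" "\<And>y. y \<in> U \<Longrightarrow> f y = g y"
  shows "frechet_derivative f (at x) = frechet_derivative g (at x)"
proof -
  have "(f has_derivative d) (at x) \<longleftrightarrow> (g has_derivative d) (at x)" for d
    using assms by (metis has_derivative_transform_within_open)
  then show ?thesis by (simp add: frechet_derivative_def)
qed

lemma differentiable_cong_open:
  assumes "open U" "x \<in> U" "\<And>y. y \<in> U \<Longrightarrow> f y = g y"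
  shows "f differentiable at x \<longleftrightarrow> g differentiable at x"
  unfolding differentiable_def using assms by (metis has_derivative_transform_within_open)

lemma Ck_on_cong:
  assumes "open U" "\<And>x. x \<in> U \<Longrightarrow> f x = g x"
  shows "Ck_on k U f \<longleftrightarrow> Ck_on k U g"
  using assms(2)
proof (induction k arbitrary: f g)
  case 0
  then show ?case by (simp cong: continuous_on_cong)
next
  case (Suc k)
  have "frechet_derivative f (at x) v = frechet_derivative g (at x) v" if "x \<in> U" for x v
    using frechet_derivative_cong_open[OF assms(1) that Suc.prems] by simp
  then have "Ck_on k U (\<lambda>x. frechet_derivative f (at x) v)
      \<longleftrightarrow> Ck_on k U (\<lambda>x. frechet_derivative g (at x) v)" for v
    by (intro Suc.IH)
  then show ?case
    using differentiable_cong_open[OF assms(1) _ Suc.prems] by auto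
qed

text \<open>The recursion of \<open>Ck_on\<close> speaks of \<open>frechet_derivative\<close>; an
  explicit derivative \<open>D\<close> may replace it, since both agree on the open set.\<close>

lemma Ck_on_SucI:
  assumes "open U" "\<And>x. x \<in> U \<Longrightarrow> (f has_derivative D x) (at x)"
    and "\<And>v. Ck_on k U (\<lambda>x. D x v)"
  shows "Ck_on (Suc k) U f"
proof -
  have "frechet_derivative f (at x) v = D x v" if "x \<in> U" for x v
    using frechet_derivative_at[OF assms(2)[OF that]] by simp
  then have "Ck_on k U (\<lambda>x. frechet_derivative f (at x) v)" for v
    by (rule iffD2[OF Ck_on_cong[OF assms(1)] assms(3)])
  then show ?thesis using assms(2) by (auto simp: differentiable_def)
qed

lemma Ck_on_SucD: "Ck_on (Suc k) U f \<Longrightarrow> Ck_on k U f"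
proof (induction k arbitrary: f)
  case 0
  then show ?case
    by (simp add: differentiable_imp_continuous_on differentiable_on_def differentiable_at_withinI)
next
  case (Suc k)
  show ?case
    unfolding Ck_on.simps(2)[of k]
    using Suc.prems Suc.IH by (metis Ck_on.simps(2))
qed

lemma Ck_on_subset: "Ck_on k U f \<Longrightarrow> V \<subseteq> U \<Longrightarrow> Ck_on k V f"
  by (induction k arbitrary: f) (auto intro: continuous_on_subset)

lemma Ck_on_const: "open U \<Longrightarrow> Ck_on k U (\<lambda>x. c)"
proof (induction k arbitrary: c)
  case (Suc k)
  then show ?case
    by (intro Ck_on_SucI[where D = "\<lambda>x v. 0"]) auto
qed auto

lemma Ck_on_linear: "open U \<Longrightarrow> bounded_linear f \<Longrightarrow> Ck_on k U f"
proof (cases k)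
  case (Suc j)
  assume "open U" "bounded_linear f"
  then show ?thesis
    unfolding Suc
    by (intro Ck_on_SucI[where D = "\<lambda>x v. f v"])
       (auto intro: bounded_linear.has_derivative[OF _ has_derivative_ident] Ck_on_const)
qed (auto intro: linear_continuous_on)

lemma has_derivative_Ck:
  "Ck_on (Suc k) U f \<Longrightarrow> x \<in> U \<Longrightarrow> (f has_derivative frechet_derivative f (at x)) (at x)"
  using frechet_derivative_works by auto

lemma Ck_on_add: "open U \<Longrightarrow> Ck_on k U f \<Longrightarrow> Ck_on k U g \<Longrightarrow> Ck_on k U (\<lambda>x. f x + g x)"
proof (induction k arbitrary: f g)
  case (Suc k)
  show ?case
    by (rule Ck_on_SucI[OF Suc.prems(1) has_derivative_add[OF
          has_derivative_Ck[OF Suc.prems(2)] has_derivative_Ck[OF Suc.prems(3)]]])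
      (use Suc in auto)
qed (simp add: continuous_on_add)

lemma Ck_on_mult: "open U \<Longrightarrow> Ck_on k U f \<Longrightarrow> Ck_on k U g \<Longrightarrow> Ck_on k U (\<lambda>x. f x * g x)"
proof (induction k arbitrary: f g)
  case (Suc k)
  have lower: "Ck_on k U f" "Ck_on k U g"
    using Suc.prems(2,3) by (blast dest: Ck_on_SucD)+
  have derivs: "Ck_on k U (\<lambda>x. frechet_derivative f (at x) v)"
      "Ck_on k U (\<lambda>x. frechet_derivative g (at x) v)" for v
    using Suc.prems(2,3) by auto
  show ?case
    by (rule Ck_on_SucI[OF Suc.prems(1) has_derivative_mult[OF
          has_derivative_Ck[OF Suc.prems(2)] has_derivative_Ck[OF Suc.prems(3)]]])
      (simp_all add: Ck_on_add Suc.IH Suc.prems(1) lower derivs)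
qed (simp add: continuous_on_mult)

lemma Ck_on_uminus: "open U \<Longrightarrow> Ck_on k U f \<Longrightarrow> Ck_on k U (\<lambda>x. - f x)"
  using Ck_on_mult[of U k "\<lambda>x. -1" f] by (simp add: Ck_on_const)

lemma Ck_on_diff: "open U \<Longrightarrow> Ck_on k U f \<Longrightarrow> Ck_on k U g \<Longrightarrow> Ck_on k U (\<lambda>x. f x - g x)"
  using Ck_on_add[of U k f "\<lambda>x. - g x"] by (simp add: Ck_on_uminus)

lemma Ck_on_power: "open U \<Longrightarrow> Ck_on k U f \<Longrightarrow> Ck_on k U (\<lambda>x. f x ^ m)"
  by (induction m) (auto intro: Ck_on_mult Ck_on_const)

lemma Ck_on_inverse:
  "open U \<Longrightarrow> Ck_on k U f \<Longrightarrow> (\<And>x. x \<in> U \<Longrightarrow> f x \<noteq> 0) \<Longrightarrow> Ck_on k U (\<lambda>x. inverse (f x))"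
proof (induction k)
  case (Suc k)
  have lower: "Ck_on k U (\<lambda>x. inverse (f x))"
    using Suc.IH[OF Suc.prems(1) Ck_on_SucD[OF Suc.prems(2)] Suc.prems(3)] .
  have derivs: "Ck_on k U (\<lambda>x. frechet_derivative f (at x) v)" for v
    using Suc.prems(2) by auto
  show ?case
  proof (rule Ck_on_SucI[OF Suc.prems(1)])
    show "((\<lambda>x. inverse (f x)) has_derivative
        (\<lambda>v. - (inverse (f x) * frechet_derivative f (at x) v * inverse (f x)))) (at x)"
      if "x \<in> U" for x
      using Deriv.has_derivative_inverse[OF Suc.prems(3)[OF that] has_derivative_Ck[OF Suc.prems(2) that]] .
    show "Ck_on k U (\<lambda>x. - (inverse (f x) * frechet_derivative f (at x) v * inverse (f x)))" for v
      by (intro Ck_on_uminus Ck_on_mult lower derivs Suc.prems(1))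
  qed
qed (simp add: continuous_on_inverse)

lemma Ck_on_compose_linear:
  assumes "bounded_linear l" "open U"
  shows "Ck_on k U f \<Longrightarrow> Ck_on k (l -` U) (\<lambda>x. f (l x))"
proof (induction k arbitrary: f)
  case 0
  then show ?case
    by (auto intro: continuous_on_compose2[OF _ linear_continuous_on[OF assms(1)]])
next
  case (Suc k)
  have op: "open (l -` U)"
    using assms by (auto intro: open_vimage linear_continuous_on)
  have d: "((\<lambda>x. f (l x)) has_derivative (\<lambda>v. frechet_derivative f (at (l x)) (l v))) (at x)"
    if "x \<in> l -` U" for x
    using has_derivative_compose[OF bounded_linear.has_derivative[OF assms(1) has_derivative_ident]
        has_derivative_Ck[OF Suc.prems]] that by auto
  show ?case
    by (rule Ck_on_SucI[OF op d]) (use Suc in auto)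
qed

lemma Ck_on_Suc_real:
  assumes "open U" "\<And>x. x \<in> U \<Longrightarrow> (f has_real_derivative f' x) (at x)" "Ck_on k U f'"
  shows "Ck_on (Suc k) U f"
proof (rule Ck_on_SucI[OF assms(1)])
  show "(f has_derivative (\<lambda>v. f' x * v)) (at x)" if "x \<in> U" for x
    using assms(2)[OF that] by (simp add: has_field_derivative_def)
  show "Ck_on k U (\<lambda>x. f' x * v)" for v
    by (intro Ck_on_mult assms Ck_on_const)
qed

lemma continuous_on_DERIV:
  fixes f :: "real \<Rightarrow> real"
  assumes "\<And>r. r \<in> S \<Longrightarrow> (f has_real_derivative f' r) (at r)"
  shows "continuous_on S f"
  by (rule DERIV_continuous_on[OF has_field_derivative_at_within[OF assms]])

text \<open>The derivative is written as a logarithmic derivative times the function, the form in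
  which it meets the term m h'/h of the radial equation.\<close>

lemma DERIV_inverse_power:
  fixes f :: "real \<Rightarrow> real"
  assumes "(f has_real_derivative f') (at t)" "f t \<noteq> 0"
  shows "((\<lambda>t. inverse (f t ^ n)) has_real_derivative - (real n * f' / f t * inverse (f t ^ n))) (at t)"
proof -
  have "((\<lambda>t. inverse (f t ^ n)) has_real_derivative
      - (inverse (f t ^ n) * (real n * (f' * f t ^ (n - 1))) * inverse (f t ^ n))) (at t)"
    using assms by (auto intro!: derivative_eq_intros)
  moreover have "inverse (f t ^ n) * (real n * (f' * f t ^ (n - 1))) * inverse (f t ^ n)
      = real n * f' / f t * inverse (f t ^ n)"
    using assms(2) by (cases n) (auto simp: field_simps)
  ultimately show ?thesis by simp
qed

lemma Ck_on_real_deriv: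
  fixes f :: "real \<Rightarrow> real"
  assumes "Ck_on (Suc k) U f" "open U"
  shows "Ck_on k U (deriv f)" "\<And>x. x \<in> U \<Longrightarrow> (f has_real_derivative deriv f x) (at x)"
proof -
  show *: "(f has_real_derivative deriv f x) (at x)" if "x \<in> U" for x
    using assms that by (auto simp: DERIV_deriv_iff_real_differentiable)
  have "frechet_derivative f (at x) 1 = deriv f x" if "x \<in> U" for x
    using frechet_derivative_at[OF *[OF that, unfolded has_field_derivative_def]]
    by (metis mult.right_neutral)
  moreover have "Ck_on k U (\<lambda>x. frechet_derivative f (at x) 1)" using assms by simp
  ultimately show "Ck_on k U (deriv f)"
    by (rule iffD1[OF Ck_on_cong[OF assms(2)]])
qed

section \<open>Linear differential equations\<close>

text \<open>One Picard step: integrating the k-th term of an exponential series against a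
  coefficient bounded by K gives the next term of that series.\<close>

lemma integral_power_bound:
  fixes p f :: "real \<Rightarrow> real"
  assumes p: "continuous_on {a..b} p" "\<And>s. s \<in> {a..b} \<Longrightarrow> \<bar>p s\<bar> \<le> K"
    and f: "continuous_on {a..b} f" "\<And>s. s \<in> {a..b} \<Longrightarrow> \<bar>f s\<bar> \<le> C * (K * (s - a)) ^ k / fact k"
    and t: "t \<in> {a..b}"
  shows "\<bar>integral {a..t} (\<lambda>s. p s * f s)\<bar> \<le> C * (K * (t - a)) ^ Suc k / fact (Suc k)"
proof -
  let ?g = "\<lambda>s. K * (C * (K * (s - a)) ^ k / fact k)"
  have "0 \<le> K" using p(2)[OF t] by linarith
  have sub: "{a..t} \<subseteq> {a..b}" using t by auto
  have d1: "((\<lambda>s. C * (K * (s - a)) ^ Suc k / fact (Suc k)) has_real_derivative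
      C * (real (Suc k) * (K * (s - a)) ^ k * K) / fact (Suc k)) (at s within {a..t})" for s
    by (auto intro!: derivative_eq_intros simp del: of_nat_Suc power_Suc fact_Suc)
  have d2: "C * (real (Suc k) * (K * (s - a)) ^ k * K) / fact (Suc k) = ?g s" for s
    by (simp add: field_simps del: of_nat_Suc)
  note der = DERIV_cong[OF d1 d2]
  have "(?g has_integral
      C * (K * (t - a)) ^ Suc k / fact (Suc k) - C * (K * (a - a)) ^ Suc k / fact (Suc k)) {a..t}"
    using t der unfolding has_real_derivative_iff_has_vector_derivative
    by (intro fundamental_theorem_of_calculus) auto
  then have g: "(?g has_integral C * (K * (t - a)) ^ Suc k / fact (Suc k)) {a..t}" by simp
  have "norm (integral {a..t} (\<lambda>s. p s * f s)) \<le> integral {a..t} ?g"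
  proof (rule Henstock_Kurzweil_Integration.integral_norm_bound_integral)
    show "(\<lambda>s. p s * f s) integrable_on {a..t}"
      using p(1) f(1) sub
      by (intro integrable_continuous_interval continuous_on_mult) (auto intro: continuous_on_subset)
    show "?g integrable_on {a..t}" using g by blast
    show "norm (p s * f s) \<le> ?g s" if "s \<in> {a..t}" for s
      unfolding real_norm_def abs_mult
      using p(2)[of s] f(2)[of s] that sub \<open>0 \<le> K\<close>
      by (intro mult_mono) auto
  qed
  then show ?thesis unfolding integral_unique[OF g] by (simp only: real_norm_def)
qed

text \<open>Increments of the Picard iterates, not the iterates themselves: the initial values occur
  only at index 0, and the solution is the sum over all k.\<close>

primrec picard :: "real \<Rightarrow> (real \<Rightarrow> real) \<Rightarrow> (real \<Rightarrow> real) \<Rightarrow> real \<Rightarrow> real \<Rightarrow> nat \<Rightarrow> (real \<Rightarrow> real) \<times> (real \<Rightarrow> real)" where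
  "picard a p q u0 v0 0 = ((\<lambda>t. u0), (\<lambda>t. v0))"
| "picard a p q u0 v0 (Suc k) =
     ((\<lambda>t. integral {a..t} (\<lambda>s. p s * snd (picard a p q u0 v0 k) s)),
      (\<lambda>t. integral {a..t} (\<lambda>s. q s * fst (picard a p q u0 v0 k) s)))"

text \<open>The increments are dominated by an exponential series, so the series and its termwise
  derivative converge uniformly on the interval.\<close>

lemma linear_system_exists:
  fixes p q :: "real \<Rightarrow> real"
  assumes ab: "a < b" and pc: "continuous_on {a..b} p" and qc: "continuous_on {a..b} q"
  obtains u v where "u a = u0" "v a = v0"
    "\<And>t. t \<in> {a..b} \<Longrightarrow> (u has_real_derivative p t * v t) (at t within {a..b})"
    "\<And>t. t \<in> {a..b} \<Longrightarrow> (v has_real_derivative q t * u t) (at t within {a..b})"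
proof -
  define X where "X = picard a p q u0 v0"
  define u where "u k = fst (X k)" for k
  define v where "v k = snd (X k)" for k
  have u_Suc: "u (Suc k) = (\<lambda>t. integral {a..t} (\<lambda>s. p s * v k s))"
    and v_Suc: "v (Suc k) = (\<lambda>t. integral {a..t} (\<lambda>s. q s * u k s))"
    and u_0: "u 0 = (\<lambda>t. u0)" and v_0: "v 0 = (\<lambda>t. v0)" for k
    by (simp_all add: u_def v_def X_def)
  obtain K1 where K1: "\<And>s. s \<in> {a..b} \<Longrightarrow> \<bar>p s\<bar> \<le> K1"
    using compact_imp_bounded[OF compact_continuous_image[OF pc]]
    unfolding bounded_iff by fastforce
  obtain K2 where K2: "\<And>s. s \<in> {a..b} \<Longrightarrow> \<bar>q s\<bar> \<le> K2"
    using compact_imp_bounded[OF compact_continuous_image[OF qc]]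
    unfolding bounded_iff by fastforce
  define K where "K = max K1 K2"
  define C where "C = max \<bar>u0\<bar> \<bar>v0\<bar>"
  have Kp: "\<bar>p s\<bar> \<le> K" and Kq: "\<bar>q s\<bar> \<le> K" if "s \<in> {a..b}" for s
    using K1[OF that] K2[OF that] by (auto simp: K_def)
  have "0 \<le> K" using Kp[of a] ab by auto
  have cont: "continuous_on {a..b} (u k) \<and> continuous_on {a..b} (v k)" for k
  proof (induction k)
    case (Suc k)
    then show ?case
      unfolding u_Suc v_Suc using pc qc
      by (auto intro!: indefinite_integral_continuous_1 integrable_continuous_interval continuous_on_mult)
  qed (auto simp: u_0 v_0)
  have bound: "(\<forall>t\<in>{a..b}. \<bar>u k t\<bar> \<le> C * (K * (t - a)) ^ k / fact k) \<and>
      (\<forall>t\<in>{a..b}. \<bar>v k t\<bar> \<le> C * (K * (t - a)) ^ k / fact k)" for k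
  proof (induction k)
    case 0
    then show ?case by (auto simp: u_0 v_0 C_def)
  next
    case (Suc k)
    then show ?case
      unfolding u_Suc v_Suc
      using integral_power_bound[OF pc Kp, of "v k" C k] integral_power_bound[OF qc Kq, of "u k" C k] cont
      by blast
  qed
  define M where "M k = C * (K * (b - a)) ^ k / fact k" for k :: nat
  have "0 \<le> C" by (auto simp: C_def)
  have mono: "C * (K * (t - a)) ^ k / fact k \<le> M k" if "t \<in> {a..b}" for t k
    using that \<open>0 \<le> K\<close> \<open>0 \<le> C\<close> unfolding M_def
    by (intro divide_right_mono mult_left_mono power_mono mult_mono) auto
  have Mu: "\<bar>u k t\<bar> \<le> M k" and Mv: "\<bar>v k t\<bar> \<le> M k" if "t \<in> {a..b}" for t k
    using bound[of k] mono[OF that, of k] that by force+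
  have sM: "summable M"
    using summable_mult[OF summable_exp[of "K * (b - a)"], of C]
    by (simp add: M_def[abs_def] divide_inverse mult_ac)
  have sum_u: "summable (\<lambda>k. u k t)" and sum_v: "summable (\<lambda>k. v k t)" if "t \<in> {a..b}" for t
    using summable_comparison_test'[OF sM, of 0 "\<lambda>k. u k t"]
      summable_comparison_test'[OF sM, of 0 "\<lambda>k. v k t"] Mu[OF that] Mv[OF that] by auto
  have series: "((\<lambda>t. \<Sum>k. f k t) has_real_derivative r t * (\<Sum>k. g k t)) (at t within {a..b})"
    if t: "t \<in> {a..b}" and f0: "f 0 = (\<lambda>t. f0)"
      and fS: "\<And>k. f (Suc k) = (\<lambda>t. integral {a..t} (\<lambda>s. r s * g k s))"
      and rc: "continuous_on {a..b} r" and Kr: "\<And>s. s \<in> {a..b} \<Longrightarrow> \<bar>r s\<bar> \<le> K"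
      and gc: "\<And>k. continuous_on {a..b} (g k)" and Mg: "\<And>k s. s \<in> {a..b} \<Longrightarrow> \<bar>g k s\<bar> \<le> M k"
      and Mf: "\<And>k s. s \<in> {a..b} \<Longrightarrow> \<bar>f k s\<bar> \<le> M k"
    for f g :: "nat \<Rightarrow> real \<Rightarrow> real" and r f0 t
  proof -
    \<comment> \<open>Index shift: term 0 is constant, and the derivative of term j + 1 is r times
      term j of the other component.\<close>
    define f' where "f' k s = (case k of 0 \<Rightarrow> 0 | Suc j \<Rightarrow> r s * g j s)" for k s
    have der: "(f k has_real_derivative f' k s) (at s within {a..b})" if "s \<in> {a..b}" for k s
    proof (cases k)
      case (Suc j)
      then show ?thesis
        using integral_has_real_derivative[OF continuous_on_mult[OF rc gc[of j]] that]
        by (simp add: f'_def fS)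
    qed (simp add: f0 f'_def)
    define M' where "M' k = (case k of 0 \<Rightarrow> 0 | Suc j \<Rightarrow> K * M j)" for k
    have "summable M'"
      using summable_Suc_iff[of M'] summable_mult[OF sM, of K] by (simp add: M'_def)
    moreover have "norm (f' k s) \<le> M' k" if "s \<in> {a..b}" for k s
      using Kr[OF that] Mg[OF that] \<open>0 \<le> K\<close>
      by (auto simp: f'_def M'_def abs_mult split: nat.split intro!: mult_mono)
    ultimately have ul: "uniform_limit {a..b} (\<lambda>k s. \<Sum>i<k. f' i s) (\<lambda>s. \<Sum>i. f' i s) sequentially"
      by (intro Weierstrass_m_test)
    have sg: "summable (\<lambda>k. g k s)" and sf: "summable (\<lambda>k. f k s)" if "s \<in> {a..b}" for s
      using summable_comparison_test'[OF sM, of 0 "\<lambda>k. g k s"]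
        summable_comparison_test'[OF sM, of 0 "\<lambda>k. f k s"] Mg[OF that] Mf[OF that] by auto
    have sumf': "(\<Sum>i. f' i s) = r s * (\<Sum>k. g k s)" if "s \<in> {a..b}" for s
    proof -
      have 1: "summable (\<lambda>i. f' (Suc i) s)"
        using summable_mult[OF sg[OF that], of "r s"] by (simp add: f'_def)
      have "summable (\<lambda>i. f' i s)"
        using 1 summable_Suc_iff[of "\<lambda>i. f' i s"] by blast
      then have "(\<Sum>i. f' i s) = (\<Sum>i. f' (Suc i) s) + f' 0 s"
        using suminf_split_head by fastforce
      then show ?thesis
        using suminf_mult[OF sg[OF that], of "r s"] by (simp add: f'_def)
    qed
    obtain h where h: "\<And>s. s \<in> {a..b} \<Longrightarrow> (\<lambda>n. f n s) sums h s"
      "\<And>s. s \<in> {a..b} \<Longrightarrow> (h has_real_derivative (\<Sum>i. f' i s)) (at s within {a..b})"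
      using has_field_derivative_series[OF convex_real_interval(5) der ul t sf[OF t]] by blast
    have "(\<Sum>k. f k s) = h s" if "s \<in> {a..b}" for s
      using h(1)[OF that] by (simp add: sums_iff)
    then show ?thesis
      using h(2)[OF t] sumf'[OF t] t
      by (simp add: has_field_derivative_def) (rule has_derivative_transform; simp)
  qed
  have at_a: "(\<Sum>k. f k a) = f0" if "f 0 = (\<lambda>t. f0)"
    "\<And>k. f (Suc k) = (\<lambda>t. integral {a..t} (F k))" for f F and f0 :: real
  proof -
    have "f k a = 0" if "k \<noteq> 0" for k
      using \<open>\<And>k. f (Suc k) = (\<lambda>t. integral {a..t} (F k))\<close> that by (cases k) auto
    then show ?thesis using that(1) suminf_finite[of "{0}" "\<lambda>k. f k a"] by auto
  qed
  show thesis
  proof (rule that[of "\<lambda>t. \<Sum>k. u k t" "\<lambda>t. \<Sum>k. v k t"])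
    show "(\<Sum>k. u k a) = u0" "(\<Sum>k. v k a) = v0"
      using at_a[OF u_0 u_Suc] at_a[OF v_0 v_Suc] by auto
    show "((\<lambda>t. \<Sum>k. u k t) has_real_derivative p t * (\<Sum>k. v k t)) (at t within {a..b})"
      if "t \<in> {a..b}" for t
      using that Kp Mu Mv cont by (intro series[OF _ u_0 u_Suc pc]) auto
    show "((\<lambda>t. \<Sum>k. v k t) has_real_derivative q t * (\<Sum>k. u k t)) (at t within {a..b})"
      if "t \<in> {a..b}" for t
      using that Kq Mu Mv cont by (intro series[OF _ v_0 v_Suc qc]) auto
  qed
qed

text \<open>Bootstrapping: each derivative is a coefficient times the other component, so every
  order of smoothness yields the next.\<close>

lemma linear_system_smooth:
  fixes p q u v :: "real \<Rightarrow> real"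
  assumes "open U" "\<And>k. Ck_on k U p" "\<And>k. Ck_on k U q"
    and u: "\<And>t. t \<in> U \<Longrightarrow> (u has_real_derivative p t * v t) (at t)"
    and v: "\<And>t. t \<in> U \<Longrightarrow> (v has_real_derivative q t * u t) (at t)"
  shows "Ck_on k U u \<and> Ck_on k U v"
proof (induction k)
  case 0
  show ?case
    using continuous_on_DERIV[OF u]
      continuous_on_DERIV[OF v] by simp
next
  case (Suc k)
  then show ?case
    using assms by (intro conjI Ck_on_Suc_real[OF assms(1) u] Ck_on_Suc_real[OF assms(1) v] Ck_on_mult) auto
qed

text \<open>The initial point r0 is interior, unlike in \<open>linear_system_exists\<close>. Two
  solutions with unit data at a are combined; the system has trace zero, so their Wronskian is
  constantly 1 and the data at r0 can be matched.\<close>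

lemma linear_ivp:
  fixes p q :: "real \<Rightarrow> real"
  assumes r0: "a < r0" "r0 < b"
    and cont: "continuous_on {a..b} p" "continuous_on {a..b} q"
    and smooth: "\<And>k. Ck_on k {a<..<b} p" "\<And>k. Ck_on k {a<..<b} q"
  obtains u v where "u r0 = u0" "v r0 = v0"
    "\<And>t. t \<in> {a<..<b} \<Longrightarrow> (u has_real_derivative p t * v t) (at t)"
    "\<And>t. t \<in> {a<..<b} \<Longrightarrow> (v has_real_derivative q t * u t) (at t)"
    "\<And>k. Ck_on k {a<..<b} u" "\<And>k. Ck_on k {a<..<b} v"
proof -
  have "a < b" using r0 by simp
  obtain u1 v1 where 1: "u1 a = 1" "v1 a = 0"
    "\<And>t. t \<in> {a..b} \<Longrightarrow> (u1 has_real_derivative p t * v1 t) (at t within {a..b})"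
    "\<And>t. t \<in> {a..b} \<Longrightarrow> (v1 has_real_derivative q t * u1 t) (at t within {a..b})"
    using linear_system_exists[OF \<open>a < b\<close> cont] by blast
  obtain u2 v2 where 2: "u2 a = 0" "v2 a = 1"
    "\<And>t. t \<in> {a..b} \<Longrightarrow> (u2 has_real_derivative p t * v2 t) (at t within {a..b})"
    "\<And>t. t \<in> {a..b} \<Longrightarrow> (v2 has_real_derivative q t * u2 t) (at t within {a..b})"
    using linear_system_exists[OF \<open>a < b\<close> cont] by blast
  have "((\<lambda>t. u1 t * v2 t - u2 t * v1 t) has_real_derivative 0) (at t within {a..b})"
    if "t \<in> {a..b}" for t
    by (rule derivative_eq_intros 1(3,4)[OF that] 2(3,4)[OF that] refl)+ (simp add: algebra_simps)
  then obtain c where c: "\<forall>t\<in>{a..b}. u1 t * v2 t - u2 t * v1 t = c"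
    using has_field_derivative_zero_constant[OF convex_real_interval(5), of a b
        "\<lambda>t. u1 t * v2 t - u2 t * v1 t"] by auto
  from c[rule_format, of a] c[rule_format, of r0] have W: "u1 r0 * v2 r0 - u2 r0 * v1 r0 = 1"
    using 1 2 r0 by auto
  \<comment> \<open>Cramer's rule at r0, where the determinant is 1.\<close>
  define A where "A = u0 * v2 r0 - v0 * u2 r0"
  define B where "B = v0 * u1 r0 - u0 * v1 r0"
  define u where "u t = A * u1 t + B * u2 t" for t
  define v where "v t = A * v1 t + B * v2 t" for t
  have at: "at t = at t within {a..b}" if "t \<in> {a<..<b}" for t
    using that at_within_interior[of t "{a..b}"] by simp
  have du: "(u has_real_derivative p t * v t) (at t)"
    and dv: "(v has_real_derivative q t * u t) (at t)" if "t \<in> {a<..<b}" for t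
    using 1(3,4)[of t] 2(3,4)[of t] at[OF that] that unfolding u_def v_def
    by (auto intro!: derivative_eq_intros simp: algebra_simps)
  have "u r0 = u0 * (u1 r0 * v2 r0 - u2 r0 * v1 r0)" "v r0 = v0 * (u1 r0 * v2 r0 - u2 r0 * v1 r0)"
    by (simp_all add: u_def v_def A_def B_def algebra_simps)
  then show thesis
    using that[of u v] du dv linear_system_smooth[OF _ smooth du dv] by (simp add: W)
qed

section \<open>The Laplacian of a metric of revolution\<close>

text \<open>The matrix c I + d x x^T. For a unit vector x it acts as c on the complement of x and as
  c + d along x, the shape of a rotationally symmetric metric at a point in direction x.\<close>

definition rank1 :: "real \<Rightarrow> real \<Rightarrow> real^'n \<Rightarrow> real^'n::finite^'n" where
  "rank1 c d x = (\<chi> i j. (if i = j then c else 0) + d * x $ i * x $ j)"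

lemma rank1_mult_vec: "rank1 c d x *v y = c *\<^sub>R y + (d * (x \<bullet> y)) *\<^sub>R x"
proof -
  have "(\<Sum>j\<in>UNIV. ((if i = j then c else 0) + d * x $ i * x $ j) * y $ j)
      = c * y $ i + d * (x \<bullet> y) * x $ i" for i
  proof -
    have "(\<Sum>j\<in>UNIV. (if i = j then c else 0) * y $ j) = c * y $ i"
      by (simp add: if_distrib[of "\<lambda>t. t * _"] cong: if_cong)
    moreover have "(\<Sum>j\<in>UNIV. d * x $ i * x $ j * y $ j) = d * (x \<bullet> y) * x $ i"
      by (simp add: inner_vec_def sum_distrib_left sum_distrib_right mult_ac)
    ultimately show ?thesis by (simp add: distrib_right sum.distrib)
  qed
  then show ?thesis by (simp add: vec_eq_iff rank1_def matrix_vector_mult_def)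
qed

text \<open>The eigenvalues c and c + d are inverted separately. \<open>matrix_inv\<close> is a
  choice, so uniqueness of the two-sided inverse is shown as well.\<close>

lemma matrix_inv_rank1:
  assumes "norm x = 1" "c \<noteq> 0" "c + d \<noteq> 0"
  shows "matrix_inv (rank1 c d x) = rank1 (1 / c) (1 / (c + d) - 1 / c) x"
proof -
  have xx: "x \<bullet> x = 1" using assms(1) by (simp add: norm_eq_1)
  have inv: "rank1 c d x ** rank1 c' d' x = mat 1"
    if "c * c' = 1" "(c + d) * (c' + d') = 1" for c d c' d' :: real
  proof -
    have "c * d' + d * c' + d * d' = 0" using that by (simp add: algebra_simps)
    then have "c * (d' * t) + d * (c' * t + d' * t) = 0" for t
      by (metis (no_types, opaque_lifting) distrib_right distrib_left mult.assoc mult_zero_left add.assoc)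
    then have "rank1 c d x *v (rank1 c' d' x *v y) = y" for y
      using that(1)
      by (simp add: rank1_mult_vec inner_add_right xx scaleR_add_right
          add.assoc flip: scaleR_add_left)
    then show ?thesis by (simp add: matrix_eq matrix_vector_mul_assoc)
  qed
  let ?B = "rank1 (1 / c) (1 / (c + d) - 1 / c) x"
  have "rank1 c d x ** ?B = mat 1" "?B ** rank1 c d x = mat 1"
    using assms by (auto intro!: inv)
  moreover have "C = ?B" if "rank1 c d x ** C = mat 1" "C ** rank1 c d x = mat 1" for C
  proof -
    have "C = C ** (rank1 c d x ** ?B)" by (simp add: calculation)
    then show ?thesis using that by (simp add: matrix_mul_assoc)
  qed
  ultimately show ?thesis
    unfolding matrix_inv_def by (intro some_equality) blast+
qed

text \<open>Conjugation with an orthogonal matrix that moves a coordinate axis to x makes the matrix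
  diagonal.\<close>

lemma det_rank1:
  fixes x :: "real^'n::finite"
  assumes "norm x = 1"
  shows "det (rank1 c d x) = c ^ (CARD('n) - 1) * (c + d)"
proof -
  fix k :: 'n
  obtain Q :: "real^'n^'n" where Q: "orthogonal_matrix Q" "Q *v axis k 1 = x"
    using orthogonal_matrix_exists_basis[OF assms] by metis
  have QQ: "Q ** transpose Q = mat 1" using Q(1) by (simp add: orthogonal_matrix_def)
  have "rank1 c d x *v y = (Q ** rank1 c d (axis k 1) ** transpose Q) *v y" for y
  proof -
    have "axis k 1 \<bullet> (transpose Q *v y) = x \<bullet> y"
      using Q(2) by (metis dot_lmul_matrix matrix_transpose_mul transpose_matrix_vector vector_transpose_matrix)
    moreover have "Q *v (transpose Q *v y) = y" unfolding matrix_vector_mul_assoc QQ by simp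
    ultimately show ?thesis
      by (simp add: rank1_mult_vec matrix_vector_mul_assoc[symmetric] matrix_vector_right_distrib
          matrix_vector_mult_scaleR Q(2))
  qed
  then have "rank1 c d x = Q ** rank1 c d (axis k 1) ** transpose Q" by (simp add: matrix_eq)
  then have "det (rank1 c d x) = det (rank1 c d (axis k 1)) * det (Q ** transpose Q)"
    by (simp add: det_mul)
  also have "\<dots> = det (rank1 c d (axis k 1))" by (simp add: QQ)
  also have "\<dots> = (\<Prod>i\<in>UNIV. rank1 c d (axis k 1) $ i $ i)"
    by (intro det_diagonal) (auto simp: rank1_def axis_def)
  also have "\<dots> = (\<Prod>i\<in>UNIV. if i = k then c + d else c)"
    by (intro prod.cong) (auto simp: rank1_def axis_def)
  also have "\<dots> = c ^ (CARD('n) - 1) * (c + d)"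
    by (subst prod.remove[of _ k]) (auto simp: card_Diff_singleton)
  finally show ?thesis .
qed

text \<open>The last clause of \<open>hypersurface_of_revolution\<close> with its bound h made a
  parameter, so that h can be replaced by an extension that agrees with it on [0, L].\<close>

definition revolution :: "real \<Rightarrow> (real \<Rightarrow> real) \<Rightarrow> 'n::finite metric \<Rightarrow> bool" where
  "revolution L h g \<longleftrightarrow>
     (\<forall>(r, p)\<in>cylinder L. \<forall>(s, v)\<in>tangent (r, p). \<forall>(t, w)\<in>tangent (r, p).
        g (r, p) (s, v) (t, w) = s * t + (h r)\<^sup>2 * (v \<bullet> w))"

lemma revolutionD:
  assumes "revolution L h g" "(r, p) \<in> cylinder L" "(s, v) \<in> tangent (r, p)" "(t, w) \<in> tangent (r, p)"
  shows "g (r, p) (s, v) (t, w) = s * t + (h r)\<^sup>2 * (v \<bullet> w)"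
  using bspec[OF bspec[OF bspec[OF assms(1)[unfolded revolution_def] assms(2), simplified] assms(3), simplified]
      assms(4), simplified] .

lemma has_derivative_norm':
  fixes x :: "'a::real_inner"
  assumes "x \<noteq> 0"
  shows "(norm has_derivative (\<lambda>v. (x \<bullet> v) / norm x)) (at x)"
  using has_derivative_norm[OF assms] by (simp add: sgn_div_norm inner_commute divide_inverse mult.commute)

lemma polar_has_derivative:
  fixes x :: "real^'n::finite"
  assumes "x \<noteq> 0"
  shows "(polar has_derivative (\<lambda>v. ((x \<bullet> v) / norm x,
      (1 / norm x) *\<^sub>R v - ((x \<bullet> v) / norm x ^ 3) *\<^sub>R x))) (at x)"
proof -
  have "((\<lambda>x. (1 / norm x) *\<^sub>R x) has_derivative
      (\<lambda>v. (1 / norm x) *\<^sub>R v - ((x \<bullet> v) / norm x ^ 3) *\<^sub>R x)) (at x)"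
    using assms
    by (auto intro!: derivative_eq_intros has_derivative_norm' ext simp: power3_eq_cube)
  then show ?thesis
    unfolding polar_def using assms
    by (auto intro!: derivative_eq_intros has_derivative_norm' simp: power3_eq_cube mult.assoc)
qed

lemma polar_in_cylinder:
  "1 \<le> norm x \<Longrightarrow> norm x \<le> 1 + L \<Longrightarrow> polar x \<in> cylinder L"
  by (auto simp: polar_def cylinder_def)

text \<open>\<open>polar\<close> is isometric in the radial direction, whence the eigenvalue 1 along
  x. It scales tangential vectors by 1/|x|, and the metric then scales them by h, whence k^2 across
  x.\<close>

lemma metric_matrix_revolution:
  fixes x :: "real^'n::finite"
  assumes g: "revolution L h g" and x: "1 \<le> norm x" "norm x \<le> 1 + L"
  defines "k \<equiv> h (norm x - 1) / norm x"
  shows "metric_matrix g x = rank1 (k\<^sup>2) (1 - k\<^sup>2) ((1 / norm x) *\<^sub>R x)"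
proof -
  have x0: "x \<noteq> 0" "norm x > 0" using x(1) by auto
  have xx: "x \<bullet> x = (norm x)\<^sup>2" by (simp add: power2_norm_eq_inner)
  define v where "v i = (1 / norm x) *\<^sub>R axis i 1 - (x $ i / norm x ^ 3) *\<^sub>R x" for i
  have fd: "frechet_derivative polar (at x) (axis i 1) = (x $ i / norm x, v i)" for i
    using frechet_derivative_at[OF polar_has_derivative[OF x0(1)], symmetric]
    by (simp add: v_def inner_axis)
  have vx: "v i \<bullet> x = 0" for i
    using x0 by (simp add: v_def inner_diff_left inner_axis' xx field_simps power2_eq_square power3_eq_cube)
  have "(x $ i / norm x, v i) \<in> tangent (polar x)" for i
    using vx[of i] by (simp add: tangent_def polar_def)
  then have "metric_matrix g x $ i $ j = (x $ i / norm x) * (x $ j / norm x) + (h (norm x - 1))\<^sup>2 * (v i \<bullet> v j)"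
    for i j
    using revolutionD[OF g polar_in_cylinder[OF x, unfolded polar_def]]
    by (simp add: metric_matrix_def fd) (simp add: polar_def)
  moreover have "v i \<bullet> v j = ((if i = j then 1 else 0) - x $ i * x $ j / (norm x)\<^sup>2) / (norm x)\<^sup>2" for i j
  proof -
    have "v i \<bullet> v j = v i \<bullet> ((1 / norm x) *\<^sub>R axis j 1)"
      using vx[of i] by (simp add: v_def[of j] inner_diff_right)
    also have "\<dots> = v i $ j / norm x" by (simp add: inner_axis)
    also have "\<dots> = ((if i = j then 1 else 0) / norm x - x $ i / norm x ^ 3 * x $ j) / norm x"
      by (auto simp: v_def axis_def)
    finally show ?thesis using x0 by (simp add: field_simps power2_eq_square power3_eq_cube)
  qed
  ultimately show ?thesis
    using x0 by (auto simp: vec_eq_iff rank1_def k_def field_simps power2_eq_square)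
qed

section \<open>Second derivatives on open sets\<close>

definition hess :: "('a::real_normed_vector \<Rightarrow> real) \<Rightarrow> 'a \<Rightarrow> 'a \<Rightarrow> 'a \<Rightarrow> real" where
  "hess u x v w = frechet_derivative (\<lambda>y. frechet_derivative u (at y) v) (at x) w"

text \<open>Twice differentiable, without continuity of the second derivative: bilinearity of
  \<open>hess\<close> and the second derivative test rest on this alone.\<close>

definition twice_on :: "'a::real_normed_vector set \<Rightarrow> ('a \<Rightarrow> real) \<Rightarrow> bool" where
  "twice_on S u \<longleftrightarrow> (\<forall>y\<in>S. u differentiable at y \<and>
     (\<forall>v. (\<lambda>z. frechet_derivative u (at z) v) differentiable at y))"

lemma twice_onD:
  assumes "twice_on S u" "x \<in> S"
  shows "(u has_derivative frechet_derivative u (at x)) (at x)"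
    and "((\<lambda>y. frechet_derivative u (at y) v) has_derivative hess u x v) (at x)"
  using assms by (auto simp: twice_on_def hess_def[abs_def] frechet_derivative_works)

text \<open>Supplies \<open>hess\<close> from explicit first and second derivatives.\<close>

lemma twice_onI:
  assumes "open S" "\<forall>x\<in>S. (u has_derivative D x) (at x)"
    and "\<forall>x\<in>S. \<forall>v. ((\<lambda>y. D y v) has_derivative H x v) (at x)"
  shows "twice_on S u" "\<And>x. x \<in> S \<Longrightarrow> frechet_derivative u (at x) = D x"
    "\<And>x v w. x \<in> S \<Longrightarrow> hess u x v w = H x v w"
proof -
  show D: "frechet_derivative u (at x) = D x" if "x \<in> S" for x
    using frechet_derivative_at[OF bspec[OF assms(2) that]] by simp
  have *: "((\<lambda>y. frechet_derivative u (at y) v) has_derivative H x v) (at x)" if "x \<in> S" for x v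
    by (rule has_derivative_transform_within_open[OF assms(3)[rule_format, OF that] assms(1) that]) (simp add: D)
  show "hess u x v w = H x v w" if "x \<in> S" for x v w
    unfolding hess_def using frechet_derivative_at[OF *[OF that]] by metis
  show "twice_on S u" unfolding twice_on_def using assms(2) * by (auto simp: differentiable_def)
qed

text \<open>Linearity in the first direction is not that of a derivative at x. It is inherited from
  the first derivatives, which are linear in the direction throughout the open set, so that the
  identities can be differentiated.\<close>

lemma linear_twice:
  assumes "open S" "twice_on S u" "x \<in> S"
  shows "linear (frechet_derivative u (at x))" "linear (hess u x v)" "linear (\<lambda>v. hess u x v w)"
proof -
  have lin: "linear (frechet_derivative u (at x))" if "x \<in> S" for x
    using twice_onD(1)[OF assms(2) that] by (rule has_derivative_linear)
  show "linear (frechet_derivative u (at x))" by (rule lin[OF assms(3)])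
  show "linear (hess u x v)" using twice_onD(2)[OF assms(2,3)] by (rule has_derivative_linear)
  show "linear (\<lambda>v. hess u x v w)"
  proof
    fix v v' and c :: real
    have "((\<lambda>y. frechet_derivative u (at y) v + frechet_derivative u (at y) v')
        has_derivative (\<lambda>w. hess u x v w + hess u x v' w)) (at x)"
      by (intro has_derivative_add twice_onD(2)[OF assms(2,3)])
    then have "((\<lambda>y. frechet_derivative u (at y) (v + v'))
        has_derivative (\<lambda>w. hess u x v w + hess u x v' w)) (at x)"
      by (rule has_derivative_transform_within_open[OF _ assms(1,3)]) (simp add: linear_add[OF lin])
    then show "hess u x (v + v') w = hess u x v w + hess u x v' w"
      using has_derivative_unique[OF twice_onD(2)[OF assms(2,3)]] by metis
    have "((\<lambda>y. c * frechet_derivative u (at y) v)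
        has_derivative (\<lambda>w. c * hess u x v w)) (at x)"
      by (intro has_derivative_mult_right twice_onD(2)[OF assms(2,3)])
    then have "((\<lambda>y. frechet_derivative u (at y) (c *\<^sub>R v))
        has_derivative (\<lambda>w. c * hess u x v w)) (at x)"
      by (rule has_derivative_transform_within_open[OF _ assms(1,3)]) (simp add: linear_scale[OF lin])
    then show "hess u x (c *\<^sub>R v) w = c *\<^sub>R hess u x v w"
      using has_derivative_unique[OF twice_onD(2)[OF assms(2,3)]] by (metis real_scaleR_def)
  qed
qed

lemma linear_vec_expansion:
  fixes f :: "real^'n::finite \<Rightarrow> real"
  assumes "linear f"
  shows "(\<Sum>i\<in>UNIV. v $ i * f (axis i 1)) = f v"
proof -
  have "f v = f (\<Sum>i\<in>UNIV. v $ i *\<^sub>R axis i 1)"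
    using basis_expansion[of v] by (simp add: scalar_mult_eq_scaleR)
  then show ?thesis by (simp add: linear_sum[OF assms] linear_scale[OF assms])
qed

section \<open>The Laplace-Beltrami operator in polar coordinates\<close>

lemma open_annulus: "open {x::'a::real_normed_vector. a < norm x \<and> norm x < b}"
  by (intro open_Collect_conj open_Collect_less continuous_intros)

lemma radial_has_derivative:
  fixes x :: "'a::real_inner"
  assumes "x \<noteq> 0" "(f has_real_derivative f') (at (norm x))"
  shows "((\<lambda>y. f (norm y)) has_derivative (\<lambda>v. f' * (x \<bullet> v) / norm x)) (at x)"
  using has_derivative_compose[OF has_derivative_norm'[OF assms(1)] assms(2)[unfolded has_field_derivative_def]]
  by simp

text \<open>The flux weights the radial part of the gradient by A and the tangential part by B. The
  derivative B' cancels, because the tangential part is orthogonal to the gradient of the radial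
  weight B.\<close>

lemma flux_divergence:
  fixes x :: "real^'n::finite" and D :: "'n \<Rightarrow> real^'n \<Rightarrow> real"
  assumes x0: "x \<noteq> 0"
    and A: "(A has_real_derivative A') (at (norm x))" and B: "(B has_real_derivative B') (at (norm x))"
    and D: "\<And>i. (D i has_derivative H i) (at x)"
  defines "E \<equiv> \<Sum>j\<in>UNIV. x $ j * D j x" and "\<rho> \<equiv> norm x"
  shows "(\<Sum>i\<in>UNIV. partial i (\<lambda>y. B (norm y) * D i y +
        (A (norm y) - B (norm y)) * (1 / (norm y)\<^sup>2) * (y $ i * (\<Sum>j\<in>UNIV. y $ j * D j y))) x)
    = B \<rho> * (\<Sum>i\<in>UNIV. H i (axis i 1)) + A' * E / \<rho>
      + (A \<rho> - B \<rho>) / \<rho>\<^sup>2 * ((real CARD('n) - 1) * E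
        + (\<Sum>i\<in>UNIV. x $ i * (\<Sum>j\<in>UNIV. x $ j * H j (axis i 1))))"
proof -
  have \<rho>: "\<rho> > 0" using x0 by (simp add: \<rho>_def)
  have dA: "((\<lambda>y. A (norm y)) has_derivative (\<lambda>v. A' * (x \<bullet> v) / \<rho>)) (at x)"
    and dB: "((\<lambda>y. B (norm y)) has_derivative (\<lambda>v. B' * (x \<bullet> v) / \<rho>)) (at x)"
    using radial_has_derivative[OF x0 A] radial_has_derivative[OF x0 B] by (simp_all add: \<rho>_def)
  have "((\<lambda>r. 1 / r\<^sup>2) has_real_derivative - 2 / \<rho> ^ 3) (at (norm x))"
    using \<rho> unfolding \<rho>_def[symmetric]
    by (auto intro!: derivative_eq_intros simp: field_simps power2_eq_square power3_eq_cube)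
  from radial_has_derivative[OF x0 this]
  have dc: "((\<lambda>y. 1 / (norm y)\<^sup>2) has_derivative (\<lambda>v. - 2 * (x \<bullet> v) / \<rho> ^ 4)) (at x)"
    by (simp add: \<rho>_def[symmetric] power4_eq_xxxx power3_eq_cube mult.assoc)
  have dx: "((\<lambda>y. y $ j) has_derivative (\<lambda>v. v $ j)) (at x)" for j
    by (rule bounded_linear.has_derivative[OF bounded_linear_vec_nth has_derivative_ident])
  have dE: "((\<lambda>y. \<Sum>j\<in>UNIV. y $ j * D j y) has_derivative
      (\<lambda>v. \<Sum>j\<in>UNIV. x $ j * H j v + v $ j * D j x)) (at x)"
    by (intro has_derivative_sum has_derivative_mult dx D)
  have sumE: "(\<Sum>j\<in>UNIV. x $ j * D j x) = E" by (simp add: E_def)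
  define Q where "Q i = (\<Sum>j\<in>UNIV. x $ j * H j (axis i 1))" for i
  have dEi: "(\<Sum>j\<in>UNIV. x $ j * H j (axis i 1) + axis i 1 $ j * D j x) = Q i + D i x" for i
    by (simp add: Q_def sum.distrib axis_def if_distrib[of "\<lambda>t. t * _"] cong: if_cong)
  have "partial i (\<lambda>y. B (norm y) * D i y +
        (A (norm y) - B (norm y)) * (1 / (norm y)\<^sup>2) * (y $ i * (\<Sum>j\<in>UNIV. y $ j * D j y))) x
    = B \<rho> * H i (axis i 1) + B' / \<rho> * (x $ i * D i x)
      + (A \<rho> - B \<rho>) / \<rho>\<^sup>2 * (x $ i * Q i + x $ i * D i x + E)
      + ((A' - B') / \<rho> ^ 3 - 2 * (A \<rho> - B \<rho>) / \<rho> ^ 4) * E * (x $ i)\<^sup>2" for i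
  proof -
    note d = has_derivative_add[OF has_derivative_mult[OF dB D[of i]]
        has_derivative_mult[OF has_derivative_mult[OF has_derivative_diff[OF dA dB] dc]
          has_derivative_mult[OF dx[of i] dE]]]
    show ?thesis
      unfolding partial_def frechet_derivative_at[OF d, symmetric] dEi sumE
      using \<rho>
      by (simp add: inner_axis \<rho>_def[symmetric] field_simps power2_eq_square
          power3_eq_cube power4_eq_xxxx)
  qed
  moreover have sq: "(\<Sum>i\<in>UNIV. (x $ i)\<^sup>2) = \<rho>\<^sup>2"
    unfolding \<rho>_def power2_norm_eq_inner inner_vec_def by (simp add: power2_eq_square)
  have "(\<Sum>i\<in>UNIV. c0 * H i (axis i 1) + c1 * (x $ i * D i x)
      + c2 * (x $ i * Q i + x $ i * D i x + E) + c3 * (x $ i)\<^sup>2)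
    = c0 * (\<Sum>i\<in>UNIV. H i (axis i 1)) + c1 * E
      + c2 * ((\<Sum>i\<in>UNIV. x $ i * Q i) + E + CARD('n) * E) + c3 * \<rho>\<^sup>2" for c0 c1 c2 c3
    by (simp only: sum.distrib sum_distrib_left[symmetric] sumE sq sum_constant)
  ultimately have "(\<Sum>i\<in>UNIV. partial i (\<lambda>y. B (norm y) * D i y +
        (A (norm y) - B (norm y)) * (1 / (norm y)\<^sup>2) * (y $ i * (\<Sum>j\<in>UNIV. y $ j * D j y))) x)
    = B \<rho> * (\<Sum>i\<in>UNIV. H i (axis i 1)) + B' / \<rho> * E
      + (A \<rho> - B \<rho>) / \<rho>\<^sup>2 * ((\<Sum>i\<in>UNIV. x $ i * Q i) + E + CARD('n) * E)
      + ((A' - B') / \<rho> ^ 3 - 2 * (A \<rho> - B \<rho>) / \<rho> ^ 4) * E * \<rho>\<^sup>2"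
    by presburger
  also have "\<dots> = B \<rho> * (\<Sum>i\<in>UNIV. H i (axis i 1)) + A' * E / \<rho>
      + (A \<rho> - B \<rho>) / \<rho>\<^sup>2 * ((real CARD('n) - 1) * E + (\<Sum>i\<in>UNIV. x $ i * Q i))"
    using \<rho> by (simp add: divide_simps power2_eq_square power3_eq_cube power4_eq_xxxx) algebra
  finally show ?thesis unfolding Q_def .
qed

text \<open>The summands are u_rr, (m h'/h) u_r and the spherical Laplacian divided by h^2. The last
  is the Euclidean Laplacian minus its radial part, rescaled by |x|^2/h^2.\<close>

lemma laplace_beltrami_revolution:
  fixes x :: "real^'n::finite"
  assumes g: "revolution L h g" and N: "CARD('n) \<ge> 3"
    and h: "\<And>r. r \<in> {0..L} \<Longrightarrow> h r > 0"
    and h': "(h has_real_derivative h') (at (norm x - 1))"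
    and x: "1 < norm x" "norm x < 1 + L"
    and S: "open S" "twice_on S u" "x \<in> S"
  defines "\<rho> \<equiv> norm x" and "m \<equiv> real CARD('n) - 1" and "H \<equiv> h (norm x - 1)"
  shows "laplace_beltrami (metric_matrix g) u x =
      hess u x x x / \<rho>\<^sup>2 + m * h' / H * (frechet_derivative u (at x) x / \<rho>)
      + \<rho>\<^sup>2 / H\<^sup>2 * ((\<Sum>i\<in>UNIV. hess u x (axis i 1) (axis i 1)) - hess u x x x / \<rho>\<^sup>2
          - m * frechet_derivative u (at x) x / \<rho>\<^sup>2)"
proof -
  \<comment> \<open>The volume density is k^(n - 1), and the tangential flux carries a further
    factor k^(-2); n >= 3 keeps both exponents natural.\<close>
  obtain M where M: "CARD('n) - 1 = M + 2" using N that[of "CARD('n) - 3"] by simp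
  have m: "m = real (M + 2)" using M N by (simp add: m_def)
  define k where "k r = h (r - 1) / r" for r
  define A where "A r = k r ^ (M + 2)" for r
  define B where "B r = k r ^ M" for r
  define D where "D i y = partial i u y" for i and y :: "real^'n"
  define V where "V = {y::real^'n. 1 < norm y \<and> norm y < 1 + L}"
  have V: "open V" "x \<in> V" using x by (auto simp: V_def open_annulus)
  have \<rho>: "\<rho> > 0" and x0: "x \<noteq> 0" using x by (auto simp: \<rho>_def)
  have k_pos: "k (norm y) > 0" if "y \<in> V" for y
    using that h[of "norm y - 1"] unfolding k_def V_def by (intro divide_pos_pos) auto
  have det: "sqrt (det (metric_matrix g y)) = A (norm y)"
    and inv: "matrix_inv (metric_matrix g y) = rank1 (1 / (k (norm y))\<^sup>2) (1 - 1 / (k (norm y))\<^sup>2) ((1 / norm y) *\<^sub>R y)"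
    if y: "y \<in> V" for y
  proof -
    have mm: "metric_matrix g y = rank1 ((k (norm y))\<^sup>2) (1 - (k (norm y))\<^sup>2) ((1 / norm y) *\<^sub>R y)"
      using metric_matrix_revolution[OF g, of y] y by (simp add: V_def k_def)
    have n1: "norm ((1 / norm y) *\<^sub>R y) = 1" using y by (auto simp: V_def)
    show "sqrt (det (metric_matrix g y)) = A (norm y)"
      unfolding mm det_rank1[OF n1] M A_def
    proof (rule real_sqrt_unique)
      have "(k (norm y) ^ (M + 2))\<^sup>2 = ((k (norm y))\<^sup>2) ^ (M + 2)" by (metis power_mult mult.commute)
      moreover have "a + (1 - a) = 1" for a :: real by simp
      ultimately show "(k (norm y) ^ (M + 2))\<^sup>2
          = ((k (norm y))\<^sup>2) ^ (M + 2) * ((k (norm y))\<^sup>2 + (1 - (k (norm y))\<^sup>2))"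
        by (simp only: mult_1_right)
      show "0 \<le> k (norm y) ^ (M + 2)" using k_pos[OF y] by (intro zero_le_power less_imp_le)
    qed
    show "matrix_inv (metric_matrix g y) = rank1 (1 / (k (norm y))\<^sup>2) (1 - 1 / (k (norm y))\<^sup>2) ((1 / norm y) *\<^sub>R y)"
      unfolding mm using matrix_inv_rank1[OF n1, of "(k (norm y))\<^sup>2" "1 - (k (norm y))\<^sup>2"] k_pos[OF y]
      by simp
  qed
  have flux: "sqrt (det (metric_matrix g y)) * (\<Sum>j\<in>UNIV. matrix_inv (metric_matrix g y) $ i $ j * partial j u y)
     = B (norm y) * D i y + (A (norm y) - B (norm y)) * (1 / (norm y)\<^sup>2) * (y $ i * (\<Sum>j\<in>UNIV. y $ j * D j y))"
    if y: "y \<in> V" for y i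
  proof -
    define c where "c = 1 / (k (norm y))\<^sup>2"
    have "(\<Sum>j\<in>UNIV. matrix_inv (metric_matrix g y) $ i $ j * partial j u y)
        = (rank1 c (1 - c) ((1 / norm y) *\<^sub>R y) *v (\<chi> j. D j y)) $ i"
      by (simp add: inv[OF y] matrix_vector_mult_def D_def c_def)
    also have "\<dots> = c * D i y + (1 - c) * (1 / (norm y)\<^sup>2) * (y $ i * (\<Sum>j\<in>UNIV. y $ j * D j y))"
      unfolding rank1_mult_vec by (simp add: inner_vec_def power2_eq_square sum_divide_distrib[symmetric])
    finally have S: "A (norm y) * (\<Sum>j\<in>UNIV. matrix_inv (metric_matrix g y) $ i $ j * partial j u y)
      = A (norm y) * (c * D i y + (1 - c) * (1 / (norm y)\<^sup>2) * (y $ i * (\<Sum>j\<in>UNIV. y $ j * D j y)))"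
      by presburger
    have Bc: "B (norm y) = A (norm y) * c"
      using k_pos[OF y] by (simp add: c_def A_def B_def power_add power2_eq_square)
    show ?thesis unfolding det[OF y] S Bc by algebra
  qed
  have "partial i (\<lambda>y. sqrt (det (metric_matrix g y)) * (\<Sum>j\<in>UNIV. matrix_inv (metric_matrix g y) $ i $ j * partial j u y)) x
     = partial i (\<lambda>y. B (norm y) * D i y + (A (norm y) - B (norm y)) * (1 / (norm y)\<^sup>2) * (y $ i * (\<Sum>j\<in>UNIV. y $ j * D j y))) x" for i
    unfolding partial_def[of i] using frechet_derivative_cong_open[OF V flux] by simp
  then have LB: "laplace_beltrami (metric_matrix g) u x =
      (\<Sum>i\<in>UNIV. partial i (\<lambda>y. B (norm y) * D i y + (A (norm y) - B (norm y)) * (1 / (norm y)\<^sup>2) * (y $ i * (\<Sum>j\<in>UNIV. y $ j * D j y))) x) / A \<rho>"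
    by (simp add: laplace_beltrami_def det[OF V(2)] \<rho>_def)
  define k' where "k' = h' / \<rho> - H / \<rho>\<^sup>2"
  have "((\<lambda>r. h (r - 1)) has_real_derivative h') (at (norm x))"
    using h' DERIV_shift[of h h' "norm x" "-1"] by simp
  then have dk: "(k has_real_derivative k') (at (norm x))"
    unfolding k_def k'_def using \<rho>
    by (auto intro!: derivative_eq_intros simp: \<rho>_def H_def field_simps power2_eq_square)
  have dA: "(A has_real_derivative m * k \<rho> ^ (M + 1) * k') (at (norm x))"
    unfolding A_def using DERIV_power[OF dk, of "M + 2"] by (simp add: m \<rho>_def mult_ac)
  have dB: "(B has_real_derivative real M * k \<rho> ^ (M - 1) * k') (at (norm x))"
    unfolding B_def using DERIV_power[OF dk, of "M"] by (simp add: \<rho>_def mult_ac)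
  have dD: "(D i has_derivative hess u x (axis i 1)) (at x)" for i
    unfolding D_def partial_def using twice_onD(2)[OF S(2,3)] .
  have lin: "linear (frechet_derivative u (at x))" "linear (hess u x x)" "\<And>w. linear (\<lambda>v. hess u x v w)"
    using linear_twice[OF S] by auto
  have E: "(\<Sum>j\<in>UNIV. x $ j * D j x) = frechet_derivative u (at x) x"
    unfolding D_def partial_def by (rule linear_vec_expansion[OF lin(1)])
  have Q: "(\<Sum>i\<in>UNIV. x $ i * (\<Sum>j\<in>UNIV. x $ j * hess u x (axis j 1) (axis i 1))) = hess u x x x"
    unfolding linear_vec_expansion[OF lin(3)] linear_vec_expansion[OF lin(2)] ..
  have kp: "k \<rho> > 0" using k_pos[OF V(2)] by (simp add: \<rho>_def)
  have kH: "H = k \<rho> * \<rho>" using \<rho> by (simp add: k_def H_def \<rho>_def)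
  have "laplace_beltrami (metric_matrix g) u x = (B \<rho> * (\<Sum>i\<in>UNIV. hess u x (axis i 1) (axis i 1))
      + m * k \<rho> ^ (M + 1) * k' * frechet_derivative u (at x) x / \<rho>
      + (A \<rho> - B \<rho>) / \<rho>\<^sup>2 * (m * frechet_derivative u (at x) x + hess u x x x)) / A \<rho>"
    unfolding LB flux_divergence[OF x0 dA dB dD] E Q by (simp add: \<rho>_def m_def)
  also have "\<dots> = hess u x x x / \<rho>\<^sup>2 + m * h' / H * (frechet_derivative u (at x) x / \<rho>)
      + \<rho>\<^sup>2 / H\<^sup>2 * ((\<Sum>i\<in>UNIV. hess u x (axis i 1) (axis i 1)) - hess u x x x / \<rho>\<^sup>2
          - m * frechet_derivative u (at x) x / \<rho>\<^sup>2)"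
    unfolding k'_def kH A_def B_def using kp \<rho>
    by (simp add: divide_simps power_add power2_eq_square) algebra
  finally show ?thesis .
qed

text \<open>h lives on an open interval around [0, L], so that \<open>deriv h\<close> is a two-sided
  derivative even at the ends.\<close>

locale profile =
  fixes L a b m :: real and h :: "real \<Rightarrow> real" and g :: "'n::finite metric"
  assumes L_pos: "L > 0" and a_neg: "a < 0" and L_less: "L < b"
    and dim: "CARD('n) \<ge> 3" and m_eq: "m = real CARD('n) - 1"
    and h_smooth: "\<And>k. Ck_on k {a<..<b} h"
    and h_pos: "\<And>r. r \<in> {a<..<b} \<Longrightarrow> h r > 0"
    and metric: "revolution L h g"
begin

lemma h_deriv: "r \<in> {a<..<b} \<Longrightarrow> (h has_real_derivative deriv h r) (at r)"
  using Ck_on_real_deriv(2)[OF h_smooth[of "Suc 0"]] by auto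

lemma interval: "r \<in> {0..L} \<Longrightarrow> r \<in> {a<..<b}"
  using a_neg L_less by auto

abbreviation laplace :: "(real^'n \<Rightarrow> real) \<Rightarrow> real^'n \<Rightarrow> real" where
  "laplace \<equiv> laplace_beltrami (metric_matrix g)"

abbreviation annulus :: "(real^'n) set" where
  "annulus \<equiv> {x. 1 < norm x \<and> norm x < 1 + L}"

lemma laplace_formula:
  fixes x :: "real^'n::finite"
  assumes "x \<in> annulus" "open S" "twice_on S u" "x \<in> S"
  shows "laplace u x =
      hess u x x x / (norm x)\<^sup>2
      + m * deriv h (norm x - 1) / h (norm x - 1) * (frechet_derivative u (at x) x / norm x)
      + (norm x)\<^sup>2 / (h (norm x - 1))\<^sup>2 * ((\<Sum>i\<in>UNIV. hess u x (axis i 1) (axis i 1))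
          - hess u x x x / (norm x)\<^sup>2 - m * frechet_derivative u (at x) x / (norm x)\<^sup>2)"
  using assms h_pos interval unfolding m_eq
  by (intro laplace_beltrami_revolution[OF metric dim _ h_deriv _ _ assms(2-4)]) auto

end

lemma twice_on_diff:
  assumes "open S" "twice_on S u" "twice_on S w"
  shows "twice_on S (\<lambda>y. u y - c * w y)"
    and "\<And>x v. x \<in> S \<Longrightarrow> frechet_derivative (\<lambda>y. u y - c * w y) (at x) v
      = frechet_derivative u (at x) v - c * frechet_derivative w (at x) v"
    and "\<And>x v z. x \<in> S \<Longrightarrow> hess (\<lambda>y. u y - c * w y) x v z = hess u x v z - c * hess w x v z"
proof -
  have D: "\<forall>x\<in>S. ((\<lambda>y. u y - c * w y) has_derivative
      (\<lambda>v. frechet_derivative u (at x) v - c * frechet_derivative w (at x) v)) (at x)"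
    by (intro ballI has_derivative_diff has_derivative_mult_right twice_onD(1)[OF assms(2)]
        twice_onD(1)[OF assms(3)])
  have H: "\<forall>x\<in>S. \<forall>v. ((\<lambda>y. frechet_derivative u (at y) v - c * frechet_derivative w (at y) v)
      has_derivative (\<lambda>z. hess u x v z - c * hess w x v z)) (at x)"
    by (intro ballI allI has_derivative_diff has_derivative_mult_right twice_onD(2)[OF assms(2)]
        twice_onD(2)[OF assms(3)])
  note T = twice_onI[OF assms(1) D H]
  show "twice_on S (\<lambda>y. u y - c * w y)" by (rule T(1))
  show "frechet_derivative (\<lambda>y. u y - c * w y) (at x) v
      = frechet_derivative u (at x) v - c * frechet_derivative w (at x) v" if "x \<in> S" for x v
    using T(2)[OF that] by metis
  show "hess (\<lambda>y. u y - c * w y) x v z = hess u x v z - c * hess w x v z" if "x \<in> S" for x v z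
    by (rule T(3)[OF that])
qed

text \<open>One formula for two uses: c = -1/|x|^2 projects the coordinate vectors off x, and c = -2
  with |x| = 1 reflects them, in which case the correction term vanishes.\<close>

lemma trace_rank1_perturbation:
  fixes B :: "real^'n::finite \<Rightarrow> real^'n \<Rightarrow> real"
  assumes "\<And>v. linear (B v)" "\<And>w. linear (\<lambda>v. B v w)"
  shows "(\<Sum>i\<in>UNIV. B (axis i 1 + (c * x $ i) *\<^sub>R x) (axis i 1 + (c * x $ i) *\<^sub>R x))
    = (\<Sum>i\<in>UNIV. B (axis i 1) (axis i 1)) + (2 * c + c\<^sup>2 * (norm x)\<^sup>2) * B x x"
proof -
  have "B (axis i 1 + (c * x $ i) *\<^sub>R x) (axis i 1 + (c * x $ i) *\<^sub>R x)
      = B (axis i 1) (axis i 1) + c * (x $ i * B (axis i 1) x) + c * (x $ i * B x (axis i 1))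
        + c\<^sup>2 * B x x * (x $ i * x $ i)" for i
    using linear_add[OF assms(1)] linear_add[OF assms(2)] linear_scale[OF assms(1)] linear_scale[OF assms(2)]
    by (simp add: algebra_simps power2_eq_square)
  moreover have "(\<Sum>i\<in>UNIV. x $ i * x $ i) = (norm x)\<^sup>2"
    unfolding power2_norm_eq_inner inner_vec_def by simp
  ultimately show ?thesis
    by (simp add: sum.distrib sum_distrib_left[symmetric] linear_vec_expansion[OF assms(1)]
        linear_vec_expansion[OF assms(2)]) (simp add: algebra_simps)
qed

text \<open>Were the second derivative along v positive, the first derivative along this line, which
  is 0 at x, would be positive shortly after; by the mean value theorem u would then exceed its
  maximum.\<close>

lemma hess_nonpos_at_max:
  assumes S: "open S" "twice_on S u" "x \<in> S" and max: "\<And>y. y \<in> S \<Longrightarrow> u y \<le> u x"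
  shows "hess u x v v \<le> 0"
proof (rule ccontr)
  assume "\<not> ?thesis"
  then have pos: "hess u x v v > 0" by simp
  have D0: "frechet_derivative u (at x) = (\<lambda>v. 0)"
    using differential_zero_maxmin[OF S(3,1) twice_onD(1)[OF S(2,3)]] max by blast
  have line: "((\<lambda>t. x + t *\<^sub>R v) has_derivative (\<lambda>t. t *\<^sub>R v)) (at s)" for s :: real
    by (auto intro!: derivative_eq_intros)
  define G where "G t = frechet_derivative u (at (x + t *\<^sub>R v)) v" for t
  have "((\<lambda>t. frechet_derivative u (at (x + t *\<^sub>R v)) v) has_derivative (\<lambda>t. hess u x v (t *\<^sub>R v))) (at 0)"
    using has_derivative_compose[OF line[of 0], of "\<lambda>y. frechet_derivative u (at y) v" "hess u x v"]
      twice_onD(2)[OF S(2,3)] by simp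
  moreover have "hess u x v (t *\<^sub>R v) = hess u x v v * t" for t
    using linear_scale[OF linear_twice(2)[OF S]] by simp
  ultimately have "(G has_real_derivative hess u x v v) (at 0)"
    by (simp add: G_def[abs_def] has_field_derivative_def)
  then obtain d1 where d1: "d1 > 0" "\<And>t. 0 < t \<Longrightarrow> t < d1 \<Longrightarrow> G 0 < G t"
    using DERIV_pos_inc_right[of G "hess u x v v" 0] pos by auto
  have "open ((\<lambda>t::real. x + t *\<^sub>R v) -` S)"
    by (intro open_vimage S continuous_intros)
  then obtain d2 where d2: "d2 > 0" "ball (0::real) d2 \<subseteq> (\<lambda>t. x + t *\<^sub>R v) -` S"
    using openE[of "(\<lambda>t::real. x + t *\<^sub>R v) -` S" 0] S(3) by auto
  define t where "t = min d1 d2 / 2"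
  have t: "0 < t" "t < d1" "t < d2" using d1 d2 by (auto simp: t_def)
  have inS: "x + s *\<^sub>R v \<in> S" if "0 \<le> s" "s \<le> t" for s
    using subsetD[OF d2(2), of s] that t by simp
  have der: "((\<lambda>s. u (x + s *\<^sub>R v)) has_real_derivative G s) (at s)" if "0 \<le> s" "s \<le> t" for s
  proof -
    have "((\<lambda>s. u (x + s *\<^sub>R v)) has_derivative (\<lambda>r. frechet_derivative u (at (x + s *\<^sub>R v)) (r *\<^sub>R v))) (at s)"
      by (rule has_derivative_compose[OF line twice_onD(1)[OF S(2) inS[OF that]]])
    moreover have "frechet_derivative u (at (x + s *\<^sub>R v)) (r *\<^sub>R v) = G s * r" for r
      using linear_scale[OF linear_twice(1)[OF S(1,2) inS[OF that]]] by (simp add: G_def)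
    ultimately show ?thesis by (simp add: has_field_derivative_def)
  qed
  obtain z where z: "0 < z" "z < t" "u (x + t *\<^sub>R v) - u (x + 0 *\<^sub>R v) = (t - 0) * G z"
    using MVT2[OF t(1) der] by blast
  have "G z > 0" using d1(2)[of z] z t D0 by (simp add: G_def)
  then have "u (x + t *\<^sub>R v) > u x" using z(3) mult_pos_pos[OF t(1)] by fastforce
  then show False using max[OF inS[of t]] t by simp
qed

section \<open>The Laplacian at a maximum\<close>

context profile
begin

lemma laplace_diff:
  assumes "x \<in> annulus" "open S" "x \<in> S" "twice_on S u" "twice_on S w"
  shows "laplace (\<lambda>y. u y - c * w y) x
    = laplace u x - c * laplace w x"
  unfolding laplace_formula[OF assms(1,2,4,3)] laplace_formula[OF assms(1,2,5,3)]
    laplace_formula[OF assms(1,2) twice_on_diff(1)[OF assms(2,4,5)] assms(3)]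
    twice_on_diff(2,3)[OF assms(2,4,5,3)] sum_subtractf sum_distrib_left[symmetric]
  by (simp add: diff_divide_distrib algebra_simps)

text \<open>First-order terms vanish. The radial part is a diagonal value of the Hessian, and the
  tangential part is the sum of its diagonal values at the projections of the coordinate vectors off
  x.\<close>

lemma laplace_nonpos_at_max:
  assumes x: "x \<in> annulus" and S: "open S" "twice_on S u" "x \<in> S"
    and max: "\<And>y. y \<in> S \<Longrightarrow> u y \<le> u x"
  shows "laplace u x \<le> 0"
proof -
  have D0: "frechet_derivative u (at x) x = 0"
    using differential_zero_maxmin[OF S(3,1) twice_onD(1)[OF S(2,3)]] max by metis
  have n: "norm x > 0" using x by auto
  have nonpos: "hess u x v v \<le> 0" for v
    by (rule hess_nonpos_at_max[OF S max])
  have "(\<Sum>i\<in>UNIV. hess u x (axis i 1) (axis i 1)) - hess u x x x / (norm x)\<^sup>2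
     = (\<Sum>i\<in>UNIV. hess u x (axis i 1 + (- (1 / (norm x)\<^sup>2) * x $ i) *\<^sub>R x)
          (axis i 1 + (- (1 / (norm x)\<^sup>2) * x $ i) *\<^sub>R x))"
    unfolding trace_rank1_perturbation[OF linear_twice(2,3)[OF S]]
    using n by (simp add: field_simps power2_eq_square)
  also have "\<dots> \<le> 0" by (intro sum_nonpos nonpos)
  finally have "(\<Sum>i\<in>UNIV. hess u x (axis i 1) (axis i 1)) - hess u x x x / (norm x)\<^sup>2 \<le> 0" .
  then have "(norm x)\<^sup>2 / (h (norm x - 1))\<^sup>2 *
      ((\<Sum>i\<in>UNIV. hess u x (axis i 1) (axis i 1)) - hess u x x x / (norm x)\<^sup>2) \<le> 0"
    by (intro mult_nonneg_nonpos) auto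
  moreover have "hess u x x x / (norm x)\<^sup>2 \<le> 0" using nonpos by (intro divide_nonpos_nonneg) auto
  ultimately show ?thesis
    unfolding laplace_formula[OF x S] by (simp add: D0)
qed

end

section \<open>Invariance under reflections\<close>

definition reflection :: "'a::real_inner \<Rightarrow> 'a \<Rightarrow> 'a" where
  "reflection e y = y - (2 * (y \<bullet> e)) *\<^sub>R e"

lemma reflection_linear: "bounded_linear (reflection e)"
  unfolding reflection_def
  by (intro bounded_linear_intros bounded_linear_sub bounded_linear_ident bounded_linear_scaleR_const
      bounded_linear_const_mult bounded_linear_inner_left)

lemma norm_reflection: "norm e = 1 \<Longrightarrow> norm (reflection e y) = norm y"
  by (simp add: norm_eq_sqrt_inner reflection_def inner_diff_left inner_diff_right inner_commute algebra_simps norm_eq_1)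

context profile
begin

text \<open>The reflection preserves everything in \<open>laplace_formula\<close>: the radius, the
  radial derivatives and, being orthogonal, the trace of the Hessian.\<close>

lemma laplace_reflection:
  assumes e: "norm e = 1" and u: "twice_on annulus u"
  shows "twice_on annulus (\<lambda>y. u (reflection e y))"
    and "\<And>x. x \<in> annulus \<Longrightarrow> laplace (\<lambda>y. u (reflection e y)) x
      = laplace u (reflection e x)"
proof -
  let ?R = "reflection e :: real^'n \<Rightarrow> real^'n"
  have R: "?R x \<in> annulus" if "x \<in> annulus" for x using that by (simp add: norm_reflection[OF e])
  have dR: "(?R has_derivative ?R) (at x)" for x
    by (rule bounded_linear.has_derivative[OF reflection_linear has_derivative_ident])
  have D: "\<forall>x\<in>annulus. ((\<lambda>y. u (?R y)) has_derivative
      (\<lambda>v. frechet_derivative u (at (?R x)) (?R v))) (at x)"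
    using has_derivative_compose[OF dR twice_onD(1)[OF u R]] by blast
  have H: "\<forall>x\<in>annulus. \<forall>v. ((\<lambda>y. frechet_derivative u (at (?R y)) (?R v)) has_derivative
      (\<lambda>w. hess u (?R x) (?R v) (?R w))) (at x)"
    using has_derivative_compose[OF dR twice_onD(2)[OF u R]] by blast
  note T = twice_onI[OF open_annulus D H]
  show "twice_on annulus (\<lambda>y. u (?R y))" by (rule T(1))
  show "laplace (\<lambda>y. u (?R y)) x = laplace u (?R x)"
    if x: "x \<in> annulus" for x
  proof -
    have "?R (axis i 1) = axis i 1 + (- 2 * e $ i) *\<^sub>R e" for i
      by (simp add: reflection_def inner_axis')
    then have "(\<Sum>i\<in>UNIV. hess u (?R x) (?R (axis i 1)) (?R (axis i 1)))
        = (\<Sum>i\<in>UNIV. hess u (?R x) (axis i 1) (axis i 1))"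
      using trace_rank1_perturbation[OF linear_twice(2,3)[OF open_annulus u R[OF x]], of "-2" e] e
      by simp
    then show ?thesis
      unfolding laplace_formula[OF x open_annulus T(1) x] laplace_formula[OF R[OF x] open_annulus u R[OF x]]
        T(2)[OF x] T(3)[OF x] norm_reflection[OF e] by simp
  qed
qed

end

section \<open>Products of a radial and a zonal function\<close>

context profile
begin

text \<open>t is the cosine of the angle to e, and (1 - t^2) \<phi>'' - m t \<phi>' is the Laplacian
  of a zonal function on the unit sphere. Constants and t are its eigenfunctions for 0 and
  -m.\<close>

lemma laplace_separated:
  fixes e :: "real^'n"
  assumes e: "norm e = 1"
    and f: "\<And>r. r \<in> {0<..<L} \<Longrightarrow> (f has_real_derivative f1 r) (at r)"
    and f1: "\<And>r. r \<in> {0<..<L} \<Longrightarrow> (f1 has_real_derivative f2 r) (at r)"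
    and \<phi>: "\<And>t. (\<phi> has_real_derivative \<phi>1 t) (at t)"
    and \<phi>1: "\<And>t. (\<phi>1 has_real_derivative \<phi>2 t) (at t)"
  defines "u \<equiv> \<lambda>x::real^'n. f (norm x - 1) * \<phi> ((x \<bullet> e) / norm x)"
  shows "twice_on annulus u"
    and "\<And>x r t. x \<in> annulus \<Longrightarrow> r = norm x - 1 \<Longrightarrow> t = (x \<bullet> e) / norm x \<Longrightarrow>
      laplace u x
      = (f2 r + m * deriv h r / h r * f1 r) * \<phi> t
        + f r / (h r)\<^sup>2 * ((1 - t\<^sup>2) * \<phi>2 t - m * t * \<phi>1 t)"
proof -
  \<comment> \<open>With N for 1/|x|, all derivatives below are polynomials in N and inner products,
    multiplied by derivatives of f and \<phi>.\<close>
  define N where "N x = inverse (norm x)" for x :: "real^'n"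
  define T where "T x = (x \<bullet> e) * N x" for x :: "real^'n"
  define \<tau> where "\<tau> x v = (e \<bullet> v) * N x - (x \<bullet> e) * (x \<bullet> v) * N x ^ 3" for x v :: "real^'n"
  define D where "D x v = f1 (norm x - 1) * \<phi> (T x) * ((x \<bullet> v) * N x)
      + f (norm x - 1) * \<phi>1 (T x) * \<tau> x v" for x v
  define H where "H x v w =
      (f2 (norm x - 1) * \<phi> (T x) * ((x \<bullet> w) * N x) + f1 (norm x - 1) * \<phi>1 (T x) * \<tau> x w) * ((x \<bullet> v) * N x)
      + f1 (norm x - 1) * \<phi> (T x) * ((v \<bullet> w) * N x - (x \<bullet> v) * (x \<bullet> w) * N x ^ 3)
      + (f1 (norm x - 1) * \<phi>1 (T x) * ((x \<bullet> w) * N x) + f (norm x - 1) * \<phi>2 (T x) * \<tau> x w) * \<tau> x v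
      + f (norm x - 1) * \<phi>1 (T x) * (3 * (x \<bullet> e) * (x \<bullet> v) * (x \<bullet> w) * N x ^ 5
          - ((e \<bullet> v) * (x \<bullet> w) + (e \<bullet> w) * (x \<bullet> v) + (x \<bullet> e) * (v \<bullet> w)) * N x ^ 3)" for x v w
  have x0: "x \<noteq> 0" "norm x > 0" if "x \<in> annulus" for x :: "real^'n" using that by auto
  have rad: "((\<lambda>y. F (norm y - 1)) has_derivative (\<lambda>w. F' (norm x - 1) * ((x \<bullet> w) * N x))) (at x)"
    if x: "x \<in> annulus" and F: "\<And>r. r \<in> {0<..<L} \<Longrightarrow> (F has_real_derivative F' r) (at r)"
    for F F' and x :: "real^'n"
  proof -
    have "((\<lambda>r. F (r - 1)) has_real_derivative F' (norm x - 1)) (at (norm x))"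
      using F[of "norm x - 1"] x DERIV_shift[of F "F' (norm x - 1)" "norm x" "-1"] by simp
    from radial_has_derivative[OF x0(1)[OF x] this] show ?thesis
      by (simp add: N_def divide_inverse mult.assoc)
  qed
  have pw: "((\<lambda>y. N y ^ k) has_derivative (\<lambda>w. - real k * (x \<bullet> w) * N x ^ (k + 2))) (at x)"
    if x: "x \<in> annulus" for k and x :: "real^'n"
  proof -
    have 1: "((\<lambda>r. inverse r ^ k) has_real_derivative
        real k * (- (inverse (norm x) ^ 2)) * inverse (norm x) ^ (k - 1)) (at (norm x))"
      using x0[OF x] by (auto intro!: derivative_eq_intros simp: power2_eq_square)
    have 2: "real k * (- (inverse (norm x) ^ 2)) * inverse (norm x) ^ (k - 1)
        = - real k * inverse (norm x) ^ (k + 1)"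
      by (cases k) (simp_all add: power2_eq_square algebra_simps)
    from radial_has_derivative[OF x0(1)[OF x] DERIV_cong[OF 1 2]] show ?thesis
      by (simp add: N_def divide_inverse mult_ac)
  qed
  have dT: "(T has_derivative \<tau> x) (at x)" if x: "x \<in> annulus" for x
  proof -
    have "((\<lambda>y. (y \<bullet> e) * N y ^ 1) has_derivative
        (\<lambda>w. (x \<bullet> e) * (- real 1 * (x \<bullet> w) * N x ^ (1 + 2)) + (w \<bullet> e) * N x ^ 1)) (at x)"
      by (intro has_derivative_mult pw[OF x] has_derivative_inner_left has_derivative_ident)
    then show ?thesis
      by (simp add: T_def[abs_def] \<tau>_def[abs_def] inner_commute algebra_simps power3_eq_cube)
  qed
  have comp: "((\<lambda>y. F (T y)) has_derivative (\<lambda>w. F' (T x) * \<tau> x w)) (at x)"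
    if x: "x \<in> annulus" and F: "\<And>t. (F has_real_derivative F' t) (at t)" for F F' x
    using has_derivative_compose[OF dT[OF x] F[unfolded has_field_derivative_def]] by simp
  have d\<tau>: "((\<lambda>y. \<tau> y v) has_derivative (\<lambda>w. 3 * (x \<bullet> e) * (x \<bullet> v) * (x \<bullet> w) * N x ^ 5
          - ((e \<bullet> v) * (x \<bullet> w) + (e \<bullet> w) * (x \<bullet> v) + (x \<bullet> e) * (v \<bullet> w)) * N x ^ 3)) (at x)"
    if x: "x \<in> annulus" for x v
  proof -
    have "((\<lambda>y. (e \<bullet> v) * N y ^ 1 - (y \<bullet> e) * (y \<bullet> v) * N y ^ 3) has_derivative
        (\<lambda>w. (e \<bullet> v) * (- real 1 * (x \<bullet> w) * N x ^ (1 + 2))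
          - ((x \<bullet> e) * (x \<bullet> v) * (- real 3 * (x \<bullet> w) * N x ^ (3 + 2))
             + ((x \<bullet> e) * (w \<bullet> v) + (w \<bullet> e) * (x \<bullet> v)) * N x ^ 3))) (at x)"
      by (intro has_derivative_mult has_derivative_diff has_derivative_mult_right pw[OF x]
          has_derivative_inner_left has_derivative_ident)
    then show ?thesis
      by (simp add: \<tau>_def[abs_def] inner_commute algebra_simps power3_eq_cube)
  qed
  have dv: "((\<lambda>y. (y \<bullet> v) * N y) has_derivative
      (\<lambda>w. (v \<bullet> w) * N x - (x \<bullet> v) * (x \<bullet> w) * N x ^ 3)) (at x)" if x: "x \<in> annulus" for x v
  proof -
    have "((\<lambda>y. (y \<bullet> v) * N y ^ 1) has_derivative
        (\<lambda>w. (x \<bullet> v) * (- real 1 * (x \<bullet> w) * N x ^ (1 + 2)) + (w \<bullet> v) * N x ^ 1)) (at x)"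
      by (intro has_derivative_mult pw[OF x] has_derivative_inner_left has_derivative_ident)
    then show ?thesis
      by (simp add: inner_commute algebra_simps power3_eq_cube)
  qed
  have u_eq: "u = (\<lambda>y. f (norm y - 1) * \<phi> (T y))" by (simp add: u_def T_def N_def divide_inverse)
  have dD: "\<forall>x\<in>annulus. (u has_derivative D x) (at x)"
  proof
    fix x assume x: "x \<in> annulus"
    show "(u has_derivative D x) (at x)"
      unfolding u_eq using has_derivative_mult[OF rad[OF x f] comp[OF x \<phi>]]
      by (simp add: D_def[abs_def] algebra_simps)
  qed
  have dH: "\<forall>x\<in>annulus. \<forall>v. ((\<lambda>y. D y v) has_derivative H x v) (at x)"
  proof (intro ballI allI)
    fix x v assume x: "x \<in> annulus"
    have rf1: "((\<lambda>y. f1 (norm y - 1)) has_derivative (\<lambda>w. f2 (norm x - 1) * ((x \<bullet> w) * N x))) (at x)"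
      and rf: "((\<lambda>y. f (norm y - 1)) has_derivative (\<lambda>w. f1 (norm x - 1) * ((x \<bullet> w) * N x))) (at x)"
      by (rule rad[OF x f1], assumption) (rule rad[OF x f], assumption)
    show "((\<lambda>y. D y v) has_derivative H x v) (at x)"
      unfolding D_def
      by (rule has_derivative_eq_rhs[OF has_derivative_add[OF
            has_derivative_mult[OF has_derivative_mult[OF rf1 comp[OF x \<phi>]] dv[OF x]]
            has_derivative_mult[OF has_derivative_mult[OF rf comp[OF x \<phi>1]] d\<tau>[OF x]]]])
         (simp add: fun_eq_iff H_def algebra_simps)
  qed
  note T = twice_onI[OF open_annulus dD dH]
  show "twice_on annulus u" by (rule T(1))
  fix x r t assume x: "x \<in> annulus" and r: "r = norm x - 1" and t: "t = (x \<bullet> e) / norm x"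
  define \<rho> where "\<rho> = norm x"
  have \<rho>: "\<rho> > 0" using x by (auto simp: \<rho>_def)
  have xx: "x \<bullet> x = \<rho>\<^sup>2" by (simp add: \<rho>_def power2_norm_eq_inner)
  have xe: "x \<bullet> e = t * \<rho>" "e \<bullet> x = t * \<rho>" using \<rho> by (simp_all add: t \<rho>_def inner_commute)
  have hr: "h r > 0" using x a_neg L_less by (intro h_pos) (auto simp: r)
  have rr: "\<rho> - 1 = r" by (simp add: \<rho>_def r)
  have Tx: "T x = t" by (simp add: T_def t N_def divide_inverse)
  have Nx: "N x = 1 / \<rho>" by (simp add: N_def \<rho>_def divide_inverse)
  have \<tau>x: "\<tau> x x = 0"
    using \<rho> by (simp add: \<tau>_def Nx xx xe field_simps power2_eq_square power3_eq_cube)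
  have Dx: "D x x = f1 r * \<phi> t * \<rho>"
    using \<rho> by (simp add: D_def \<tau>x Tx \<rho>_def[symmetric] rr Nx xx power2_eq_square)
  have Hx: "H x x x = f2 r * \<phi> t * \<rho>\<^sup>2"
    using \<rho> unfolding H_def \<tau>x Tx Nx \<rho>_def[symmetric] rr xx xe
    by (simp add: field_simps power_numeral_reduce)
  have \<tau>i: "\<tau> x (axis i 1) = e $ i / \<rho> - t / \<rho>\<^sup>2 * x $ i" for i
    using \<rho> by (simp add: \<tau>_def Nx xe inner_axis field_simps power2_eq_square power3_eq_cube)
  have Hi: "H x (axis i 1) (axis i 1) = (f2 r * \<phi> t / \<rho>\<^sup>2 - f1 r * \<phi> t / \<rho> ^ 3
        - 2 * f1 r * \<phi>1 t * t / \<rho> ^ 3 + f r * \<phi>2 t * t\<^sup>2 / \<rho> ^ 4 + 3 * f r * \<phi>1 t * t / \<rho> ^ 4) * (x $ i * x $ i)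
      + (2 * f1 r * \<phi>1 t / \<rho>\<^sup>2 - 2 * f r * \<phi>2 t * t / \<rho> ^ 3 - 2 * f r * \<phi>1 t / \<rho> ^ 3) * (x $ i * e $ i)
      + f r * \<phi>2 t / \<rho>\<^sup>2 * (e $ i * e $ i) + (f1 r * \<phi> t / \<rho> - f r * \<phi>1 t * t / \<rho>\<^sup>2)" for i
  proof -
    define n where "n = 1 / \<rho>"
    have n: "1 / \<rho> = n" "c / \<rho> ^ k = c * n ^ k" "c / \<rho> = c * n" for c k
      by (simp_all add: n_def power_one_over divide_inverse power_inverse)
    have \<rho>n: "\<rho> * n ^ 5 = n ^ 4" "\<rho> * n ^ 3 = n\<^sup>2"
      using \<rho> by (simp_all add: n_def power_numeral_reduce)
    have "t * \<rho> * n ^ 5 = t * n ^ 4" "t * \<rho> * n ^ 3 = t * n\<^sup>2"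
      using \<rho>n by (simp_all add: mult.assoc)
    then show ?thesis
      unfolding H_def \<tau>i Tx Nx \<rho>_def[symmetric] rr xe n
      by (simp add: inner_axis) algebra
  qed
  have sums: "(\<Sum>i\<in>UNIV. x $ i * x $ i) = \<rho>\<^sup>2" "(\<Sum>i\<in>UNIV. x $ i * e $ i) = t * \<rho>"
    "(\<Sum>i\<in>UNIV. e $ i * e $ i) = 1"
    using xx xe e by (simp_all add: inner_vec_def norm_eq_1)
  have card: "real CARD('n) = m + 1" by (simp add: m_eq)
  have tr: "(\<Sum>i\<in>UNIV. H x (axis i 1) (axis i 1)) = f2 r * \<phi> t + m * f1 r * \<phi> t / \<rho>
      + f r / \<rho>\<^sup>2 * ((1 - t\<^sup>2) * \<phi>2 t - m * t * \<phi>1 t)"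
    unfolding Hi sum.distrib sum_distrib_left[symmetric] sums sum_constant card
    using \<rho> by (simp add: field_simps power_numeral_reduce)
  show "laplace u x
      = (f2 r + m * deriv h r / h r * f1 r) * \<phi> t
        + f r / (h r)\<^sup>2 * ((1 - t\<^sup>2) * \<phi>2 t - m * t * \<phi>1 t)"
    unfolding laplace_formula[OF x open_annulus T(1) x] T(2)[OF x] T(3)[OF x] tr Dx Hx
      \<rho>_def[symmetric] rr
    using \<rho> hr by (simp add: field_simps power2_eq_square)
qed

end

text \<open>Derivatives are taken of an extension \<open>F\<close>, since f has prescribed values
  only on the cylinder, a set without interior.\<close>

lemma twice_on_comp_polar:
  fixes f :: "real \<times> (real^'n::finite) \<Rightarrow> real"
  assumes "smooth_on (cylinder L) f"
  shows "twice_on {x. 1 < norm x \<and> norm x < 1 + L} (f \<circ> polar)"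
proof -
  let ?V = "{x::real^'n. 1 < norm x \<and> norm x < 1 + L}"
  obtain U F where UF: "open U" "cylinder L \<subseteq> U" "\<And>k. Ck_on k U F" "\<And>q. q \<in> cylinder L \<Longrightarrow> F q = f q"
    using assms unfolding smooth_on_def by blast
  have V: "open ?V" by (rule open_annulus)
  have pU: "polar x \<in> U" and eq: "(f \<circ> polar) x = F (polar x)" if "x \<in> ?V" for x
    using polar_in_cylinder[of x L] that UF by auto
  define P where "P x v = ((x \<bullet> v) / norm x, (1 / norm x) *\<^sub>R v - ((x \<bullet> v) / norm x ^ 3) *\<^sub>R x)" for x v :: "real^'n"
  have dpol: "(polar has_derivative P x) (at x)" if "x \<in> ?V" for x
    unfolding P_def[abs_def] using that by (intro polar_has_derivative) auto
  have F2: "Ck_on (Suc (Suc 0)) U F" by (rule UF)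
  have dF: "(F has_derivative frechet_derivative F (at q)) (at q)" if "q \<in> U" for q
    using has_derivative_Ck[OF F2 that] .
  have d2F: "(\<lambda>q. frechet_derivative F (at q) z) differentiable at q" if "q \<in> U" for q z
    using F2 that unfolding Ck_on.simps by blast
  have du: "((f \<circ> polar) has_derivative (\<lambda>v. frechet_derivative F (at (polar x)) (P x v))) (at x)"
    if "x \<in> ?V" for x
    by (rule has_derivative_transform_within_open[OF
          has_derivative_compose[OF dpol[OF that] dF[OF pU[OF that]]] V that]) (rule eq[symmetric])
  \<comment> \<open>The direction P y v varies with y. Expanding it in a basis leaves derivatives of
    \<open>F\<close> in fixed directions, which \<open>Ck_on\<close> controls.\<close>
  have expand: "frechet_derivative F (at q) z = (\<Sum>b\<in>Basis. (z \<bullet> b) * frechet_derivative F (at q) b)"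
    if "q \<in> U" for q z
  proof -
    have l: "linear (frechet_derivative F (at q))" using dF[OF that] by (rule has_derivative_linear)
    have "frechet_derivative F (at q) z = frechet_derivative F (at q) (\<Sum>b\<in>Basis. (z \<bullet> b) *\<^sub>R b)"
      by (simp add: euclidean_representation)
    then show ?thesis by (simp add: linear_sum[OF l] linear_scale[OF l])
  qed
  have dP: "(\<lambda>y. P y v) differentiable at x" if x: "x \<in> ?V" for x v
  proof -
    have "x \<noteq> 0" using x by auto
    then have n: "norm differentiable at x" by (auto simp: differentiable_def dest: has_derivative_norm')
    have c: "(\<lambda>y. (y \<bullet> v) / norm y) differentiable at x" "(\<lambda>y. 1 / norm y) differentiable at x"
        "(\<lambda>y. (y \<bullet> v) / norm y ^ 3) differentiable at x"
      using \<open>x \<noteq> 0\<close> n by (auto intro!: differentiable_divide differentiable_inner differentiable_power)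
    show ?thesis
      unfolding P_def
      by (intro differentiable_Pair differentiable_diff differentiable_scaleR c differentiable_const
          differentiable_ident)
  qed
  have D: "(\<lambda>y. frechet_derivative (f \<circ> polar) (at y) v) differentiable at x" if x: "x \<in> ?V" for x v
  proof -
    have e: "frechet_derivative (f \<circ> polar) (at y) v
        = (\<Sum>b\<in>Basis. (P y v \<bullet> b) * frechet_derivative F (at (polar y)) b)" if "y \<in> ?V" for y
    proof -
      have "frechet_derivative (f \<circ> polar) (at y) = (\<lambda>v. frechet_derivative F (at (polar y)) (P y v))"
        by (rule frechet_derivative_at[OF du[OF that], symmetric])
      then have "frechet_derivative (f \<circ> polar) (at y) v = frechet_derivative F (at (polar y)) (P y v)"
        by (rule fun_cong)
      also have "\<dots> = (\<Sum>b\<in>Basis. (P y v \<bullet> b) * frechet_derivative F (at (polar y)) b)"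
        by (rule expand[OF pU[OF that]])
      finally show ?thesis .
    qed
    have d: "(\<lambda>y. \<Sum>b\<in>Basis. (P y v \<bullet> b) * frechet_derivative F (at (polar y)) b) differentiable at x"
    proof (intro differentiable_sum ballI differentiable_mult differentiable_inner dP[OF x])
      show "(\<lambda>y. frechet_derivative F (at (polar y)) b) differentiable at x" for b
        using differentiable_compose[of "\<lambda>q. frechet_derivative F (at q) b" polar, OF d2F[OF pU[OF x]]] dpol[OF x]
        unfolding differentiable_def by blast
    qed auto
    show ?thesis
      by (rule iffD2[OF differentiable_cong_open[OF V x] d]) (rule e)
  qed
  show ?thesis
    unfolding twice_on_def using du D by (auto simp: differentiable_def)
qed

section \<open>Steklov eigenfunctions and the maximum principle\<close>

lemma twice_on_subset: "twice_on S u \<Longrightarrow> T \<subseteq> S \<Longrightarrow> twice_on T u"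
  unfolding twice_on_def by blast

section \<open>Normals, boundary conditions and separated eigenfunctions\<close>

context profile
begin

text \<open>Orthogonality is tested on the spherical component of the normal itself, which must
  therefore vanish; unit length and the sign condition fix the rest.\<close>

lemma normal_unique:
  assumes r: "r \<in> {0, L}" and p: "norm p = 1" and n: "outward_unit_normal L g (r, p) \<nu>"
  shows "\<nu> = (if r = 0 then -1 else 1, 0)"
proof -
  obtain s w where \<nu>: "\<nu> = (s, w)" by force
  have cyl: "(r, p) \<in> cylinder L" using r p L_pos by (auto simp: cylinder_def)
  have T: "(s, w) \<in> tangent (r, p)" and one: "g (r, p) (s, w) (s, w) = 1"
    and orth: "\<And>v. (0, v) \<in> tangent (r, p) \<Longrightarrow> g (r, p) (s, w) (0, v) = 0"
    and sgn: "if r = 0 then s < 0 else s > 0"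
    using n by (auto simp: outward_unit_normal_def \<nu>)
  have T0: "(0, w) \<in> tangent (r, p)" using T by (simp add: tangent_def)
  have "h r > 0" using r L_pos by (intro h_pos interval) auto
  then have "w = 0" using orth[OF T0] revolutionD[OF metric cyl T T0] by simp
  then have "s\<^sup>2 = 1" using one revolutionD[OF metric cyl T T] by (simp add: power2_eq_square)
  then show ?thesis using sgn \<open>w = 0\<close> by (auto simp: \<nu> power2_eq_1_iff split: if_splits)
qed

lemma normal_exists:
  assumes r: "r \<in> {0, L}" and p: "norm p = 1"
  shows "outward_unit_normal L g (r, p) (if r = 0 then -1 else 1, 0)"
proof -
  have cyl: "(r, p) \<in> cylinder L" using r p L_pos by (auto simp: cylinder_def)
  have T: "(s, 0) \<in> tangent (r, p)" for s by (simp add: tangent_def)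
  show ?thesis
    using T revolutionD[OF metric cyl T] by (auto simp: outward_unit_normal_def)
qed

text \<open>The normal is tangent to the meridian, so the condition becomes one on one-sided
  derivatives in r, free of the ambiguous \<open>D\<close>.\<close>

lemma steklov_boundary:
  assumes f: "steklov_eigenfunction L g \<sigma> f" and p: "norm p = 1"
  shows "((\<lambda>t. f (t, p)) has_real_derivative - \<sigma> * f (0, p)) (at 0 within {0..L})"
    and "((\<lambda>t. f (t, p)) has_real_derivative \<sigma> * f (L, p)) (at L within {0..L})"
proof -
  have *: "((\<lambda>t. f (t, p)) has_real_derivative (if r = 0 then - 1 else 1) * (\<sigma> * f (r, p))) (at r within {0..L})"
    if r: "r \<in> {0, L}" for r
  proof -
    have "(r, p) \<in> cylinder_boundary L" using r p by (auto simp: cylinder_boundary_def)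
    then obtain \<nu> D where \<nu>: "outward_unit_normal L g (r, p) \<nu>"
      and D: "(f has_derivative D) (at (r, p) within cylinder L)" and D\<nu>: "D \<nu> = \<sigma> * f (r, p)"
      using f unfolding steklov_eigenfunction_def by blast
    define s :: real where "s = (if r = 0 then -1 else 1)"
    have s: "s * s = 1" by (simp add: s_def)
    have lin: "linear D" using D by (rule has_derivative_linear)
    have Ds: "D (s, 0) = \<sigma> * f (r, p)" using normal_unique[OF r p \<nu>] D\<nu> by (simp add: s_def)
    have "D (t, 0) = t * s * D (s, 0)" for t
      using linear_scale[OF lin, of "t * s" "(s, 0)"] s by (simp add: mult.assoc)
    then have Dt: "D (t, 0) = s * (\<sigma> * f (r, p)) * t" for t
      unfolding Ds by (simp only: mult_ac)
    have "((\<lambda>t. f (t, p)) has_derivative (\<lambda>t. D (t, 0))) (at r within {0..L})"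
    proof (rule has_derivative_in_compose[where f = "\<lambda>t. (t, p)" and g = f])
      show "((\<lambda>t. (t, p)) has_derivative (\<lambda>t. (t, 0))) (at r within {0..L})"
        by (auto intro!: derivative_eq_intros)
      show "(f has_derivative D) (at (r, p) within (\<lambda>t. (t, p)) ` {0..L})"
        by (rule has_derivative_subset[OF D]) (use p in \<open>auto simp: cylinder_def\<close>)
    qed
    then show ?thesis unfolding Dt by (simp add: has_field_derivative_def s_def[symmetric])
  qed
  show "((\<lambda>t. f (t, p)) has_real_derivative - \<sigma> * f (0, p)) (at 0 within {0..L})"
    "((\<lambda>t. f (t, p)) has_real_derivative \<sigma> * f (L, p)) (at L within {0..L})"
    using *[of 0] *[of L] L_pos by simp_all
qed

text \<open>Covers both competing modes: \<kappa> = 0 is the radial one, c = 0 the first spherical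
  harmonic.\<close>

lemma separated_eigenfunction:
  fixes e :: "real^'n"
  assumes e: "norm e = 1" and A: "\<And>k. Ck_on k {a<..<b} A"
    and ode: "\<And>r t. r \<in> {0<..<L} \<Longrightarrow>
      (deriv (deriv A) r + m * deriv h r / h r * deriv A r) * (c + \<kappa> * t) + A r / (h r)\<^sup>2 * - (m * t * \<kappa>) = 0"
    and bdry: "deriv A 0 = - \<sigma> * A 0" "deriv A L = \<sigma> * A L"
    and nz: "\<exists>r\<in>{0..L}. A r \<noteq> 0" "c \<noteq> 0 \<or> \<kappa> \<noteq> 0"
  shows "steklov_eigenfunction L g \<sigma> (\<lambda>(r, p). A r * (c + \<kappa> * (p \<bullet> e)))"
proof -
  let ?f = "\<lambda>(r, p). A r * (c + \<kappa> * (p \<bullet> e))"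
  let ?I = "{a<..<b}"
  have dA: "(A has_real_derivative deriv A r) (at r)" if "r \<in> ?I" for r
    using Ck_on_real_deriv(2)[OF A[of "Suc 0"] _ that] by simp
  have "Ck_on (Suc 0) ?I (deriv A)" using Ck_on_real_deriv(1)[OF A[of "Suc (Suc 0)"]] by simp
  then have ddA: "(deriv A has_real_derivative deriv (deriv A) r) (at r)" if "r \<in> ?I" for r
    using Ck_on_real_deriv(2)[of 0 ?I "deriv A"] that by simp
  have sub: "r \<in> ?I" if "r \<in> {0..L}" for r using interval[OF that] .
  have smooth: "smooth_on (cylinder L) ?f"
    unfolding smooth_on_def
  proof (intro exI[of _ "fst -` ?I"] exI[of _ ?f] conjI ballI allI)
    show op: "open (fst -` ?I :: (real \<times> (real^'n)) set)" by (intro open_vimage_fst open_greaterThanLessThan)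
    show "cylinder L \<subseteq> fst -` ?I" using a_neg L_less by (auto simp: cylinder_def)
    have "bounded_linear (\<lambda>q::real \<times> (real^'n). snd q \<bullet> e)"
      by (intro bounded_linear_inner_left_comp bounded_linear_snd)
    then show "Ck_on k (fst -` ?I) ?f" for k
      unfolding case_prod_beta
      by (intro Ck_on_mult Ck_on_add Ck_on_const Ck_on_linear op
          Ck_on_compose_linear[OF bounded_linear_fst open_greaterThanLessThan A])
  qed (rule refl)
  have "laplace (?f \<circ> polar) x = 0" if x: "1 < norm x \<and> norm x < 1 + L" for x
  proof -
    have eq: "?f \<circ> polar = (\<lambda>x. A (norm x - 1) * (\<lambda>t. c + \<kappa> * t) ((x \<bullet> e) / norm x))"
      by (auto simp: polar_def fun_eq_iff)
    have r: "norm x - 1 \<in> {0<..<L}" using x by auto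
    have d1: "((\<lambda>t. c + \<kappa> * t) has_real_derivative \<kappa>) (at t)" for t
      by (auto intro!: derivative_eq_intros)
    have "laplace (?f \<circ> polar) x
      = (deriv (deriv A) (norm x - 1) + m * deriv h (norm x - 1) / h (norm x - 1) * deriv A (norm x - 1))
          * (c + \<kappa> * ((x \<bullet> e) / norm x))
        + A (norm x - 1) / (h (norm x - 1))\<^sup>2 * ((1 - ((x \<bullet> e) / norm x)\<^sup>2) * 0 - m * ((x \<bullet> e) / norm x) * \<kappa>)"
      unfolding eq
      by (rule laplace_separated(2)[OF e _ _ d1 _ _ refl refl]) (use dA ddA sub x in auto)
    then show ?thesis using ode[OF r, of "(x \<bullet> e) / norm x"] by simp
  qed
  then have harm: "harmonic L g ?f" using smooth by (simp add: harmonic_def)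
  obtain r0 where r0: "r0 \<in> {0..L}" "A r0 \<noteq> 0" using nz by blast
  have "\<exists>p::real^'n. norm p = 1 \<and> c + \<kappa> * (p \<bullet> e) \<noteq> 0"
  proof (cases "c + \<kappa> = 0")
    case True
    then have "c + \<kappa> * ((- e) \<bullet> e) \<noteq> 0" using nz(2) e by (auto simp: norm_eq_1)
    then show ?thesis using e by (intro exI[of _ "- e"]) auto
  next
    case False
    then show ?thesis using e by (intro exI[of _ e]) (auto simp: norm_eq_1)
  qed
  then obtain p :: "real^'n" where "norm p = 1" "c + \<kappa> * (p \<bullet> e) \<noteq> 0" by blast
  then have ne: "\<exists>q\<in>cylinder L. ?f q \<noteq> 0"
    using r0 by (intro bexI[of _ "(r0, p)"]) (auto simp: cylinder_def)
  have bd: "\<exists>\<nu> D. outward_unit_normal L g q \<nu> \<and> (?f has_derivative D) (at q within cylinder L) \<and> D \<nu> = \<sigma> * ?f q"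
    if "q \<in> cylinder_boundary L" for q
  proof -
    have "q = (fst q, snd q)" "fst q \<in> {0, L}" "norm (snd q) = 1"
      using that by (auto simp: cylinder_boundary_def)
    then obtain r p where q: "q = (r, p)" "r \<in> {0, L}" "norm p = 1" by blast
    have rI: "r \<in> ?I" using q L_pos sub by auto
    have 1: "((\<lambda>q. A (fst q)) has_derivative (\<lambda>v. deriv A r * fst v)) (at q)"
      using has_derivative_compose[OF has_derivative_fst[OF has_derivative_ident], of A "(*) (deriv A r)" q UNIV]
        dA[OF rI] q(1) by (simp add: has_field_derivative_def)
    have 2: "((\<lambda>q. c + \<kappa> * (snd q \<bullet> e)) has_derivative (\<lambda>v. \<kappa> * (snd v \<bullet> e))) (at q)"
      by (auto intro!: derivative_eq_intros)
    define D where "D v = A r * (\<kappa> * (snd v \<bullet> e)) + deriv A r * fst v * (c + \<kappa> * (p \<bullet> e))"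
      for v :: "real \<times> (real^'n)"
    have "?f = (\<lambda>q. A (fst q) * (c + \<kappa> * (snd q \<bullet> e)))" by (auto simp: fun_eq_iff)
    then have "(?f has_derivative D) (at q)"
      using has_derivative_mult[OF 1 2] q(1) by (simp add: D_def[abs_def])
    then have "(?f has_derivative D) (at q within cylinder L)" by (rule has_derivative_at_withinI)
    moreover have "D (if r = 0 then -1 else 1, 0) = \<sigma> * ?f q"
      using bdry q L_pos by (auto simp: D_def)
    ultimately show ?thesis
      using normal_exists[OF q(2,3)] q(1) by blast
  qed
  show ?thesis unfolding steklov_eigenfunction_def using harm ne bd by blast
qed

end

section \<open>Comparison with strict supersolutions\<close>

context profile
begin

text \<open>What the maximum principle uses of an eigenfunction. Unlike eigenfunctions, these are
  closed under differences, which may vanish identically.\<close>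

definition steklov_like :: "real \<Rightarrow> (real \<times> (real^'n) \<Rightarrow> real) \<Rightarrow> bool" where
  "steklov_like \<sigma> w \<longleftrightarrow> continuous_on (cylinder L) w \<and> twice_on annulus (w \<circ> polar) \<and>
     (\<forall>x\<in>annulus. laplace (w \<circ> polar) x = 0) \<and>
     (\<forall>p. norm p = 1 \<longrightarrow>
        ((\<lambda>t. w (t, p)) has_real_derivative - \<sigma> * w (0, p)) (at 0 within {0..L}) \<and>
        ((\<lambda>t. w (t, p)) has_real_derivative \<sigma> * w (L, p)) (at L within {0..L}))"

lemma steklov_like_eigenfunction:
  assumes "steklov_eigenfunction L g \<sigma> f"
  shows "steklov_like \<sigma> f"
proof -
  have h: "harmonic L g f" using assms by (simp add: steklov_eigenfunction_def)
  then have s: "smooth_on (cylinder L) f" by (simp add: harmonic_def)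
  then obtain U F where F: "open U" "cylinder L \<subseteq> U" "Ck_on 0 U F" "\<forall>q\<in>cylinder L. F q = f q"
    unfolding smooth_on_def by blast
  then have "continuous_on (cylinder L) F"
    using continuous_on_subset[OF F(3)[unfolded Ck_on.simps(1)]] by blast
  then have "continuous_on (cylinder L) f"
    by (rule continuous_on_eq) (use F(4) in blast)
  then show ?thesis
    using twice_on_comp_polar[OF s] h steklov_boundary[OF assms]
    unfolding steklov_like_def harmonic_def by blast
qed

lemma steklov_like_diff:
  assumes u: "steklov_like \<sigma> u" and w: "steklov_like \<sigma> w"
  shows "steklov_like \<sigma> (\<lambda>q. u q - c * w q)"
  unfolding steklov_like_def
proof (intro conjI ballI allI impI)
  show "continuous_on (cylinder L) (\<lambda>q. u q - c * w q)"
    using u w by (auto simp: steklov_like_def intro!: continuous_intros)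
  have tw: "twice_on annulus (u \<circ> polar)" "twice_on annulus (w \<circ> polar)"
    using u w by (auto simp: steklov_like_def)
  have eq: "(\<lambda>q. u q - c * w q) \<circ> polar = (\<lambda>y. (u \<circ> polar) y - c * (w \<circ> polar) y)" by auto
  show "twice_on annulus ((\<lambda>q. u q - c * w q) \<circ> polar)"
    unfolding eq by (rule twice_on_diff(1)[OF open_annulus tw])
  show "laplace ((\<lambda>q. u q - c * w q) \<circ> polar) x = 0" if x: "x \<in> annulus" for x
    unfolding eq using laplace_diff[OF x open_annulus x tw] u w x by (simp add: steklov_like_def)
  fix p :: "real^'n" assume p: "norm p = 1"
  have "((\<lambda>t. u (t, p) - c * w (t, p)) has_real_derivative - \<sigma> * u (0, p) - c * (- \<sigma> * w (0, p))) (at 0 within {0..L})"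
    "((\<lambda>t. u (t, p) - c * w (t, p)) has_real_derivative \<sigma> * u (L, p) - c * (\<sigma> * w (L, p))) (at L within {0..L})"
    using u w p unfolding steklov_like_def by (intro DERIV_diff DERIV_cmult; blast)+
  then show "((\<lambda>t. u (t, p) - c * w (t, p)) has_real_derivative - \<sigma> * (u (0, p) - c * w (0, p))) (at 0 within {0..L})"
    "((\<lambda>t. u (t, p) - c * w (t, p)) has_real_derivative \<sigma> * (u (L, p) - c * w (L, p))) (at L within {0..L})"
    by (simp_all add: algebra_simps)
qed

text \<open>The reflection acts on the sphere factor; in the chart it is the reflection of the
  ambient space, because \<open>polar\<close> commutes with it.\<close>

lemma steklov_like_reflection:
  assumes e: "norm e = 1" and u: "steklov_like \<sigma> u"
  shows "steklov_like \<sigma> (\<lambda>(r, p). u (r, reflection e p))"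
  unfolding steklov_like_def
proof (intro conjI ballI allI impI)
  let ?w = "\<lambda>(r, p). u (r, reflection e p)"
  have "continuous_on (cylinder L) (\<lambda>q. u (fst q, reflection e (snd q)))"
  proof (rule continuous_on_compose2[of "cylinder L" u])
    show "continuous_on (cylinder L) u" using u by (simp add: steklov_like_def)
    show "continuous_on (cylinder L) (\<lambda>q. (fst q, reflection e (snd q)))"
      by (intro continuous_intros linear_continuous_on_compose[OF _ bounded_linear.linear[OF reflection_linear]])
    show "(\<lambda>q. (fst q, reflection e (snd q))) ` cylinder L \<subseteq> cylinder L"
      using e by (auto simp: cylinder_def norm_reflection)
  qed
  then show "continuous_on (cylinder L) ?w" by (simp add: case_prod_beta')
  have tw: "twice_on annulus (u \<circ> polar)" using u by (auto simp: steklov_like_def)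
  have "(1 / norm x) *\<^sub>R reflection e x = reflection e ((1 / norm x) *\<^sub>R x)" for x
    using linear_scale[OF bounded_linear.linear[OF reflection_linear]] by metis
  then have eq: "?w \<circ> polar = (\<lambda>y. (u \<circ> polar) (reflection e y))"
    using e by (auto simp: polar_def fun_eq_iff norm_reflection)
  show "twice_on annulus (?w \<circ> polar)"
    unfolding eq by (rule laplace_reflection(1)[OF e tw])
  show "laplace (?w \<circ> polar) x = 0" if x: "x \<in> annulus" for x
    unfolding eq laplace_reflection(2)[OF e tw x] using u x e by (auto simp: steklov_like_def norm_reflection)
  fix p :: "real^'n" assume p: "norm p = 1"
  then have "norm (reflection e p) = 1" using e by (simp add: norm_reflection)
  then show "((\<lambda>t. ?w (t, p)) has_real_derivative - \<sigma> * ?w (0, p)) (at 0 within {0..L})"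
    "((\<lambda>t. ?w (t, p)) has_real_derivative \<sigma> * ?w (L, p)) (at L within {0..L})"
    using u by (auto simp: steklov_like_def)
qed

text \<open>At a maximum of the quotient of \<open>w\<close> by the supersolution \<open>f(r) \<phi>(p \<bullet> e)\<close>, the difference of
  \<open>w\<close> and the matching multiple of the supersolution has a zero maximum.\<close>

lemma steklov_like_comparison:
  fixes e :: "real^'n" and w :: "real \<times> (real^'n) \<Rightarrow> real"
  assumes e: "norm e = 1" and w: "steklov_like \<sigma> w"
    and w_edge: "\<And>r p. r \<in> {0..L} \<Longrightarrow> norm p = 1 \<Longrightarrow> p \<bullet> e = \<beta> \<Longrightarrow> w (r, p) \<le> 0"
    and w_pos: "r0 \<in> {0..L}" "norm p0 = 1" "p0 \<bullet> e \<ge> \<beta>" "w (r0, p0) > 0"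
    and f: "\<And>r. r \<in> {0..L} \<Longrightarrow> (f has_real_derivative f1 r) (at r)"
    and f1: "\<And>r. r \<in> {0<..<L} \<Longrightarrow> (f1 has_real_derivative f2 r) (at r)"
    and bdry: "f1 0 \<le> - \<sigma>' * f 0" "f1 L \<ge> \<sigma>' * f L"
    and f_pos: "\<And>r. r \<in> {0..L} \<Longrightarrow> f r > 0"
    and \<phi>: "\<And>t. (\<phi> has_real_derivative \<phi>1 t) (at t)"
    and \<phi>1: "\<And>t. (\<phi>1 has_real_derivative \<phi>2 t) (at t)"
    and \<phi>_pos: "\<And>t. \<beta> \<le> t \<Longrightarrow> t \<le> 1 \<Longrightarrow> \<phi> t > 0"
    and super: "\<And>r t. r \<in> {0<..<L} \<Longrightarrow> \<beta> \<le> t \<Longrightarrow> -1 \<le> t \<Longrightarrow> t \<le> 1 \<Longrightarrow>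
      (f2 r + m * deriv h r / h r * f1 r) * \<phi> t + f r / (h r)\<^sup>2 * ((1 - t\<^sup>2) * \<phi>2 t - m * t * \<phi>1 t) < 0"
  shows "\<sigma>' \<le> \<sigma>"
proof (rule ccontr)
  assume "\<not> ?thesis"
  then have \<sigma>: "\<sigma> < \<sigma>'" by simp
  have w_cont: "continuous_on (cylinder L) w" and w_twice: "twice_on annulus (w \<circ> polar)"
    and w_harm: "\<And>x. x \<in> annulus \<Longrightarrow> laplace (w \<circ> polar) x = 0"
    and w0: "\<And>p. norm p = 1 \<Longrightarrow> ((\<lambda>t. w (t, p)) has_real_derivative - \<sigma> * w (0, p)) (at 0 within {0..L})"
    and wL: "\<And>p. norm p = 1 \<Longrightarrow> ((\<lambda>t. w (t, p)) has_real_derivative \<sigma> * w (L, p)) (at L within {0..L})"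
    using w unfolding steklov_like_def by blast+
  have f_cont: "continuous_on {0..L} f"
    by (rule continuous_on_DERIV[OF f])
  have f0: "(f has_real_derivative f1 0) (at 0 within {0..L})"
    and fL: "(f has_real_derivative f1 L) (at L within {0..L})"
    using L_pos by (simp_all add: has_field_derivative_at_within[OF f])
  have fI: "(f has_real_derivative f1 r) (at r)" if "r \<in> {0<..<L}" for r
    using f that by simp
  \<comment> \<open>The part of the cylinder above the level \<beta>: half of it for \<beta> = 0,
    all of it for \<beta> < -1.\<close>
  define Z where "Z = {0..L} \<times> (sphere 0 1 \<inter> {p::real^'n. \<beta> \<le> p \<bullet> e})"
  have "closed {p::real^'n. \<beta> \<le> p \<bullet> e}"
    by (intro closed_Collect_le continuous_intros)
  then have "compact Z" unfolding Z_def by (intro compact_Times compact_Int_closed) auto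
  have Zc: "Z \<subseteq> cylinder L" by (auto simp: Z_def cylinder_def)
  define \<psi> where "\<psi> q = f (fst q) * \<phi> (snd q \<bullet> e)" for q :: "real \<times> (real^'n)"
  have le1: "p \<bullet> e \<le> 1" "-1 \<le> p \<bullet> e" if "norm p = 1" for p
    using Cauchy_Schwarz_ineq2[of p e] that e by (auto simp: abs_le_iff)
  have \<psi>_pos: "\<psi> q > 0" if "q \<in> Z" for q
    using that f_pos \<phi>_pos le1 by (auto simp: \<psi>_def Z_def)
  have \<phi>_cont: "continuous_on UNIV \<phi>"
    using \<phi> by (auto intro!: DERIV_continuous_on)
  have "continuous_on Z \<psi>"
    unfolding \<psi>_def
    by (intro continuous_on_mult continuous_on_compose2[OF f_cont] continuous_on_compose2[OF \<phi>_cont]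
        continuous_intros) (auto simp: Z_def)
  then have "continuous_on Z (\<lambda>q. w q / \<psi> q)"
    by (rule continuous_on_divide[OF continuous_on_subset[OF w_cont Zc]]) (use \<psi>_pos in force)
  moreover have "(r0, p0) \<in> Z" using w_pos by (auto simp: Z_def)
  ultimately obtain q where q: "q \<in> Z" and qmax: "\<And>z. z \<in> Z \<Longrightarrow> w z / \<psi> z \<le> w q / \<psi> q"
    using continuous_attains_sup[OF \<open>compact Z\<close>] by blast
  define M where "M = w q / \<psi> q"
  have "0 < w (r0, p0) / \<psi> (r0, p0)" using w_pos \<psi>_pos[OF \<open>(r0, p0) \<in> Z\<close>] by simp
  then have M: "M > 0" using qmax[OF \<open>(r0, p0) \<in> Z\<close>] by (simp add: M_def)
  have wq: "w q = M * \<psi> q" using \<psi>_pos[OF q] by (simp add: M_def)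
  have wle: "w z \<le> M * \<psi> z" if "z \<in> Z" for z
    using qmax[OF that] \<psi>_pos[OF that] by (simp add: M_def[symmetric] pos_divide_le_eq)
  obtain r p where rp: "q = (r, p)" by force
  have r: "r \<in> {0..L}" and p: "norm p = 1" and pe: "\<beta> \<le> p \<bullet> e" using q by (auto simp: Z_def rp)
  have wpos: "w (r, p) > 0" using wq M \<psi>_pos[OF q] by (simp add: rp)
  then have pe': "\<beta> < p \<bullet> e" using w_edge[OF r p] pe by force
  \<comment> \<open>The difference along the meridian through the maximum point. At an end of the
    meridian, \<sigma> < \<sigma>' would make G grow from 0 into the interior, where it is
    nonpositive.\<close>
  define G where "G t = w (t, p) - M * \<phi> (p \<bullet> e) * f t" for t
  have G_le: "G t \<le> 0" if "t \<in> {0..L}" for t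
    using wle[of "(t, p)"] that p pe by (simp add: Z_def G_def \<psi>_def mult_ac)
  have Gr: "G r = 0" using wq by (simp add: G_def rp \<psi>_def mult_ac)
  have weq: "w (r, p) = M * \<phi> (p \<bullet> e) * f r" using Gr by (simp add: G_def)
  have M\<phi>: "0 < M * \<phi> (p \<bullet> e)" using M \<phi>_pos[OF pe] le1[OF p] by simp
  consider "r = 0" | "r = L" | "r \<in> {0<..<L}" using r by fastforce
  then show False
  proof cases
    case 1
    have "(G has_real_derivative - \<sigma> * w (0, p) - M * \<phi> (p \<bullet> e) * f1 0) (at 0 within {0..L})"
      unfolding G_def by (intro DERIV_diff DERIV_cmult w0[OF p] f0)
    moreover have "- \<sigma> * w (0, p) - M * \<phi> (p \<bullet> e) * f1 0 > 0"
    proof -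
      have "M * \<phi> (p \<bullet> e) * f1 0 \<le> M * \<phi> (p \<bullet> e) * (- \<sigma>' * f 0)"
        using M\<phi> bdry(1) by (intro mult_left_mono) auto
      also have "\<dots> = - \<sigma>' * w (r, p)" using weq 1 by simp
      also have "\<dots> < - \<sigma> * w (r, p)" using \<sigma> wpos by simp
      finally show ?thesis using 1 by simp
    qed
    ultimately obtain d where d: "d > 0" "\<And>t. 0 < t \<Longrightarrow> 0 + t \<in> {0..L} \<Longrightarrow> t < d \<Longrightarrow> G 0 < G (0 + t)"
      using has_real_derivative_pos_inc_right by blast
    define t where "t = min (d / 2) L"
    have "0 < t" "t \<in> {0..L}" "t < d" using d(1) L_pos by (auto simp: t_def min_def)
    then show False using d(2)[of t] G_le[of t] Gr 1 by simp
  next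
    case 2
    have "(G has_real_derivative \<sigma> * w (L, p) - M * \<phi> (p \<bullet> e) * f1 L) (at L within {0..L})"
      unfolding G_def by (intro DERIV_diff DERIV_cmult wL[OF p] fL)
    moreover have "\<sigma> * w (L, p) - M * \<phi> (p \<bullet> e) * f1 L < 0"
    proof -
      have "\<sigma> * w (r, p) < \<sigma>' * w (r, p)" using \<sigma> wpos by simp
      also have "\<dots> = M * \<phi> (p \<bullet> e) * (\<sigma>' * f L)" using weq 2 by simp
      also have "\<dots> \<le> M * \<phi> (p \<bullet> e) * f1 L" using M\<phi> bdry(2) by (intro mult_left_mono) auto
      finally show ?thesis using 2 by simp
    qed
    ultimately obtain d where d: "d > 0" "\<And>t. 0 < t \<Longrightarrow> L - t \<in> {0..L} \<Longrightarrow> t < d \<Longrightarrow> G L < G (L - t)"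
      using has_real_derivative_neg_dec_left by blast
    define t where "t = min (d / 2) L"
    have "0 < t" "L - t \<in> {0..L}" "t < d" using d(1) L_pos by (auto simp: t_def min_def)
    then show False using d(2)[of t] G_le[of "L - t"] Gr 2 by simp
  next
    case 3
    define x where "x = (1 + r) *\<^sub>R p"
    have nx: "norm x = 1 + r" using p 3 by (simp add: x_def)
    have x: "x \<in> annulus" using nx 3 by auto
    have px: "polar x = (r, p)" using nx 3 by (simp add: polar_def) (simp add: x_def)
    have xe: "(x \<bullet> e) / norm x = p \<bullet> e" using nx 3 by (simp add: x_def)
    define u where "u y = f (norm y - 1) * \<phi> ((y \<bullet> e) / norm y)" for y :: "real^'n"
    have u\<psi>: "u y = \<psi> (polar y)" for y by (simp add: u_def \<psi>_def polar_def)
    have u_twice: "twice_on annulus u"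
      unfolding u_def by (rule laplace_separated(1)[OF e fI f1 \<phi> \<phi>1])
    have u_laplace: "laplace u x
        = (f2 r + m * deriv h r / h r * f1 r) * \<phi> (p \<bullet> e)
          + f r / (h r)\<^sup>2 * ((1 - (p \<bullet> e)\<^sup>2) * \<phi>2 (p \<bullet> e) - m * (p \<bullet> e) * \<phi>1 (p \<bullet> e))"
      unfolding u_def by (rule laplace_separated(2)[OF e fI f1 \<phi> \<phi>1 x]) (simp_all add: nx xe[unfolded nx])
    \<comment> \<open>Strict inequality makes \<open>S\<close> open while \<open>polar\<close> still
      maps it into \<open>Z\<close>, so x is an interior maximum.\<close>
    define S where "S = annulus \<inter> {y. \<beta> * norm y < y \<bullet> e}"
    have S: "open S"
      unfolding S_def by (intro open_Int open_annulus open_Collect_less continuous_intros)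
    have xS: "x \<in> S" using x pe' xe nx 3 by (simp add: S_def pos_less_divide_eq[symmetric])
    have tw: "twice_on S (w \<circ> polar)" "twice_on S u"
      using twice_on_subset[OF w_twice] twice_on_subset[OF u_twice] by (auto simp: S_def)
    have inZ: "polar y \<in> Z" if "y \<in> S" for y
      using that by (auto simp: S_def Z_def polar_def field_simps less_imp_le)
    have "laplace (\<lambda>y. (w \<circ> polar) y - M * u y) x \<le> 0"
    proof (rule laplace_nonpos_at_max[OF x S twice_on_diff(1)[OF S tw] xS])
      fix y assume "y \<in> S"
      have "w (polar x) = M * \<psi> (polar x)" using wq by (simp add: px rp)
      then show "(w \<circ> polar) y - M * u y \<le> (w \<circ> polar) x - M * u x"
        using wle[OF inZ[OF \<open>y \<in> S\<close>]] by (simp add: u\<psi>)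
    qed
    then have "M * laplace u x \<ge> 0"
      using laplace_diff[OF x S xS tw] w_harm[OF x] by simp
    moreover have "laplace u x < 0"
      unfolding u_laplace using super[OF 3 pe] le1[OF p] by simp
    ultimately show False using M by (simp add: zero_le_mult_iff)
  qed
qed

end

section \<open>Radial and non-radial eigenfunctions\<close>

text \<open>Continuity and positivity up to a and b serve the integrals that start at a:
  \<open>width\<close> and the solutions of the linear system.\<close>

locale unit_profile = profile L a b m h g for L a b m h and g :: "'n::finite metric" +
  assumes h_cont: "continuous_on {a..b} h" and h_pos': "\<And>r. r \<in> {a..b} \<Longrightarrow> h r > 0"
    and h_0: "h 0 = 1" and h_L: "h L = 1"
    and slope: "\<And>r. r \<in> {0..L} \<Longrightarrow> \<bar>deriv h r\<bar> \<le> 1"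
begin

lemma unit_vector: obtains e :: "real^'n" where "norm e = 1"
  using that[of "axis undefined 1"] by (simp add: norm_axis_1)

text \<open>Needed before a member of the set behind \<open>steklov_eigenvalue\<close> bounds its
  infimum from above. A radial supersolution on the whole cylinder yields a crude bound.\<close>

lemma eigenvalues_bounded_below:
  obtains C where "\<And>\<sigma> f. steklov_eigenfunction L g \<sigma> f \<Longrightarrow> C \<le> \<sigma>"
proof -
  obtain e :: "real^'n" where e: "norm e = 1" by (rule unit_vector)
  have "continuous_on {0..L} (\<lambda>r. m / h r)"
    using h_pos'[THEN less_imp_neq] a_neg L_less
    by (intro continuous_on_divide continuous_on_const continuous_on_subset[OF h_cont]) force+
  then obtain K where K: "\<And>r. r \<in> {0..L} \<Longrightarrow> \<bar>m / h r\<bar> \<le> K"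
    using compact_imp_bounded[OF compact_continuous_image[of "{0..L}" "\<lambda>r. m / h r"]]
    unfolding bounded_iff by fastforce
  \<comment> \<open>\<mu> exceeds every |m h'/h|, so B - exp (\<mu> r) is strictly superharmonic. B
    gives it the value 1 at L, where the quotient of derivative and value is then - \<mu> exp (\<mu>
    L).\<close>
  define \<mu> where "\<mu> = K + 1"
  have \<mu>: "\<mu> > 0" using order_trans[OF abs_ge_zero K[of 0]] L_pos by (simp add: \<mu>_def)
  define B where "B = exp (\<mu> * L) + 1"
  have "- (\<mu> * exp (\<mu> * L)) \<le> \<sigma>" if f: "steklov_eigenfunction L g \<sigma> f" for \<sigma> f
  proof -
    obtain r0 p0 where q0: "(r0, p0) \<in> cylinder L" "f (r0, p0) \<noteq> 0"
      using f unfolding steklov_eigenfunction_def by auto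
    \<comment> \<open>Makes \<open>w\<close> equal to f or to -f, whichever is positive at the
      chosen point.\<close>
    define c :: real where "c = (if f (r0, p0) > 0 then 0 else 2)"
    define w where "w q = f q - c * f q" for q
    have w: "steklov_like \<sigma> w"
      unfolding w_def by (intro steklov_like_diff steklov_like_eigenfunction f)
    have w0: "w (r0, p0) > 0" using q0(2) by (auto simp: w_def c_def)
    have p0: "r0 \<in> {0..L}" "norm p0 = 1" using q0(1) by (auto simp: cylinder_def)
    have ge: "-1 \<le> p \<bullet> e" if "norm p = 1" for p
      using Cauchy_Schwarz_ineq2[of p e] that e by (auto simp: abs_le_iff)
    \<comment> \<open>The level \<beta> = -2 lies below all values of p \<bullet> e, so there is no
      edge.\<close>
    show ?thesis
    proof (rule steklov_like_comparison[where e = e and w = w and ?r0.0 = r0 and ?p0.0 = p0 and \<beta> = "-2"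
          and f = "\<lambda>r. B - exp (\<mu> * r)" and ?f1.0 = "\<lambda>r. - (\<mu> * exp (\<mu> * r))"
          and ?f2.0 = "\<lambda>r. - (\<mu>\<^sup>2 * exp (\<mu> * r))" and \<phi> = "\<lambda>t. 1" and ?\<phi>1.0 = "\<lambda>t. 0" and ?\<phi>2.0 = "\<lambda>t. 0"])
      show "w (r, p) \<le> 0" if "norm p = 1" "p \<bullet> e = -2" for r p using ge[OF that(1)] that(2) by simp
      show "-2 \<le> p0 \<bullet> e" using ge[OF p0(2)] by simp
      show "((\<lambda>r. B - exp (\<mu> * r)) has_real_derivative - (\<mu> * exp (\<mu> * r))) (at r)" for r
        by (auto intro!: derivative_eq_intros)
      show "((\<lambda>r. - (\<mu> * exp (\<mu> * r))) has_real_derivative - (\<mu>\<^sup>2 * exp (\<mu> * r))) (at r)" for r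
        by (auto intro!: derivative_eq_intros simp: power2_eq_square)
      show "- (\<mu> * exp (\<mu> * 0)) \<le> - (- (\<mu> * exp (\<mu> * L))) * (B - exp (\<mu> * 0))"
        using \<mu> by (simp add: B_def) (smt (verit) exp_gt_zero mult_nonneg_nonneg)
      show "- (\<mu> * exp (\<mu> * L)) * (B - exp (\<mu> * L)) \<le> - (\<mu> * exp (\<mu> * L))"
        by (simp add: B_def)
      show "B - exp (\<mu> * r) > 0" if "r \<in> {0..L}" for r
      proof -
        have "exp (\<mu> * r) \<le> exp (\<mu> * L)" using that \<mu> by simp
        then show ?thesis unfolding B_def by linarith
      qed
      show "(- (\<mu>\<^sup>2 * exp (\<mu> * r)) + m * deriv h r / h r * - (\<mu> * exp (\<mu> * r))) * 1
          + (B - exp (\<mu> * r)) / (h r)\<^sup>2 * ((1 - t\<^sup>2) * 0 - m * t * 0) < 0"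
        if r: "r \<in> {0<..<L}" for r t
      proof -
        have r': "r \<in> {0..L}" using r by auto
        have "\<bar>m * deriv h r / h r\<bar> = \<bar>m / h r\<bar> * \<bar>deriv h r\<bar>" by (simp add: abs_mult)
        also have "\<dots> \<le> K * 1" using K[OF r'] slope[OF r'] order_trans[OF abs_ge_zero K[OF r']] by (intro mult_mono) auto
        finally have "- (m * deriv h r / h r) < \<mu>" unfolding \<mu>_def by linarith
        then have "0 < \<mu> * exp (\<mu> * r) * (\<mu> + m * deriv h r / h r)"
          using \<mu> by (intro mult_pos_pos) auto
        then show ?thesis by (simp add: algebra_simps power2_eq_square)
      qed
    qed (use e w p0 w0 in auto)
  qed
  then show thesis using that by blast
qed

text \<open>A is a supersolution of the first-mode equation with m lowered to m - \<delta>. This gap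
  pays for an angular factor that is positive up to the mirror.\<close>

lemma nonradial_eigenvalue_ge:
  assumes f: "steklov_eigenfunction L g \<sigma> f"
    and nonradial: "r0 \<in> {0..L}" "norm p = 1" "norm q = 1" "f (r0, p) > f (r0, q)"
    and A: "\<And>r. r \<in> {0..L} \<Longrightarrow> (A has_real_derivative A1 r) (at r)"
    and A1: "\<And>r. r \<in> {0<..<L} \<Longrightarrow> (A1 has_real_derivative A2 r) (at r)"
    and bdry: "A1 0 \<le> - \<sigma>' * A 0" "A1 L \<ge> \<sigma>' * A L"
    and A_pos: "\<And>r. r \<in> {0..L} \<Longrightarrow> A r > 0" and \<delta>: "\<delta> > 0"
    and super: "\<And>r. r \<in> {0<..<L} \<Longrightarrow> A2 r + m * deriv h r / h r * A1 r \<le> (m - \<delta>) * A r / (h r)\<^sup>2"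
  shows "\<sigma>' \<le> \<sigma>"
proof -
  have m: "m > 0" using dim by (simp add: m_eq)
  \<comment> \<open>The unit normal of the mirror that exchanges p and q.\<close>
  define e where "e = (1 / norm (p - q)) *\<^sub>R (p - q)"
  have pq: "p \<noteq> q" using nonradial(4) by auto
  then have e: "norm e = 1" by (simp add: e_def)
  have pp: "p \<bullet> p = 1" "q \<bullet> q = 1" using nonradial by (simp_all add: norm_eq_1)
  have n2: "(norm (p - q))\<^sup>2 = 2 * (p \<bullet> (p - q))"
    by (simp add: power2_norm_eq_inner inner_diff_left inner_diff_right pp inner_commute)
  have pe: "p \<bullet> e = norm (p - q) / 2"
    using n2 pq unfolding e_def inner_scaleR_right by (simp add: power2_eq_square field_simps)
  have "reflection e p = p - (2 * (norm (p - q) / 2)) *\<^sub>R e" by (simp add: reflection_def pe)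
  also have "\<dots> = q" using pq by (simp add: e_def)
  finally have Rp: "reflection e p = q" .
  define w where "w z = f z - 1 * (case z of (r, y) \<Rightarrow> f (r, reflection e y))" for z
  have w: "steklov_like \<sigma> w"
    unfolding w_def
    by (intro steklov_like_diff steklov_like_reflection[OF e] steklov_like_eigenfunction[OF f])
  have w_pos: "w (r0, p) > 0" using nonradial by (simp add: w_def Rp)
  \<comment> \<open>Makes the coefficient of t^2 below equal to \<delta>; what remains is \<delta>
    (t^2 - t) - \<delta> \<eta>, which is negative on [0, 1].\<close>
  define \<eta> where "\<eta> = \<delta> / (m + m\<^sup>2 / 2 + \<delta> * m / 2)"
  have den: "m + m\<^sup>2 / 2 + \<delta> * m / 2 > 0" using m \<delta> by (simp add: add_pos_pos)
  have \<eta>: "\<eta> > 0" "\<eta> * (m + m\<^sup>2 / 2 + \<delta> * m / 2) = \<delta>" "\<eta> * m / 2 \<le> 1"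
  proof -
    show "\<eta> > 0" using \<delta> den by (simp add: \<eta>_def)
    show *: "\<eta> * (m + m\<^sup>2 / 2 + \<delta> * m / 2) = \<delta>" using den by (simp add: \<eta>_def)
    show "\<eta> * m / 2 \<le> 1" using m \<delta> den by (simp add: \<eta>_def divide_simps)
  qed
  \<comment> \<open>The first spherical harmonic \<open>t\<close>, perturbed so as to be positive on the equator \<open>t = 0\<close> as well.\<close>
  define \<phi> where "\<phi> t = t + \<eta> * (1 - m / 2 * t\<^sup>2)" for t
  have t2: "t\<^sup>2 \<le> t" if "0 \<le> t" "t \<le> 1" for t :: real
    using that by (simp add: power2_eq_square mult_left_le_one_le)
  have \<phi>_pos: "\<phi> t > 0" if "0 \<le> t" "t \<le> 1" for t
  proof -
    have "\<eta> * m / 2 * t\<^sup>2 \<le> 1 * t" using \<eta> m t2[OF that] that by (intro mult_mono) auto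
    then show ?thesis using \<eta>(1) by (simp add: \<phi>_def algebra_simps)
  qed
  show ?thesis
  proof (rule steklov_like_comparison[where e = e and w = w and ?r0.0 = r0 and ?p0.0 = p and \<beta> = 0
        and f = A and ?f1.0 = A1 and ?f2.0 = A2
        and \<phi> = \<phi> and ?\<phi>1.0 = "\<lambda>t. 1 - \<eta> * m * t" and ?\<phi>2.0 = "\<lambda>t. - \<eta> * m"])
    show "w (r, y) \<le> 0" if "y \<bullet> e = 0" for r y using that by (simp add: w_def reflection_def)
    show "0 \<le> p \<bullet> e" by (simp add: pe)
    show "(\<phi> has_real_derivative 1 - \<eta> * m * t) (at t)" for t
      unfolding \<phi>_def by (auto intro!: derivative_eq_intros)
    show "((\<lambda>t. 1 - \<eta> * m * t) has_real_derivative - \<eta> * m) (at t)" for t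
      by (auto intro!: derivative_eq_intros)
    show "\<phi> t > 0" if "0 \<le> t" "t \<le> 1" for t by (rule \<phi>_pos[OF that])
    show "(A2 r + m * deriv h r / h r * A1 r) * \<phi> t
        + A r / (h r)\<^sup>2 * ((1 - t\<^sup>2) * (- \<eta> * m) - m * t * (1 - \<eta> * m * t)) < 0"
      if r: "r \<in> {0<..<L}" and t: "0 \<le> t" "t \<le> 1" for r t
    proof -
      have r': "r \<in> {0..L}" using r by auto
      have "(1 - t\<^sup>2) * (- \<eta> * m) - m * t * (1 - \<eta> * m * t) + (m - \<delta>) * \<phi> t
          = t\<^sup>2 * (\<eta> * (m + m\<^sup>2 / 2 + \<delta> * m / 2)) - \<delta> * t - \<delta> * \<eta>"
        by (simp add: \<phi>_def field_simps power2_eq_square)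
      also have "\<dots> = \<delta> * (t\<^sup>2 - t) - \<delta> * \<eta>" unfolding \<eta>(2) by (simp add: algebra_simps)
      also have "\<dots> < 0"
      proof -
        have "\<delta> * (t\<^sup>2 - t) \<le> 0" using t2[OF t] \<delta> by (intro mult_nonneg_nonpos) auto
        moreover have "\<delta> * \<eta> > 0" using \<delta> \<eta> by simp
        ultimately show ?thesis by linarith
      qed
      finally have *: "(1 - t\<^sup>2) * (- \<eta> * m) - m * t * (1 - \<eta> * m * t) < - ((m - \<delta>) * \<phi> t)" by simp
      have "A r / (h r)\<^sup>2 > 0" using A_pos[OF r'] h_pos[OF interval[OF r']] by simp
      then have "A r / (h r)\<^sup>2 * ((1 - t\<^sup>2) * (- \<eta> * m) - m * t * (1 - \<eta> * m * t))
          < A r / (h r)\<^sup>2 * - ((m - \<delta>) * \<phi> t)" using * by (intro mult_strict_left_mono)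
      moreover have "(A2 r + m * deriv h r / h r * A1 r) * \<phi> t \<le> (m - \<delta>) * A r / (h r)\<^sup>2 * \<phi> t"
        using super[OF r] \<phi>_pos[OF t] by (intro mult_right_mono) auto
      moreover have "A r / (h r)\<^sup>2 * - ((m - \<delta>) * \<phi> t) = - ((m - \<delta>) * A r / (h r)\<^sup>2 * \<phi> t)"
        by (simp only: times_divide_eq_left times_divide_eq_right mult_minus_right minus_divide_left mult_ac)
      ultimately show ?thesis by linarith
    qed
  qed (use e w nonradial w_pos A A1 bdry A_pos in auto)
qed

end

context profile
begin

text \<open>A radial eigenfunction agrees with its radial model only on the annulus; openness of the
  annulus carries this over to derivatives.\<close>

lemma laplace_cong:
  assumes x: "x \<in> annulus" and u: "twice_on annulus u" and eq: "\<And>y. y \<in> annulus \<Longrightarrow> u y = u' y"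
    and u': "twice_on annulus u'"
  shows "laplace u x = laplace u' x"
proof -
  have D: "frechet_derivative u (at y) = frechet_derivative u' (at y)" if "y \<in> annulus" for y
    by (rule frechet_derivative_cong_open[OF open_annulus that eq])
  have "hess u x v = hess u' x v" for v
    unfolding hess_def[abs_def] by (rule frechet_derivative_cong_open[OF open_annulus x]) (simp add: D)
  then show ?thesis
    unfolding laplace_formula[OF x open_annulus u x] laplace_formula[OF x open_annulus u' x] D[OF x] by simp
qed

end

section \<open>Radial eigenfunctions\<close>

context unit_profile
begin

text \<open>A radial harmonic function. The lower limit a < 0 makes it differentiable from both
  sides at 0; only its differences matter.\<close>

definition width :: "real \<Rightarrow> real" where
  "width t = integral {a..t} (\<lambda>s. 1 / h s ^ (CARD('n) - 1))"

lemma width_deriv: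
  assumes "r \<in> {a<..<b}"
  shows "(width has_real_derivative 1 / h r ^ (CARD('n) - 1)) (at r)"
proof -
  have "continuous_on {a..b} (\<lambda>s. 1 / h s ^ (CARD('n) - 1))"
    using h_pos' by (intro continuous_on_divide continuous_on_const continuous_on_power h_cont) force
  from integral_has_real_derivative[OF this, of r] show ?thesis
    using assms at_within_interior[of r "{a..b}"] by (simp add: width_def[abs_def])
qed

lemma width_smooth: "Ck_on k {a<..<b} width"
proof -
  have "Ck_on k {a<..<b} (\<lambda>s. inverse (h s ^ (CARD('n) - 1)))"
    using h_pos by (intro Ck_on_inverse Ck_on_power h_smooth open_greaterThanLessThan) force
  moreover have "(width has_real_derivative inverse (h r ^ (CARD('n) - 1))) (at r)" if "r \<in> {a<..<b}" for r
    using width_deriv[OF that] by (simp add: divide_inverse)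
  ultimately have "Ck_on (Suc k) {a<..<b} width"
    by (intro Ck_on_Suc_real[OF open_greaterThanLessThan]) auto
  then show ?thesis by (rule Ck_on_SucD)
qed

lemma width_strict_mono: "width 0 < width L"
proof (rule DERIV_pos_imp_increasing[OF L_pos])
  fix r assume "0 \<le> r" "r \<le> L"
  then have "r \<in> {a<..<b}" using interval by auto
  then show "\<exists>y. (width has_real_derivative y) (at r) \<and> 0 < y"
    using width_deriv h_pos by (intro exI conjI) auto
qed

text \<open>The flux h^m A' is conserved. As h is 1 at both ends, A' takes the same value there, and
  dividing the flux by h^m and integrating gives \<open>width\<close>.\<close>

lemma radial_ode:
  assumes A: "\<And>r. r \<in> {0<..<L} \<Longrightarrow> (A has_real_derivative A1 r) (at r)"
    and A1: "\<And>r. r \<in> {0<..<L} \<Longrightarrow> (A1 has_real_derivative A2 r) (at r)"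
    and cont: "continuous_on {0..L} A" "continuous_on {0..L} A1"
    and ode: "\<And>r. r \<in> {0<..<L} \<Longrightarrow> A2 r + m * deriv h r / h r * A1 r = 0"
  shows "A1 L = A1 0" and "r \<in> {0..L} \<Longrightarrow> A r - A 0 = A1 0 * (width r - width 0)"
proof -
  define k where "k = CARD('n) - 1"
  have k: "m = real k" "k > 0" using dim by (simp_all add: k_def m_eq)
  have hc: "continuous_on {0..L} h" using a_neg L_less by (intro continuous_on_subset[OF h_cont]) auto
  have pos: "h r > 0" "r \<in> {a<..<b}" if "r \<in> {0..L}" for r using that h_pos interval by auto
  define C where "C r = h r ^ k * A1 r" for r
  have C0: "C r = C 0" if r: "r \<in> {0..L}" for r
  proof (cases "r = 0")
    case False
    then have "0 < r" using r by simp
    have "continuous_on {0..r} C"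
      unfolding C_def using r by (intro continuous_intros continuous_on_subset[OF hc] continuous_on_subset[OF cont(2)]) auto
    moreover have "(C has_real_derivative 0) (at s)" if "0 < s" "s < r" for s
    proof -
      have s: "s \<in> {0<..<L}" "s \<in> {0..L}" using that r by auto
      have "(C has_real_derivative real k * h s ^ (k - 1) * deriv h s * A1 s + A2 s * h s ^ k) (at s)"
        unfolding C_def using h_deriv[OF pos(2)[OF s(2)]] A1[OF s(1)]
        by (auto intro!: derivative_eq_intros)
      moreover have "real k * h s ^ (k - 1) * deriv h s * A1 s + A2 s * h s ^ k
          = h s ^ k * (A2 s + m * deriv h s / h s * A1 s)"
        using pos(1)[OF s(2)] k by (cases k) (auto simp: field_simps)
      ultimately show ?thesis using ode[OF s(1)] by simp
    qed
    ultimately show ?thesis by (intro DERIV_isconst_end[OF \<open>0 < r\<close>])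
  qed simp
  from C0[of L] show "A1 L = A1 0" using L_pos by (simp add: C_def h_0 h_L)
  have A1_eq: "A1 r = A1 0 * (1 / h r ^ k)" if "r \<in> {0..L}" for r
    using C0[OF that] pos[OF that] by (simp add: C_def h_0 field_simps)
  assume r: "r \<in> {0..L}"
  show "A r - A 0 = A1 0 * (width r - width 0)"
  proof (cases "r = 0")
    case False
    then have "0 < r" using r by simp
    define G where "G t = A t - A1 0 * width t" for t
    have "continuous_on {0..L} width"
      using pos(2) by (intro continuous_on_DERIV[OF width_deriv]) auto
    then have "continuous_on {0..r} G"
      unfolding G_def using r
      by (intro continuous_intros continuous_on_subset[OF cont(1)]) (auto intro: continuous_on_subset)
    moreover have "(G has_real_derivative 0) (at s)" if "0 < s" "s < r" for s
    proof -
      have s: "s \<in> {0<..<L}" "s \<in> {0..L}" using that r by auto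
      have "(G has_real_derivative A1 s - A1 0 * (1 / h s ^ (CARD('n) - 1))) (at s)"
        unfolding G_def by (intro DERIV_diff DERIV_cmult A[OF s(1)] width_deriv pos(2)[OF s(2)])
      then show ?thesis using A1_eq[OF s(2)] by (simp add: k_def)
    qed
    ultimately have "G r = G 0" by (intro DERIV_isconst_end[OF \<open>0 < r\<close>])
    then show ?thesis by (simp add: G_def algebra_simps)
  qed simp
qed

text \<open>By \<open>radial_ode\<close> both end slopes equal A'(0), so the boundary conditions
  give \<sigma> (A(L) - A(0)) = 2 A'(0), while A(L) - A(0) is A'(0) times the width. A'(0) is
  nonzero, as f would otherwise be constant.\<close>

lemma radial_eigenvalue:
  assumes f: "steklov_eigenfunction L g \<sigma> f"
    and radial: "\<And>r p q. r \<in> {0..L} \<Longrightarrow> norm p = 1 \<Longrightarrow> norm q = 1 \<Longrightarrow> f (r, p) = f (r, q)"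
    and nonconst: "z \<in> cylinder L" "z' \<in> cylinder L" "f z \<noteq> f z'"
  shows "\<sigma> = 2 / (width L - width 0)"
proof -
  obtain e :: "real^'n" where e: "norm e = 1" by (rule unit_vector)
  have harm: "harmonic L g f" using f by (simp add: steklov_eigenfunction_def)
  then have sm: "smooth_on (cylinder L) f" by (simp add: harmonic_def)
  then obtain U F where UF: "open U" "cylinder L \<subseteq> U" "\<And>k. Ck_on k U F" "\<And>q. q \<in> cylinder L \<Longrightarrow> F q = f q"
    unfolding smooth_on_def by blast
  define A where "A r = F (r, e)" for r
  define A1 where "A1 r = frechet_derivative F (at (r, e)) (1, 0)" for r
  define A2 where "A2 r = frechet_derivative (\<lambda>q. frechet_derivative F (at q) (1, 0)) (at (r, e)) (1, 0)" for r
  have re: "(r, e) \<in> cylinder L" if "r \<in> {0..L}" for r using that e by (auto simp: cylinder_def)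
  have Af: "A r = f (r, e)" if "r \<in> {0..L}" for r using UF(4)[OF re[OF that]] by (simp add: A_def)
  have slice: "((\<lambda>r. G (r, e)) has_real_derivative frechet_derivative G (at (r, e)) (1, 0)) (at r)"
    if G: "Ck_on (Suc 0) U G" and r: "r \<in> {0..L}" for G r
  proof -
    have d: "(G has_derivative frechet_derivative G (at (r, e))) (at (r, e))"
      using has_derivative_Ck[OF G] re[OF r] UF(2) by blast
    have "((\<lambda>r. (r, e)) has_derivative (\<lambda>t. (t, 0))) (at r)"
      by (auto intro!: derivative_eq_intros)
    from has_derivative_compose[OF this d]
    have "((\<lambda>r. G (r, e)) has_derivative (\<lambda>t. frechet_derivative G (at (r, e)) (t, 0))) (at r)" .
    moreover have "(\<lambda>t. frechet_derivative G (at (r, e)) (t, 0)) = (*) (frechet_derivative G (at (r, e)) (1, 0))"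
    proof
      fix t :: real
      show "frechet_derivative G (at (r, e)) (t, 0) = frechet_derivative G (at (r, e)) (1, 0) * t"
        using linear_scale[OF has_derivative_linear[OF d], of t "(1, 0)"] by simp
    qed
    ultimately show ?thesis unfolding has_field_derivative_def by metis
  qed
  have CF: "Ck_on (Suc (Suc 0)) U F" by (rule UF)
  have dA: "(A has_real_derivative A1 r) (at r)" if "r \<in> {0..L}" for r
    unfolding A_def A1_def by (rule slice[OF UF(3) that])
  have "Ck_on (Suc 0) U (\<lambda>q. frechet_derivative F (at q) (1, 0))"
    using CF unfolding Ck_on.simps(2)[of "Suc 0"] by blast
  then have dA1: "(A1 has_real_derivative A2 r) (at r)" if "r \<in> {0..L}" for r
    unfolding A1_def A2_def using slice that by blast
  have contA: "continuous_on {0..L} A"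
    by (rule continuous_on_DERIV[OF dA])
  have contA1: "continuous_on {0..L} A1"
    by (rule continuous_on_DERIV[OF dA1])
  have ode: "A2 r + m * deriv h r / h r * A1 r = 0" if r: "r \<in> {0<..<L}" for r
  proof -
    define x where "x = (1 + r) *\<^sub>R e"
    have nx: "norm x = 1 + r" using e r by (simp add: x_def)
    have x: "x \<in> annulus" using nx r by auto
    define u where "u y = A (norm y - 1) * (\<lambda>t. 1) ((y \<bullet> e) / norm y)" for y :: "real^'n"
    have u_twice: "twice_on annulus u"
      unfolding u_def by (rule laplace_separated(1)[OF e, of A A1 A2 _ "\<lambda>t. 0" "\<lambda>t. 0"]) (auto intro: dA dA1)
    have u_laplace: "laplace u x
       = (A2 r + m * deriv h r / h r * A1 r) * 1
         + A r / (h r)\<^sup>2 * ((1 - ((x \<bullet> e) / norm x)\<^sup>2) * 0 - m * ((x \<bullet> e) / norm x) * 0)"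
      unfolding u_def
      by (rule laplace_separated(2)[OF e, of A A1 A2 "\<lambda>t. 1" "\<lambda>t. 0" "\<lambda>t. 0" x r "(x \<bullet> e) / norm x"])
         (use x nx in \<open>auto intro: dA dA1\<close>)
    have eq: "(f \<circ> polar) y = u y" if y: "y \<in> annulus" for y
    proof -
      have "f (norm y - 1, (1 / norm y) *\<^sub>R y) = f (norm y - 1, e)"
        using y e by (intro radial) auto
      then show ?thesis using y by (simp add: u_def polar_def Af)
    qed
    have "laplace u x = laplace (f \<circ> polar) x"
      by (rule laplace_cong[OF x twice_on_comp_polar[OF sm] _ u_twice, symmetric]) (rule eq)
    also have "\<dots> = 0"
      using harm x unfolding harmonic_def by blast
    finally have "laplace u x = 0" .
    then show ?thesis unfolding u_laplace by simp
  qed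
  have dA': "(A has_real_derivative A1 r) (at r)" and dA1': "(A1 has_real_derivative A2 r) (at r)"
    if "r \<in> {0<..<L}" for r using dA dA1 that by auto
  have sol1: "A1 L = A1 0"
    by (rule radial_ode(1)[OF dA' dA1' contA contA1 ode])
  have sol2: "A r - A 0 = A1 0 * (width r - width 0)" if r: "r \<in> {0..L}" for r
    by (rule radial_ode(2)[OF dA' dA1' contA contA1 ode r])
  \<comment> \<open>\<open>A\<close> comes from the extension \<open>F\<close> and agrees with f
    only on [0, L]; at the ends the one-sided derivative identifies \<open>A1\<close>.\<close>
  have bd: "A1 r = D" if r: "r \<in> {0, L}" and D: "((\<lambda>t. f (t, e)) has_real_derivative D) (at r within {0..L})" for r D
  proof -
    have r': "r \<in> {0..L}" using r L_pos by auto
    have "(A has_real_derivative D) (at r within {0..L})"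
      using D r' unfolding has_field_derivative_def
      by (rule has_derivative_transform[rotated 2]) (simp_all add: Af)
    then show ?thesis
      using vector_derivative_unique_within_closed_interval[of 0 L r A "A1 r" D] L_pos r'
        has_field_derivative_at_within[OF dA[OF r'], of "{0..L}"]
      by (simp add: has_real_derivative_iff_has_vector_derivative)
  qed
  have b0: "A1 0 = - \<sigma> * A 0" and bL: "A1 L = \<sigma> * A L"
    using bd[OF _ steklov_boundary(1)[OF f e]] bd[OF _ steklov_boundary(2)[OF f e]] Af L_pos by auto
  define I where "I = width L - width 0"
  have I: "I > 0" using width_strict_mono by (simp add: I_def)
  have "A1 0 \<noteq> 0"
  proof
    assume "A1 0 = 0"
    then have A0: "A r = A 0" if "r \<in> {0..L}" for r using sol2[OF that] by simp
    have "f q = A 0" if "q \<in> cylinder L" for q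
    proof -
      have "q = (fst q, snd q)" "fst q \<in> {0..L}" "norm (snd q) = 1"
        using that by (auto simp: cylinder_def)
      then obtain r p where q: "q = (r, p)" "r \<in> {0..L}" "norm p = 1" by blast
      have "f q = f (r, e)" unfolding q(1) by (rule radial[OF q(2,3) e])
      also have "\<dots> = A 0" using Af[OF q(2)] A0[OF q(2)] by simp
      finally show ?thesis .
    qed
    then show False using nonconst by metis
  qed
  moreover have "A L - A 0 = A1 0 * I" using sol2[of L] L_pos by (simp add: I_def)
  moreover have "\<sigma> * (A L - A 0) = 2 * A1 0" using b0 bL sol1 by (simp add: algebra_simps)
  ultimately have "\<sigma> * I = 2" by simp
  then show ?thesis using I by (simp add: I_def field_simps)
qed

section \<open>The first eigenvalue as an infimum\<close>

definition eigen_bounds :: "real set" where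
  "eigen_bounds = {x. \<exists>f \<sigma>. (\<forall>i\<le>1::nat. \<sigma> i \<le> x \<and> steklov_eigenfunction L g (\<sigma> i) (f i)) \<and>
     (\<forall>c. (\<forall>q\<in>cylinder L. (\<Sum>i\<le>1. c i * f i q) = 0) \<longrightarrow> (\<forall>i\<le>1. c i = 0))}"

lemma steklov_eigenvalue_1: "steklov_eigenvalue L g 1 = Inf eigen_bounds"
  by (simp add: steklov_eigenvalue_def eigen_bounds_def)

lemma constant_eigenfunction: "steklov_eigenfunction L g 0 (\<lambda>q. 1)"
proof -
  obtain e :: "real^'n" where e: "norm e = 1" by (rule unit_vector)
  have "steklov_eigenfunction L g 0 (\<lambda>(r, p). (\<lambda>r. 1) r * (1 + 0 * (p \<bullet> e)))"
    using L_pos by (intro separated_eigenfunction[OF e] Ck_on_const open_greaterThanLessThan) auto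
  then show ?thesis by (simp add: case_prod_beta')
qed

text \<open>The constants are the second member of an independent pair; their eigenvalue 0 causes
  the maximum.\<close>

lemma eigen_boundsI:
  assumes f: "steklov_eigenfunction L g \<sigma> f"
    and nonconst: "z \<in> cylinder L" "z' \<in> cylinder L" "f z \<noteq> f z'"
  shows "max 0 \<sigma> \<in> eigen_bounds"
  unfolding eigen_bounds_def mem_Collect_eq
proof (rule exI[of _ "\<lambda>i. if i = 0 then (\<lambda>q. 1) else f"], rule exI[of _ "\<lambda>i. if i = 0 then 0 else \<sigma>"],
    intro conjI allI impI)
  fix c :: "nat \<Rightarrow> real" and i :: nat
  assume "\<forall>q\<in>cylinder L. (\<Sum>i\<le>1. c i * (if i = 0 then (\<lambda>q. 1) else f) q) = 0" and i: "i \<le> 1"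
  then have eq: "c 0 + c 1 * f q = 0" if "q \<in> cylinder L" for q using that by simp
  have "c 1 * (f z - f z') = (c 0 + c 1 * f z) - (c 0 + c 1 * f z')" by (simp add: algebra_simps)
  also have "\<dots> = 0" by (simp only: eq[OF nonconst(1)] eq[OF nonconst(2)] diff_self)
  finally have "c 1 = 0" using nonconst by simp
  then have "c 0 = 0" using eq[OF nonconst(1)] by simp
  then show "c i = 0" using \<open>c 1 = 0\<close> i by (cases i) auto
qed (use f constant_eigenfunction in auto)

lemma steklov_eigenvalue_le:
  assumes "steklov_eigenfunction L g \<sigma> f" "z \<in> cylinder L" "z' \<in> cylinder L" "f z \<noteq> f z'"
  shows "steklov_eigenvalue L g 1 \<le> max 0 \<sigma>"
proof -
  obtain C where "\<And>\<sigma> f. steklov_eigenfunction L g \<sigma> f \<Longrightarrow> C \<le> \<sigma>" using eigenvalues_bounded_below by metis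
  then have "bdd_below eigen_bounds"
    unfolding eigen_bounds_def by (intro bdd_belowI[of _ C]) (force intro: order_trans)
  then show ?thesis unfolding steklov_eigenvalue_1 by (intro cInf_lower eigen_boundsI[OF assms])
qed

lemma radial_eigenfunction_exists:
  obtains f z z' where "steklov_eigenfunction L g (2 / (width L - width 0)) f"
    "z \<in> cylinder L" "z' \<in> cylinder L" "f z \<noteq> f z'"
proof -
  obtain e :: "real^'n" where e: "norm e = 1" by (rule unit_vector)
  \<comment> \<open>The subtracted mean makes A(L) = -A(0), so that both boundary conditions hold
    with the same \<sigma>.\<close>
  define A where "A r = width r - (width 0 + width L) / 2" for r
  define f where "f = (\<lambda>(r, p::real^'n). A r * (1 + 0 * (p \<bullet> e)))"
  define k where "k = CARD('n) - 1"
  have k: "m = real k" using dim by (simp add: k_def m_eq)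
  have dA: "(A has_real_derivative inverse (h r ^ k)) (at r)" if "r \<in> {a<..<b}" for r
  proof -
    have "(A has_real_derivative 1 / h r ^ (CARD('n) - 1) - 0) (at r)"
      unfolding A_def by (intro DERIV_diff width_deriv that DERIV_const)
    then show ?thesis by (simp add: k_def divide_inverse)
  qed
  then have A1: "deriv A r = inverse (h r ^ k)" if "r \<in> {a<..<b}" for r
    using that by (blast intro: DERIV_imp_deriv)
  have A2: "deriv (deriv A) r = - (real k * deriv h r / h r * inverse (h r ^ k))" if r: "r \<in> {a<..<b}" for r
  proof (rule DERIV_imp_deriv)
    have "((\<lambda>r. inverse (h r ^ k)) has_real_derivative - (real k * deriv h r / h r * inverse (h r ^ k))) (at r)"
      using h_pos[OF r] by (intro DERIV_inverse_power h_deriv[OF r]) simp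
    then show "(deriv A has_real_derivative - (real k * deriv h r / h r * inverse (h r ^ k))) (at r)"
      by (rule has_field_derivative_transform_within_open[OF _ open_greaterThanLessThan r]) (simp add: A1)
  qed
  have I: "width 0 < width L" by (rule width_strict_mono)
  have in0: "0 \<in> {a<..<b}" "L \<in> {a<..<b}" using L_pos interval by auto
  have "steklov_eigenfunction L g (2 / (width L - width 0)) f"
    unfolding f_def
  proof (rule separated_eigenfunction[OF e])
    show "Ck_on k {a<..<b} A" for k
      unfolding A_def by (intro Ck_on_diff Ck_on_const width_smooth open_greaterThanLessThan)
    show "(deriv (deriv A) r + m * deriv h r / h r * deriv A r) * (1 + 0 * t) + A r / (h r)\<^sup>2 * - (m * t * 0) = 0"
      if "r \<in> {0<..<L}" for r t
      using that interval[of r] by (simp add: A1 A2 k)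
    show "deriv A 0 = - (2 / (width L - width 0)) * A 0" "deriv A L = 2 / (width L - width 0) * A L"
      using I in0 by (simp_all add: A1 h_0 h_L A_def field_simps)
    show "\<exists>r\<in>{0..L}. A r \<noteq> 0" using L_pos I by (intro bexI[of _ L]) (auto simp: A_def)
  qed simp
  moreover have "f (0, e) \<noteq> f (L, e)" using I by (simp add: f_def A_def)
  moreover have "(0, e) \<in> cylinder L" "(L, e) \<in> cylinder L" using e L_pos by (auto simp: cylinder_def)
  ultimately show thesis using that by blast
qed

lemma steklov_eigenvalue_le_radial: "steklov_eigenvalue L g 1 \<le> 2 / (width L - width 0)"
proof -
  obtain f z z' where "steklov_eigenfunction L g (2 / (width L - width 0)) f"
    "z \<in> cylinder L" "z' \<in> cylinder L" "f z \<noteq> f z'" by (rule radial_eigenfunction_exists)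
  from steklov_eigenvalue_le[OF this] show ?thesis using width_strict_mono by (simp add: max_def)
qed

text \<open>If both eigenvalues of a pair were below s, both eigenfunctions would be constant, hence
  linearly dependent.\<close>

lemma steklov_eigenvalue_ge:
  assumes "\<And>\<sigma> f z z'. steklov_eigenfunction L g \<sigma> f \<Longrightarrow> z \<in> cylinder L \<Longrightarrow> z' \<in> cylinder L \<Longrightarrow>
    f z \<noteq> f z' \<Longrightarrow> s \<le> \<sigma>"
  shows "s \<le> steklov_eigenvalue L g 1"
  unfolding steklov_eigenvalue_1
proof (rule cInf_greatest)
  show "eigen_bounds \<noteq> {}" using radial_eigenfunction_exists eigen_boundsI by (metis empty_iff)
  fix x assume "x \<in> eigen_bounds"
  then obtain f \<sigma> where f: "\<And>i. i \<le> (1::nat) \<Longrightarrow> \<sigma> i \<le> x \<and> steklov_eigenfunction L g (\<sigma> i) (f i)"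
    and indep: "\<And>c. (\<forall>q\<in>cylinder L. (\<Sum>i\<le>1. c i * f i q) = 0) \<Longrightarrow> (\<forall>i\<le>1. c i = 0)"
    unfolding eigen_bounds_def by blast
  show "s \<le> x"
  proof (rule ccontr)
    assume "\<not> s \<le> x"
    then have const: "f i z = f i z'" if "i \<le> 1" "z \<in> cylinder L" "z' \<in> cylinder L" for i z z'
      using assms[of "\<sigma> i" "f i" z z'] f[OF that(1)] that by force
    obtain q0 where q0: "q0 \<in> cylinder L" "f 0 q0 \<noteq> 0"
      using f[of 0] unfolding steklov_eigenfunction_def by auto
    define c where "c i = (if i = 0 then f 1 q0 else - f 0 q0)" for i :: nat
    have "(\<Sum>i\<le>1. c i * f i q) = 0" if "q \<in> cylinder L" for q
      using const[of 0 q q0] const[of 1 q q0] that q0 by (simp add: c_def)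
    then have "c 1 = 0" using indep[of c] by blast
    then show False using q0 by (simp add: c_def)
  qed
qed

end

section \<open>The first non-radial mode\<close>

lemma deriv_nonneg_mono:
  fixes f :: "real \<Rightarrow> real"
  assumes "s \<le> t" "\<And>r. r \<in> {s..t} \<Longrightarrow> (f has_real_derivative f' r) (at r)" "\<And>r. r \<in> {s..t} \<Longrightarrow> 0 \<le> f' r"
  shows "f s \<le> f t"
  using assms by (intro DERIV_nonneg_imp_nondecreasing[OF assms(1)]) force

lemma DERIV_reflect:
  fixes f :: "real \<Rightarrow> real"
  assumes "(f has_real_derivative D) (at (c - r))"
  shows "((\<lambda>r. f (c - r)) has_real_derivative - D) (at r)"
proof -
  have "((\<lambda>r. c - r) has_real_derivative - 1) (at r)" by (auto intro!: derivative_eq_intros)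
  from DERIV_chain2[where f = f and g = "\<lambda>r. c - r", OF assms this] show ?thesis by simp
qed

lemma nonzero_imp_pos:
  fixes f :: "real \<Rightarrow> real"
  assumes "s \<le> t" "continuous_on {s..t} f" "f s > 0" "\<And>r. r \<in> {s..t} \<Longrightarrow> f r \<noteq> 0"
  shows "f t > 0"
proof (rule ccontr)
  assume "\<not> ?thesis"
  then obtain r where "s \<le> r" "r \<le> t" "f r = 0"
    using IVT2'[of f t 0 s] assms by auto
  then show False using assms(4)[of r] by simp
qed

text \<open>(u v)' = p v^2 + q u^2 is nonnegative, so u v stays nonnegative; then u^2 and v^2 are
  nondecreasing, and a component that starts positive never reaches 0.\<close>

lemma linear_system_positivity:
  fixes u v p q :: "real \<Rightarrow> real"
  assumes u: "\<And>r. r \<in> {0..l} \<Longrightarrow> (u has_real_derivative p r * v r) (at r)"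
    and v: "\<And>r. r \<in> {0..l} \<Longrightarrow> (v has_real_derivative q r * u r) (at r)"
    and pq: "\<And>r. r \<in> {0..l} \<Longrightarrow> p r > 0" "\<And>r. r \<in> {0..l} \<Longrightarrow> q r > 0"
    and init: "u 0 * v 0 = 0" and r: "r \<in> {0..l}"
  shows "u 0 > 0 \<Longrightarrow> u r > 0" and "v 0 > 0 \<Longrightarrow> v r > 0"
proof -
  have contu: "continuous_on {0..l} u"
    by (rule continuous_on_DERIV[OF u])
  have contv: "continuous_on {0..l} v"
    by (rule continuous_on_DERIV[OF v])
  have uv: "u s * v s \<ge> 0" if s: "s \<in> {0..l}" for s
  proof -
    have "u 0 * v 0 \<le> u s * v s"
    proof (rule deriv_nonneg_mono[where f = "\<lambda>r. u r * v r"])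
      show "((\<lambda>r. u r * v r) has_real_derivative p t * v t * v t + q t * u t * u t) (at t)" if "t \<in> {0..s}" for t
        using DERIV_mult[OF u v, of t] that s by simp
      show "0 \<le> p t * v t * v t + q t * u t * u t" if "t \<in> {0..s}" for t
        using pq[of t] that s by (simp add: mult.assoc)
    qed (use s in auto)
    then show ?thesis using init by simp
  qed
  have nz: "(f 0)\<^sup>2 \<le> (f s)\<^sup>2" if s: "s \<in> {0..l}"
    and f: "\<And>r. r \<in> {0..l} \<Longrightarrow> (f has_real_derivative w r * f' r) (at r)"
    and w: "\<And>r. r \<in> {0..l} \<Longrightarrow> w r > 0" and ff: "\<And>r. r \<in> {0..l} \<Longrightarrow> f r * f' r \<ge> 0"
    for f f' w :: "real \<Rightarrow> real" and s
  proof (rule deriv_nonneg_mono[where f = "\<lambda>r. (f r)\<^sup>2"])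
    show "((\<lambda>r. (f r)\<^sup>2) has_real_derivative 2 * w t * (f t * f' t)) (at t)" if "t \<in> {0..s}" for t
      using DERIV_power[OF f, of t 2] that s by (simp add: mult_ac)
    show "0 \<le> 2 * w t * (f t * f' t)" if "t \<in> {0..s}" for t
      using w[of t] ff[of t] that s by simp
  qed (use s in auto)
  show "u r > 0" if u0: "u 0 > 0"
  proof (rule nonzero_imp_pos[of 0 r u])
    show "u s \<noteq> 0" if "s \<in> {0..r}" for s
      using nz[of s u p v, OF _ u pq(1) uv] that r u0 by auto
  qed (use r u0 in \<open>auto intro: continuous_on_subset[OF contu]\<close>)
  show "v r > 0" if v0: "v 0 > 0"
  proof (rule nonzero_imp_pos[of 0 r v])
    show "v s \<noteq> 0" if "s \<in> {0..r}" for s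
      using nz[of s v q u, OF _ v pq(2)] uv that r v0 by (auto simp: mult.commute)
  qed (use r v0 in \<open>auto intro: continuous_on_subset[OF contv]\<close>)
qed

text \<open>z is the flux y'/p, and c, s play the part of cosh and sinh. \<Theta> is positive at 0,
  and the Wronskian makes it negative at \<sigma>1 = c(l)/s(l), so it has a zero in between.\<close>

lemma robin_solution_exists:
  fixes p q :: "real \<Rightarrow> real"
  assumes ab: "a < 0" "0 < l" "l < b"
    and cont: "continuous_on {a..b} p" "continuous_on {a..b} q"
    and smooth: "\<And>k. Ck_on k {a<..<b} p" "\<And>k. Ck_on k {a<..<b} q"
    and pq: "\<And>r. r \<in> {0..l} \<Longrightarrow> p r > 0" "\<And>r. r \<in> {0..l} \<Longrightarrow> q r > 0"
  obtains y z \<sigma> where "\<sigma> > 0" "y 0 = 1" "z 0 = - \<sigma>" "z l = \<sigma> * y l"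
    "\<And>r. r \<in> {0..l} \<Longrightarrow> y r > 0"
    "\<And>t. t \<in> {a<..<b} \<Longrightarrow> (y has_real_derivative p t * z t) (at t)"
    "\<And>t. t \<in> {a<..<b} \<Longrightarrow> (z has_real_derivative q t * y t) (at t)"
    "\<And>k. Ck_on k {a<..<b} y"
proof -
  have ab': "a < 0" "0 < b" using ab by auto
  have sub: "r \<in> {a<..<b}" if "r \<in> {0..l}" for r using that ab by auto
  obtain c c' where c: "c 0 = 1" "c' 0 = 0"
    "\<And>t. t \<in> {a<..<b} \<Longrightarrow> (c has_real_derivative p t * c' t) (at t)"
    "\<And>t. t \<in> {a<..<b} \<Longrightarrow> (c' has_real_derivative q t * c t) (at t)"
    "\<And>k. Ck_on k {a<..<b} c"
    using linear_ivp[OF ab' cont smooth, of 1 0] by metis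
  obtain s s' where s: "s 0 = 0" "s' 0 = 1"
    "\<And>t. t \<in> {a<..<b} \<Longrightarrow> (s has_real_derivative p t * s' t) (at t)"
    "\<And>t. t \<in> {a<..<b} \<Longrightarrow> (s' has_real_derivative q t * s t) (at t)"
    "\<And>k. Ck_on k {a<..<b} s"
    using linear_ivp[OF ab' cont smooth, of 0 1] by metis
  have c_pos: "c r > 0" if "r \<in> {0..l}" for r
    by (rule linear_system_positivity(1)[of l c p c' q]) (use c pq sub that in auto)
  have s'_pos: "s' r > 0" if "r \<in> {0..l}" for r
    by (rule linear_system_positivity(2)[of l s p s' q]) (use s pq sub that in auto)
  have incr: "f 0 < f r" if "0 < r" "r \<le> l"
    and "\<And>t. t \<in> {0..l} \<Longrightarrow> (f has_real_derivative f' t) (at t)" "\<And>t. t \<in> {0..l} \<Longrightarrow> f' t > 0"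
    for r f f'
    by (rule DERIV_pos_imp_increasing[OF that(1)]) (use that in force)
  have s_pos: "s r > 0" if "0 < r" "r \<le> l" for r
    using incr[OF that, of s "\<lambda>t. p t * s' t"] s sub pq s'_pos by simp
  have c'_pos: "c' l > 0"
    using incr[of l c' "\<lambda>t. q t * c t"] ab c sub pq c_pos by simp
  have wronskian: "c r * s' r - s r * c' r = 1" if r: "r \<in> {0..l}" for r
  proof (cases "r = 0")
    case False
    define W where "W r = c r * s' r - s r * c' r" for r
    have d: "(W has_real_derivative 0) (at t)" if "t \<in> {0..l}" for t
      unfolding W_def
      by (rule derivative_eq_intros c(3,4)[OF sub[OF that]] s(3,4)[OF sub[OF that]] refl)+
         (simp add: algebra_simps)
    have "continuous_on {0..l} W"
      by (rule continuous_on_DERIV[OF d])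
    then have "W r = W 0"
      using r False by (intro DERIV_isconst_end) (auto intro: continuous_on_subset d)
    then show ?thesis by (simp add: W_def c s)
  qed (simp add: c s)
  define \<sigma>1 where "\<sigma>1 = c l / s l"
  \<comment> \<open>Shooting: \<open>y = c - \<sigma> s\<close> meets the condition at \<open>l\<close> iff \<open>\<Theta> \<sigma> = 0\<close>, and it is positive as long as
    \<open>\<sigma> < \<sigma>1\<close>, because \<open>c / s\<close> decreases.\<close>
  define \<Theta> where "\<Theta> \<sigma> = c' l - \<sigma> * s' l - \<sigma> * (c l - \<sigma> * s l)" for \<sigma>
  have sl: "s l > 0" and cl: "c l > 0" using s_pos[of l] c_pos[of l] ab by auto
  have "\<Theta> \<sigma>1 * s l = - (c l * s' l - s l * c' l)"
    using sl by (simp add: \<Theta>_def \<sigma>1_def field_simps)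
  then have "\<Theta> \<sigma>1 * s l = -1" using wronskian[of l] ab by simp
  then have neg: "\<Theta> \<sigma>1 < 0" using sl by (smt (verit) mult_nonneg_nonneg)
  have \<sigma>1: "\<sigma>1 > 0" using sl cl by (simp add: \<sigma>1_def)
  have "continuous_on {0..\<sigma>1} \<Theta>" unfolding \<Theta>_def by (intro continuous_intros)
  then obtain \<sigma> where \<sigma>: "0 \<le> \<sigma>" "\<sigma> \<le> \<sigma>1" "\<Theta> \<sigma> = 0"
    using IVT2'[of \<Theta> \<sigma>1 0 0] neg c'_pos \<sigma>1 by (auto simp: \<Theta>_def)
  have "\<sigma> \<noteq> 0" using \<sigma>(3) c'_pos by (auto simp: \<Theta>_def)
  then have \<sigma>0: "\<sigma> > 0" using \<sigma> by simp
  have \<sigma>lt: "\<sigma> < \<sigma>1" using \<sigma> neg by (cases "\<sigma> = \<sigma>1") auto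
  define y where "y r = c r - \<sigma> * s r" for r
  define z where "z r = c' r - \<sigma> * s' r" for r
  have dy: "(y has_real_derivative p t * z t) (at t)" and dz: "(z has_real_derivative q t * y t) (at t)"
    if "t \<in> {a<..<b}" for t
    unfolding y_def z_def using DERIV_diff[OF c(3)[OF that] DERIV_cmult[OF s(3)[OF that], of \<sigma>]]
      DERIV_diff[OF c(4)[OF that] DERIV_cmult[OF s(4)[OF that], of \<sigma>]]
    by (simp_all add: algebra_simps)
  have y_pos: "y r > 0" if r: "r \<in> {0..l}" for r
  proof (cases "r = 0")
    case False
    then have r0: "0 < r" using r by simp
    have "\<sigma>1 \<le> c r / s r"
      unfolding \<sigma>1_def
    proof (rule DERIV_nonpos_imp_nonincreasing[of r l "\<lambda>t. c t / s t"])
      fix t assume t: "r \<le> t" "t \<le> l"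
      then have st: "s t > 0" "t \<in> {0..l}" using s_pos[of t] r0 by auto
      have "((\<lambda>t. c t / s t) has_real_derivative (p t * c' t * s t - c t * (p t * s' t)) / (s t * s t)) (at t)"
        using st sub by (intro DERIV_divide c(3) s(3)) auto
      moreover have "p t * c' t * s t - c t * (p t * s' t) = - p t"
        using arg_cong[OF wronskian[OF st(2)], of "\<lambda>w. - p t * w"] by (simp add: algebra_simps)
      moreover have "- p t / (s t * s t) \<le> 0" using st pq(1)[OF st(2)] by (simp add: divide_nonpos_pos)
      ultimately show "\<exists>y. ((\<lambda>t. c t / s t) has_real_derivative y) (at t) \<and> y \<le> 0" by auto
    qed (use r in auto)
    then have "\<sigma> < c r / s r" using \<sigma>lt by simp
    then show ?thesis using s_pos[OF r0] r by (simp add: y_def pos_less_divide_eq)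
  qed (simp add: y_def c s)
  show thesis
  proof (rule that[of \<sigma> y z])
    show "Ck_on k {a<..<b} y" for k
      unfolding y_def by (intro Ck_on_diff Ck_on_mult Ck_on_const c s open_greaterThanLessThan)
    show "z l = \<sigma> * y l" using \<sigma>(3) by (simp add: \<Theta>_def z_def y_def)
  qed (use \<sigma>0 y_pos dy dz c s in \<open>auto simp: y_def z_def\<close>)
qed

text \<open>Picone's identity: \<open>z\<close> and \<open>w\<close> are the fluxes \<open>H y'\<close> and \<open>P c'\<close>.\<close>

lemma picone_comparison:
  fixes y z c c1 w :: "real \<Rightarrow> real"
  assumes st: "s \<le> t" and m: "0 \<le> m"
    and y: "\<And>r. r \<in> {s..t} \<Longrightarrow> (y has_real_derivative z r / H r) (at r)"
    and z: "\<And>r. r \<in> {s..t} \<Longrightarrow> (z has_real_derivative m * H2 r * y r) (at r)"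
    and c: "\<And>r. r \<in> {s..t} \<Longrightarrow> (c has_real_derivative c1 r) (at r)"
    and w: "\<And>r. r \<in> {s..t} \<Longrightarrow> (w has_real_derivative m * P2 r * c r) (at r)"
    and wP: "\<And>r. r \<in> {s..t} \<Longrightarrow> w r = P r * c1 r"
    and y_pos: "\<And>r. r \<in> {s..t} \<Longrightarrow> y r > 0"
    and HP: "\<And>r. r \<in> {s..t} \<Longrightarrow> 0 < H r" "\<And>r. r \<in> {s..t} \<Longrightarrow> H r \<le> P r" "\<And>r. r \<in> {s..t} \<Longrightarrow> H2 r \<le> P2 r"
  shows "z t * (c t)\<^sup>2 / y t - w t * c t \<le> z s * (c s)\<^sup>2 / y s - w s * c s"
proof (rule DERIV_nonpos_imp_nonincreasing[OF st, of "\<lambda>r. z r * (c r)\<^sup>2 / y r - w r * c r"])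
  fix r assume "s \<le> r" "r \<le> t"
  then have r: "r \<in> {s..t}" by simp
  define D where "D = m * (H2 r - P2 r) * (c r)\<^sup>2 + (H r - P r) * (c1 r)\<^sup>2
      - (z r * c r / y r - H r * c1 r)\<^sup>2 / H r"
  have "((\<lambda>r. z r * (c r)\<^sup>2 / y r - w r * c r) has_real_derivative D) (at r)"
    using y_pos[OF r] HP(1)[OF r]
    by (auto intro!: derivative_eq_intros y[OF r] z[OF r] c[OF r] w[OF r]
        simp: D_def wP[OF r] field_simps power2_eq_square)
  moreover have "D \<le> 0"
  proof -
    have "m * (H2 r - P2 r) * (c r)\<^sup>2 \<le> 0"
      using m HP(3)[OF r] by (intro mult_nonpos_nonneg mult_nonneg_nonpos) auto
    moreover have "(H r - P r) * (c1 r)\<^sup>2 \<le> 0"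
      using HP(2)[OF r] by (intro mult_nonpos_nonneg) auto
    moreover have "(z r * c r / y r - H r * c1 r)\<^sup>2 / H r \<ge> 0"
      using HP(1)[OF r] by simp
    ultimately show ?thesis by (simp add: D_def)
  qed
  ultimately show "\<exists>D. ((\<lambda>r. z r * (c r)\<^sup>2 / y r - w r * c r) has_real_derivative D) (at r) \<and> D \<le> 0"
    by blast
qed

section \<open>Comparing the first mode with the tent\<close>

context unit_profile
begin

lemma h_le: assumes "r \<in> {0..L}" shows "h r \<le> 1 + r" "h r \<le> 1 + L - r"
proof -
  have d: "((\<lambda>r. (1 + r) - h r) has_real_derivative 1 - deriv h s) (at s)"
    "((\<lambda>r. h r - (1 + L - r)) has_real_derivative deriv h s + 1) (at s)" if "s \<in> {0..L}" for s
    using h_deriv[OF interval[OF that]] by (auto intro!: derivative_eq_intros)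
  have "(1 + 0) - h 0 \<le> (1 + r) - h r"
    using assms slope by (intro deriv_nonneg_mono[OF _ d(1)]) (auto simp: abs_le_iff)
  then show "h r \<le> 1 + r" by (simp add: h_0)
  have "h r - (1 + L - r) \<le> h L - (1 + L - L)"
  proof (rule deriv_nonneg_mono[OF _ d(2)])
    fix s assume "s \<in> {r..L}"
    then show s: "s \<in> {0..L}" using assms by auto
    show "0 \<le> deriv h s + 1" using slope[OF s] by linarith
  qed (use assms in auto)
  then show "h r \<le> 1 + L - r" by (simp add: h_L)
qed

text \<open>With x = 1 + r, the left half of the tent has the Euclidean metric dx^2 + x^2 g_0, whose
  first-mode solutions are spanned by x and x^(1 - n). A combination \<open>G\<close>, mirrored to
  the right half, is compared with the solution y found by shooting.\<close>

lemma steklov_eigenvalue_le_first_mode: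
  defines "M \<equiv> 1 + L / 2" and "n \<equiv> CARD('n)"
  shows "steklov_eigenvalue L g 1 \<le> (real n - 1) * (M ^ n - 1) / (M ^ n + real n - 1)"
proof -
  obtain j where j: "n = j + 3" using dim by (metis add.commute le_iff_add n_def)
  have m: "m = real j + 2" by (simp add: m_eq j[unfolded n_def])
  have sub: "r \<in> {a<..<b}" if "r \<in> {0..L}" for r using interval[OF that] .
  define p where "p r = inverse (h r ^ (j + 2))" for r
  define q where "q r = m * h r ^ j" for r
  have "0 \<in> {a<..<b}" using sub L_pos by auto
  obtain y z \<sigma> where \<sigma>: "\<sigma> > 0" and y0: "y 0 = 1" "z 0 = - \<sigma>" and yL: "z L = \<sigma> * y L"
    and y_pos: "\<And>r. r \<in> {0..L} \<Longrightarrow> y r > 0"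
    and dy: "\<And>t. t \<in> {a<..<b} \<Longrightarrow> (y has_real_derivative p t * z t) (at t)"
    and dz: "\<And>t. t \<in> {a<..<b} \<Longrightarrow> (z has_real_derivative q t * y t) (at t)"
    and y_smooth: "\<And>k. Ck_on k {a<..<b} y"
  proof (rule robin_solution_exists[OF a_neg L_pos L_less, of p q])
    show "continuous_on {a..b} p" "continuous_on {a..b} q"
      unfolding p_def q_def using h_pos' by (intro continuous_intros h_cont; force)+
    show "Ck_on k {a<..<b} p" for k
      unfolding p_def using h_pos by (intro Ck_on_inverse Ck_on_power h_smooth open_greaterThanLessThan) force
    show "Ck_on k {a<..<b} q" for k
      unfolding q_def by (intro Ck_on_mult Ck_on_const Ck_on_power h_smooth open_greaterThanLessThan)
    show "p r > 0" "q r > 0" if "r \<in> {0..L}" for r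
      using h_pos[OF sub[OF that]] m by (simp_all add: p_def q_def)
  qed blast
  obtain e :: "real^'n" where e: "norm e = 1" by (rule unit_vector)
  define f where "f = (\<lambda>(r, x::real^'n). y r * (0 + 1 * (x \<bullet> e)))"
  have y1: "deriv y t = p t * z t" if "t \<in> {a<..<b}" for t
    using dy[OF that] by (rule DERIV_imp_deriv)
  have y2: "deriv (deriv y) t = q t * y t * p t - m * deriv h t / h t * (p t * z t)" if t: "t \<in> {a<..<b}" for t
  proof (rule DERIV_imp_deriv)
    have dp: "(p has_real_derivative - (m * deriv h t / h t * p t)) (at t)"
      using DERIV_inverse_power[OF h_deriv[OF t], of "j + 2"] h_pos[OF t]
      unfolding p_def m by (simp add: add.commute)
    have "((\<lambda>t. p t * z t) has_real_derivative q t * y t * p t - m * deriv h t / h t * (p t * z t)) (at t)"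
      using DERIV_mult[OF dp dz[OF t]] by (simp add: algebra_simps)
    then show "(deriv y has_real_derivative q t * y t * p t - m * deriv h t / h t * (p t * z t)) (at t)"
      by (rule has_field_derivative_transform_within_open[OF _ open_greaterThanLessThan t]) (simp add: y1)
  qed
  have "steklov_eigenfunction L g \<sigma> f"
    unfolding f_def
  proof (rule separated_eigenfunction[OF e y_smooth])
    fix r t assume "r \<in> {0<..<L}"
    then have r: "r \<in> {a<..<b}" using sub by auto
    have "q r * y r * p r = m * y r / (h r)\<^sup>2"
      using h_pos[OF r] by (simp add: q_def p_def power_add power2_eq_square field_simps)
    then show "(deriv (deriv y) r + m * deriv h r / h r * deriv y r) * (0 + 1 * t) + y r / (h r)\<^sup>2 * - (m * t * 1) = 0"
      unfolding y2[OF r] y1[OF r] by simp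
  next
    show "deriv y 0 = - \<sigma> * y 0" "deriv y L = \<sigma> * y L"
      using y1 sub L_pos y0 yL by (simp_all add: p_def h_0 h_L)
    show "\<exists>r\<in>{0..L}. y r \<noteq> 0" using L_pos y0 by (intro bexI[of _ 0]) auto
  qed simp
  moreover have "f (0, e) \<noteq> f (0, - e)" using e y0 by (simp add: f_def norm_eq_1)
  moreover have "(0, e) \<in> cylinder L" "(0, - e) \<in> cylinder L" using e L_pos by (auto simp: cylinder_def)
  ultimately have le: "steklov_eigenvalue L g 1 \<le> \<sigma>" using steklov_eigenvalue_le[of \<sigma> f] \<sigma> by force
  have M: "M > 1" using L_pos by (simp add: M_def)
  define \<kappa> where "\<kappa> = m / M ^ n"
  \<comment> \<open>\<open>G (1 + r)\<close> is the solution for the tent, with vanishing derivative at the tip.\<close>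
  define G where "G x = \<kappa> * x + inverse (x ^ (j + 2))" for x :: real
  define G1 where "G1 x = \<kappa> - m * inverse (x ^ (j + 3))" for x :: real
  have dG: "(G has_real_derivative G1 x) (at x)" if x: "x > 0" for x
  proof -
    have "(G has_real_derivative \<kappa> * 1 + - (real (j + 2) * 1 / x * inverse (x ^ (j + 2)))) (at x)"
      unfolding G_def using x by (intro DERIV_add DERIV_cmult DERIV_ident DERIV_inverse_power) auto
    moreover have "\<kappa> * 1 + - (real (j + 2) * 1 / x * inverse (x ^ (j + 2))) = G1 x"
      using x by (simp add: G1_def m power_add eval_nat_numeral field_simps)
    ultimately show ?thesis by simp
  qed
  have dG1: "((\<lambda>x. x ^ (j + 2) * G1 x) has_real_derivative m * x ^ j * G x) (at x)" if x: "x > 0" for x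
  proof -
    have "((\<lambda>x. \<kappa> * x ^ (j + 2) - m * inverse x) has_real_derivative
        \<kappa> * (real (j + 2) * x ^ (j + 1)) - m * (- (inverse x * inverse x))) (at x)"
    proof (intro DERIV_diff DERIV_cmult)
      show "((\<lambda>x. x ^ (j + 2)) has_real_derivative real (j + 2) * x ^ (j + 1)) (at x)"
        using DERIV_pow[of "j + 2" x UNIV] by simp
      show "(inverse has_real_derivative - (inverse x * inverse x)) (at x)"
        using x by (auto intro!: derivative_eq_intros)
    qed
    moreover have "\<kappa> * (real (j + 2) * x ^ (j + 1)) - m * (- (inverse x * inverse x)) = m * x ^ j * G x"
      using x by (simp add: G_def m power_add power2_eq_square field_simps)
    ultimately have "((\<lambda>x. \<kappa> * x ^ (j + 2) - m * inverse x) has_real_derivative m * x ^ j * G x) (at x)" by simp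
    then show ?thesis
      by (rule has_field_derivative_transform_within_open[of _ _ _ "{0<..}"])
         (use x in \<open>auto simp: G1_def power_add eval_nat_numeral field_simps\<close>)
  qed
  have G1M: "G1 M = 0" using M by (simp add: G1_def \<kappa>_def j field_simps)
  have dy': "(y has_real_derivative z r / h r ^ (j + 2)) (at r)" if "r \<in> {0..L}" for r
    using dy[OF sub[OF that]] by (simp add: p_def field_simps)
  have dz': "(z has_real_derivative m * h r ^ j * y r) (at r)" if "r \<in> {0..L}" for r
    using dz[OF sub[OF that]] by (simp add: q_def)
  have hp: "h r > 0" if "r \<in> {0..L}" for r using h_pos[OF sub[OF that]] .
  have half: "r \<in> {0..L}" if "r \<in> {0..L/2}" for r using that L_pos by auto
  have half': "r \<in> {0..L}" if "r \<in> {L/2..L}" for r using that L_pos by auto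
  \<comment> \<open>The tent has a corner at L/2, so each half is treated by itself; the flux of the
    tent solution vanishes at the tip because G1 M = 0.\<close>
  have "z (L/2) * (G (1 + L/2))\<^sup>2 / y (L/2) - (1 + L/2) ^ (j + 2) * G1 (1 + L/2) * G (1 + L/2)
     \<le> z 0 * (G (1 + 0))\<^sup>2 / y 0 - (1 + 0) ^ (j + 2) * G1 (1 + 0) * G (1 + 0)"
  proof (rule picone_comparison[where H = "\<lambda>r. h r ^ (j + 2)" and ?H2.0 = "\<lambda>r. h r ^ j" and m = m
        and P = "\<lambda>r. (1 + r) ^ (j + 2)" and ?P2.0 = "\<lambda>r. (1 + r) ^ j" and c = "\<lambda>r. G (1 + r)"
        and ?c1.0 = "\<lambda>r. G1 (1 + r)" and w = "\<lambda>r. (1 + r) ^ (j + 2) * G1 (1 + r)"])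
    fix r assume r: "r \<in> {0..L/2}"
    have r1: "1 + r > 0" using r by simp
    show "((\<lambda>r. G (1 + r)) has_real_derivative G1 (1 + r)) (at r)"
      using dG[OF r1] DERIV_shift[of G _ r 1] by (simp add: add.commute)
    show "((\<lambda>r. (1 + r) ^ (j + 2) * G1 (1 + r)) has_real_derivative m * (1 + r) ^ j * G (1 + r)) (at r)"
      using dG1[OF r1] DERIV_shift[of "\<lambda>x. x ^ (j + 2) * G1 x" _ r 1] by (simp add: add.commute)
    show "h r ^ (j + 2) \<le> (1 + r) ^ (j + 2)" "h r ^ j \<le> (1 + r) ^ j"
      using h_le[OF half[OF r]] hp[OF half[OF r]] by (intro power_mono; simp)+
  qed (use L_pos m dy' dz' half y_pos hp in auto)
  moreover have "z L * (G (1 + L - L))\<^sup>2 / y L - - ((1 + L - L) ^ (j + 2) * G1 (1 + L - L)) * G (1 + L - L)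
     \<le> z (L/2) * (G (1 + L - L/2))\<^sup>2 / y (L/2) - - ((1 + L - L/2) ^ (j + 2) * G1 (1 + L - L/2)) * G (1 + L - L/2)"
  proof (rule picone_comparison[where H = "\<lambda>r. h r ^ (j + 2)" and ?H2.0 = "\<lambda>r. h r ^ j" and m = m
        and P = "\<lambda>r. (1 + L - r) ^ (j + 2)" and ?P2.0 = "\<lambda>r. (1 + L - r) ^ j" and c = "\<lambda>r. G (1 + L - r)"
        and ?c1.0 = "\<lambda>r. - G1 (1 + L - r)" and w = "\<lambda>r. - ((1 + L - r) ^ (j + 2) * G1 (1 + L - r))"])
    fix r assume r: "r \<in> {L/2..L}"
    have r1: "1 + L - r > 0" using r by simp
    show "((\<lambda>r. G (1 + L - r)) has_real_derivative - G1 (1 + L - r)) (at r)"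
      by (rule DERIV_reflect[OF dG[OF r1]])
    show "((\<lambda>r. - ((1 + L - r) ^ (j + 2) * G1 (1 + L - r))) has_real_derivative m * (1 + L - r) ^ j * G (1 + L - r)) (at r)"
      using DERIV_minus[OF DERIV_reflect[OF dG1[OF r1]]] by simp
    show "h r ^ (j + 2) \<le> (1 + L - r) ^ (j + 2)" "h r ^ j \<le> (1 + L - r) ^ j"
      using h_le[OF half'[OF r]] hp[OF half'[OF r]] by (intro power_mono; simp)+
  qed (use L_pos m dy' dz' half' y_pos hp in auto)
  moreover have "1 + L / 2 = M" "1 + L - L / 2 = M" by (simp_all add: M_def)
  moreover have "z L * x / y L = \<sigma> * x" for x using yL y_pos[of L] L_pos by simp
  \<comment> \<open>The two inequalities are chained through the common term z G^2 / y at L/2; only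
    terms at the ends remain.\<close>
  ultimately have "\<sigma> * (G 1)\<^sup>2 + G1 1 * G 1 \<le> - \<sigma> * (G 1)\<^sup>2 - G1 1 * G 1"
    using G1M y0 by simp
  moreover have "G 1 * (\<sigma> * G 1 + G1 1) = \<sigma> * (G 1)\<^sup>2 + G1 1 * G 1"
    by (simp add: algebra_simps power2_eq_square)
  ultimately have GG: "G 1 * (\<sigma> * G 1 + G1 1) \<le> 0" by linarith
  have \<kappa>: "\<kappa> > 0" using m M by (simp add: \<kappa>_def)
  then have G: "G 1 = \<kappa> + 1" "G 1 > 0" "G1 1 = \<kappa> - m" by (simp_all add: G_def G1_def)
  have "\<sigma> * G 1 + G1 1 \<le> 0" using G(2) GG by (simp add: mult_le_0_iff)
  \<comment> \<open>The right-hand side is - G1 1 / G 1, the eigenvalue of the tent for this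
    mode.\<close>
  then have "\<sigma> \<le> (m - \<kappa>) / (\<kappa> + 1)" using G \<kappa> by (simp add: pos_le_divide_eq)
  also have "\<dots> = m * (M ^ n - 1) / (M ^ n + m)"
    using M m by (simp add: \<kappa>_def divide_simps) (simp add: algebra_simps)
  also have "\<dots> = (real n - 1) * (M ^ n - 1) / (M ^ n + real n - 1)"
    by (simp add: m_eq n_def add_diff_eq)
  finally show ?thesis using le by simp
qed

end

section \<open>The critical length and the upper bound\<close>

definition radial_bound :: "nat \<Rightarrow> real \<Rightarrow> real" where
  "radial_bound n M = (real n - 2) * M ^ (n - 2) / (M ^ (n - 2) - 1)"

definition first_mode_bound :: "nat \<Rightarrow> real \<Rightarrow> real" where
  "first_mode_bound n M = (real n - 1) * (M ^ n - 1) / (M ^ n + real n - 1)"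

lemma radial_bound_strict_antimono:
  assumes "n \<ge> 3" "1 < M" "M < M'"
  shows "radial_bound n M' < radial_bound n M"
proof -
  have "1 < M ^ (n - 2)" using assms by (intro one_less_power) auto
  moreover have "M ^ (n - 2) < M' ^ (n - 2)" using assms by (intro power_strict_mono) auto
  moreover have "real n - 2 > 0" using assms by simp
  ultimately show ?thesis by (simp add: radial_bound_def divide_simps) (simp add: algebra_simps)
qed

lemma first_mode_bound_strict_mono:
  assumes "n \<ge> 3" "1 < M" "M < M'"
  shows "first_mode_bound n M < first_mode_bound n M'"
proof -
  have "1 < M ^ n" using assms by (intro one_less_power) auto
  moreover have less: "M ^ n < M' ^ n" using assms by (intro power_strict_mono) auto
  moreover have n: "real n - 1 > 0" using assms by simp
  ultimately have "(M ^ n - 1) / (M ^ n + (real n - 1)) < (M' ^ n - 1) / (M' ^ n + (real n - 1))"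
    by (simp add: divide_simps) (simp add: algebra_simps)
  from mult_strict_left_mono[OF this n] show ?thesis by (simp add: first_mode_bound_def add_diff_eq)
qed

text \<open>Clearing the denominators of the two tent values gives the polynomial. With u = M^(n -
  2) all its powers are monomials in u and M^2.\<close>

lemma critical_equation_iff:
  assumes n: "n \<ge> 3" and L: "L > 0"
  shows "critical_equation n L \<longleftrightarrow> radial_bound n (1 + L/2) = first_mode_bound n (1 + L/2)"
proof -
  obtain j where j: "n = j + 3" using n by (metis add.commute le_iff_add)
  define M where "M = 1 + L/2"
  have M: "M > 1" using L by (simp add: M_def)
  define u where "u = M ^ (j + 1)"
  have u: "u > 1" unfolding u_def using M by (intro one_less_power) auto
  have pw: "M ^ n = u * M\<^sup>2" "M ^ (n - 2) = u" "M ^ (2 * n - 2) = u * (u * M\<^sup>2)"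
    by (simp_all add: u_def j power_add[symmetric]) (simp_all add: power_add power2_eq_square power_mult eval_nat_numeral)
  have "u * M\<^sup>2 > 0" using u M by simp
  then have "u * M\<^sup>2 + real n - 1 > 0" using n by simp
  then have "radial_bound n M = first_mode_bound n M \<longleftrightarrow>
      (real n - 2) * u * (u * M\<^sup>2 + real n - 1) = (real n - 1) * (u * M\<^sup>2 - 1) * (u - 1)"
    using u by (simp add: radial_bound_def first_mode_bound_def pw frac_eq_eq)
  also have "\<dots> \<longleftrightarrow> critical_equation n L"
    unfolding critical_equation_def M_def[symmetric] pw
    by (auto simp: algebra_simps power2_eq_square)
  finally show ?thesis unfolding M_def by blast
qed

text \<open>Existence by the intermediate value theorem; uniqueness because one side of
  \<open>critical_equation_iff\<close> decreases and the other increases.\<close>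

lemma critical_equation_ex1:
  assumes n: "n \<ge> 3"
  shows "\<exists>!L. L > 0 \<and> critical_equation n L"
proof -
  define E where "E L = (1 + L/2) ^ (2*n - 2) - (real n - 1) * (1 + L/2) ^ n
       - (real n - 1)\<^sup>2 * (1 + L/2) ^ (n - 2) + real n - 1" for L
  \<comment> \<open>Here 1 + L'/2 = n, so the leading power n^(2n - 2) is at least n^(n + 1), which
    dominates the two negative terms.\<close>
  define L' where "L' = 2 * (real n - 1)"
  have L': "1 + L'/2 = real n" "0 \<le> L'" using n by (simp_all add: L'_def field_simps)
  have "E 0 = 1 - (real n - 1)\<^sup>2" by (simp add: E_def power2_eq_square)
  moreover have "(real n - 1)\<^sup>2 > 1" using n by (intro one_less_power) auto
  ultimately have E0: "E 0 < 0" by simp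
  have EL': "E L' > 0"
  proof -
    obtain j where j: "n = j + 3" using n by (metis add.commute le_iff_add)
    have "(real n - 1)\<^sup>2 * real n ^ (n - 2) \<le> (real n)\<^sup>2 * real n ^ (n - 2)"
      using n by (intro mult_right_mono power_mono) auto
    also have "\<dots> = real n ^ (2 + (n - 2))" by (rule power_add[symmetric])
    also have "2 + (n - 2) = n" using n by simp
    finally have "(real n - 1) * real n ^ n + (real n - 1)\<^sup>2 * real n ^ (n - 2) \<le> real n ^ (n + 1)"
      by (simp add: algebra_simps)
    also have "\<dots> \<le> real n ^ (2 * n - 2)" using n by (intro power_increasing) auto
    finally show ?thesis unfolding E_def L'(1) using n by simp
  qed
  have "continuous_on {0..L'} E" unfolding E_def by (intro continuous_intros) auto
  then obtain L where L: "0 \<le> L" "E L = 0" using IVT'[of E 0 0 L'] E0 EL' L' by auto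
  then have "L > 0" "critical_equation n L" using E0 by (cases "L = 0"; simp add: E_def critical_equation_def)+
  moreover have "L1 = L2" if "L1 > 0" "critical_equation n L1" "L2 > 0" "critical_equation n L2" for L1 L2
  proof -
    have "\<not> x < y" if "x > 0" "critical_equation n x" "y > 0" "critical_equation n y" for x y
    proof
      assume "x < y"
      then have "radial_bound n (1 + y/2) < radial_bound n (1 + x/2)"
        "first_mode_bound n (1 + x/2) < first_mode_bound n (1 + y/2)"
        using that n by (auto intro: radial_bound_strict_antimono first_mode_bound_strict_mono)
      then show False using that critical_equation_iff[OF n] by force
    qed
    then show ?thesis using that by (metis linorder_neqE_linordered_idom)
  qed
  ultimately show ?thesis by blast
qed

lemma critical_length:
  assumes n: "n \<ge> 3"
  shows "critical_length n > 0" "radial_bound n (1 + critical_length n / 2) = steklov_bound n"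
    "first_mode_bound n (1 + critical_length n / 2) = steklov_bound n"
proof -
  have *: "critical_length n > 0 \<and> critical_equation n (critical_length n)"
    unfolding critical_length_def by (rule theI'[OF critical_equation_ex1[OF n]])
  then show "critical_length n > 0" by simp
  show "radial_bound n (1 + critical_length n / 2) = steklov_bound n"
    by (simp add: radial_bound_def steklov_bound_def)
  then show "first_mode_bound n (1 + critical_length n / 2) = steklov_bound n"
    using * critical_equation_iff[OF n] by metis
qed

text \<open>An antiderivative of \<open>(1 + r)\<^sup>1\<^sup>-\<^sup>n\<close>, the integrand of the width of the tent
  \<open>1 + min r (L - r)\<close>.\<close>

definition tent_width :: "nat \<Rightarrow> real \<Rightarrow> real" where
  "tent_width n r = - (inverse ((1 + r) ^ (n - 2)) / (real n - 2))"

lemma tent_width_deriv: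
  assumes "n \<ge> 3" "r \<ge> 0"
  shows "(tent_width n has_real_derivative inverse ((1 + r) ^ (n - 1))) (at r)"
proof -
  have "((\<lambda>r. 1 + r) has_real_derivative 1) (at r)" by (auto intro!: derivative_eq_intros)
  from DERIV_inverse_power[OF this, of "n - 2"]
  have "((\<lambda>r. inverse ((1 + r) ^ (n - 2))) has_real_derivative
      - (real (n - 2) * 1 / (1 + r) * inverse ((1 + r) ^ (n - 2)))) (at r)" using assms by simp
  from DERIV_minus[OF DERIV_cdivide[OF this, of "real n - 2"]]
  have "(tent_width n has_real_derivative
      - (- (real (n - 2) * 1 / (1 + r) * inverse ((1 + r) ^ (n - 2))) / (real n - 2))) (at r)"
    unfolding tent_width_def .
  moreover have "inverse ((1 + r) ^ (n - 1)) = inverse (1 + r) * inverse ((1 + r) ^ (n - 2))"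
  proof -
    have "n - 1 = Suc (n - 2)" using assms(1) by simp
    then show ?thesis by simp
  qed
  then have "- (- (real (n - 2) * 1 / (1 + r) * inverse ((1 + r) ^ (n - 2))) / (real n - 2))
      = inverse ((1 + r) ^ (n - 1))"
    using assms by (simp add: divide_inverse)
  ultimately show ?thesis by simp
qed

lemma radial_bound_tent_width:
  assumes "n \<ge> 3" "L > 0"
  shows "1 / (tent_width n (L/2) - tent_width n 0) = radial_bound n (1 + L/2)"
proof -
  define v where "v = (1 + L/2) ^ (n - 2)"
  have "v > 1" using assms unfolding v_def by (intro one_less_power) auto
  moreover have te: "tent_width n (L/2) - tent_width n 0 = (1 - inverse v) / (real n - 2)"
    by (simp add: tent_width_def v_def diff_divide_distrib)
  ultimately show ?thesis
    using assms unfolding te radial_bound_def v_def[symmetric] by (simp add: field_simps)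
qed

lemma tent_width_pos:
  assumes "n \<ge> 3" "L > 0"
  shows "tent_width n 0 < tent_width n (L/2)"
proof (rule DERIV_pos_imp_increasing[of 0 "L/2"])
  fix r :: real assume "0 \<le> r" "r \<le> L/2"
  then show "\<exists>y. (tent_width n has_real_derivative y) (at r) \<and> 0 < y"
    using tent_width_deriv[OF assms(1), of r] by auto
qed (use assms in auto)

section \<open>Strictness and the upper bound\<close>

context unit_profile
begin

text \<open>If h reached the tip, L/2 would be a maximum of h and a minimum of 1 + r - h; its
  derivative there would be both 0 and 1.\<close>

lemma h_less_tip: "h (L/2) < 1 + L/2"
proof (rule ccontr)
  assume "\<not> ?thesis"
  moreover have mid: "L/2 \<in> {0..L}" using L_pos by auto
  ultimately have eq: "h (L/2) = 1 + L/2" using h_le[OF mid] by auto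
  have near: "r \<in> {0..L}" if "\<bar>L/2 - r\<bar> < L/2" for r using that by (auto simp: abs_if split: if_splits)
  have d: "(h has_real_derivative deriv h (L/2)) (at (L/2))" by (rule h_deriv[OF interval[OF mid]])
  have L2: "L/2 > 0" using L_pos by simp
  have "h r \<le> h (L/2)" if "\<bar>L/2 - r\<bar> < L/2" for r
    using h_le[OF near[OF that]] eq by linarith
  then have "deriv h (L/2) = 0" using DERIV_local_max[OF d L2] by blast
  moreover have "((\<lambda>r. 1 + r - h r) has_real_derivative 1 - deriv h (L/2)) (at (L/2))"
    using d by (auto intro!: derivative_eq_intros)
  then have "1 - deriv h (L/2) = 0"
    using h_le near eq by (intro DERIV_local_min[OF _ L2, of "\<lambda>r. 1 + r - h r"]) force+
  ultimately show False by simp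
qed

text \<open>The width gains weakly over the tent everywhere, as h lies below both sides. Strict
  inequality at the tip makes the gain strict just left of L/2.\<close>

lemma width_greater:
  defines "n \<equiv> CARD('n)"
  shows "2 * (tent_width n (L/2) - tent_width n 0) < width L - width 0"
proof -
  have n: "n \<ge> 3" using dim by (simp add: n_def)
  have dw: "(width has_real_derivative inverse (h r ^ (n - 1))) (at r)" if "r \<in> {0..L}" for r
    using width_deriv[OF interval[OF that]] by (simp add: n_def divide_inverse)
  have hp: "h r > 0" if "r \<in> {0..L}" for r using h_pos[OF interval[OF that]] .
  have inv: "inverse (x ^ (n - 1)) \<le> inverse (h r ^ (n - 1))" if "r \<in> {0..L}" "h r \<le> x" for r x
    using that hp[OF that(1)] by (intro le_imp_inverse_le power_mono) auto
  define G where "G r = width r - tent_width n r" for r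
  have dG: "(G has_real_derivative inverse (h r ^ (n - 1)) - inverse ((1 + r) ^ (n - 1))) (at r)"
    if "r \<in> {0..L}" for r
    unfolding G_def using that by (intro DERIV_diff dw tent_width_deriv n) auto
  have mid: "L/2 \<in> {0..L}" using L_pos by auto
  have "h (L/2) ^ (n - 1) < (1 + L/2) ^ (n - 1)"
    using h_less_tip hp[OF mid] n by (intro power_strict_mono) auto
  then have "0 < inverse (h (L/2) ^ (n - 1)) - inverse ((1 + L/2) ^ (n - 1))"
    using hp[OF mid] by (simp add: less_imp_inverse_less)
  from DERIV_pos_inc_left[OF dG[OF mid] this]
  obtain d where d: "d > 0" "\<And>s. 0 < s \<Longrightarrow> s < d \<Longrightarrow> G (L/2 - s) < G (L/2)" by blast
  define s where "s = min (d/2) (L/2)"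
  have s: "0 < s" "s < d" "s \<le> L/2" using d(1) L_pos by (auto simp: s_def)
  have "G 0 \<le> G (L/2 - s)"
  proof (rule deriv_nonneg_mono[OF _ dG])
    show "r \<in> {0..L}" if "r \<in> {0..L/2 - s}" for r using that s L_pos by auto
    then show "0 \<le> inverse (h r ^ (n - 1)) - inverse ((1 + r) ^ (n - 1))" if "r \<in> {0..L/2 - s}" for r
      using inv[OF _ h_le(1)] that by simp
  qed (use s in auto)
  also have "\<dots> < G (L/2)" by (rule d(2)[OF s(1,2)])
  finally have 1: "tent_width n (L/2) - tent_width n 0 < width (L/2) - width 0" by (simp add: G_def)
  have "width (L/2) - (- tent_width n (L - L/2)) \<le> width L - (- tent_width n (L - L))"
  proof (rule deriv_nonneg_mono[where f = "\<lambda>r. width r - (- tent_width n (L - r))"])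
    fix r assume r: "r \<in> {L/2..L}"
    then have r': "r \<in> {0..L}" using L_pos by auto
    show "((\<lambda>r. width r - (- tent_width n (L - r))) has_real_derivative
        inverse (h r ^ (n - 1)) - (- (- inverse ((1 + (L - r)) ^ (n - 1))))) (at r)"
      using r by (intro DERIV_diff DERIV_minus DERIV_reflect dw[OF r'] tent_width_deriv n) auto
    show "0 \<le> inverse (h r ^ (n - 1)) - (- (- inverse ((1 + (L - r)) ^ (n - 1))))"
      using inv[OF r' h_le(2)[OF r']] by (simp add: add_diff_eq)
  qed (use L_pos in auto)
  then show ?thesis using 1 by simp
qed

text \<open>Below the critical length the first mode decides, strictly by monotonicity in L. From
  there on the radial mode decides; at the critical length itself strictness comes from
  \<open>width_greater\<close>.\<close>

lemma steklov_eigenvalue_less: "steklov_eigenvalue L g 1 < steklov_bound (CARD('n))"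
proof -
  let ?n = "CARD('n)"
  let ?L = "critical_length ?n"
  have n: "?n \<ge> 3" by (rule dim)
  show ?thesis
  proof (cases "L < ?L")
    case True
    have "steklov_eigenvalue L g 1 \<le> first_mode_bound ?n (1 + L/2)"
      using steklov_eigenvalue_le_first_mode by (simp add: first_mode_bound_def)
    also have "\<dots> < first_mode_bound ?n (1 + ?L/2)"
      using True L_pos n by (intro first_mode_bound_strict_mono) auto
    finally show ?thesis using critical_length[OF n] by simp
  next
    case False
    define t where "t = tent_width ?n (L/2) - tent_width ?n 0"
    have t: "t > 0" using tent_width_pos[OF n L_pos] by (simp add: t_def)
    have "steklov_eigenvalue L g 1 \<le> 2 / (width L - width 0)" by (rule steklov_eigenvalue_le_radial)
    also have "\<dots> < 2 / (2 * t)"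
      using width_greater t by (intro divide_strict_left_mono) (auto simp: t_def)
    also have "\<dots> = radial_bound ?n (1 + L/2)"
      using radial_bound_tent_width[OF n L_pos] unfolding t_def[symmetric] by simp
    also have "\<dots> \<le> radial_bound ?n (1 + ?L/2)"
      using False critical_length(1)[OF n] radial_bound_strict_antimono[OF n, of "1 + ?L/2" "1 + L/2"]
      by (cases "L = ?L") auto
    finally show ?thesis using critical_length[OF n] by simp
  qed
qed

end

text \<open>h is given on [0, L] only. Its smooth extension \<open>F\<close> is positive near [0, L]
  by continuity, hence on some [-e, L + e]. The slope bound passes to \<open>deriv F\<close> even at
  the ends, where a one-sided derivative determines it.\<close>

lemma hypersurface_unit_profile:
  fixes g :: "'n::finite metric"
  assumes n: "CARD('n) \<ge> 3" and g: "hypersurface_of_revolution L g"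
  obtains a b h where "unit_profile L a b (real CARD('n) - 1) h g"
proof -
  obtain h where L: "L > 0" and h: "smooth_on {0..L} h" "\<And>r. r \<in> {0..L} \<Longrightarrow> h r > 0"
    "\<And>r. r \<in> {0..L} \<Longrightarrow> \<exists>d. (h has_real_derivative d) (at r within {0..L}) \<and> \<bar>d\<bar> \<le> 1"
    "h 0 = 1" "h L = 1"
    and metric: "revolution L h g"
    using g unfolding hypersurface_of_revolution_def revolution_def by blast
  obtain U F where U: "open U" "{0..L} \<subseteq> U" "\<And>k. Ck_on k U F" and Fh: "\<And>r. r \<in> {0..L} \<Longrightarrow> F r = h r"
    using h(1) unfolding smooth_on_def by blast
  have Fc: "continuous_on U F" using U(3)[of 0] by simp
  define V where "V = U \<inter> F -` {0<..}"
  have "open V" unfolding V_def by (rule continuous_open_preimage[OF Fc U(1) open_greaterThan])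
  moreover have V0: "{0..L} \<subseteq> V" using U(2) Fh h(2) by (auto simp: V_def)
  ultimately have "0 \<in> V" "L \<in> V" using L by auto
  then obtain e where e: "e > 0" "cball 0 e \<subseteq> V" "cball L e \<subseteq> V"
  proof -
    obtain e1 where e1: "e1 > 0" "cball 0 e1 \<subseteq> V"
      using open_contains_cball[THEN iffD1, rule_format, OF \<open>open V\<close> \<open>0 \<in> V\<close>] by blast
    obtain e2 where e2: "e2 > 0" "cball L e2 \<subseteq> V"
      using open_contains_cball[THEN iffD1, rule_format, OF \<open>open V\<close> \<open>L \<in> V\<close>] by blast
    show thesis
    proof (rule that[of "min e1 e2"])
      show "cball 0 (min e1 e2) \<subseteq> V" by (rule order_trans[OF subset_cball e1(2)]) simp
      show "cball L (min e1 e2) \<subseteq> V" by (rule order_trans[OF subset_cball e2(2)]) simp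
    qed (use e1 e2 in simp)
  qed
  have sub: "{-e..L+e} \<subseteq> V"
  proof
    fix r assume r: "r \<in> {-e..L+e}"
    consider "r < 0" | "r \<in> {0..L}" | "r > L" by fastforce
    then show "r \<in> V"
      using r subsetD[OF V0, of r] subsetD[OF e(2), of r] subsetD[OF e(3), of r] by cases (auto simp: dist_real_def)
  qed
  have subU: "{-e..L+e} \<subseteq> U" using sub by (auto simp: V_def)
  have I: "{-e<..<L+e} \<subseteq> U" using subU by (auto simp: subset_iff)
  have sm: "Ck_on k {-e<..<L+e} F" for k by (rule Ck_on_subset[OF U(3) I])
  show thesis
  proof (rule that[of "-e" "L+e" F], unfold_locales)
    show "continuous_on {-e..L+e} F" by (rule continuous_on_subset[OF Fc subU])
    show "F r > 0" if "r \<in> {-e..L+e}" for r using sub that by (auto simp: V_def)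
    then show "F r > 0" if "r \<in> {-e<..<L+e}" for r using that by auto
    show "revolution L F g"
      using metric Fh unfolding revolution_def by (auto simp: cylinder_def)
    show "F 0 = 1" "F L = 1" using Fh h(4,5) L by auto
    show "\<bar>deriv F r\<bar> \<le> 1" if r: "r \<in> {0..L}" for r
    proof -
      obtain d where d: "(h has_real_derivative d) (at r within {0..L})" "\<bar>d\<bar> \<le> 1" using h(3)[OF r] by blast
      have "(F has_real_derivative d) (at r within {0..L})"
        using d(1) r unfolding has_field_derivative_def
        by (rule has_derivative_transform[rotated 2]) (simp_all add: Fh)
      moreover have "r \<in> {-e<..<L+e}" using r e by auto
      then have "(F has_real_derivative deriv F r) (at r within {0..L})"
        by (rule has_field_derivative_at_within[OF Ck_on_real_deriv(2)[OF sm[of "Suc 0"] open_greaterThanLessThan]])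
      ultimately have "d = deriv F r"
        using vector_derivative_unique_within_closed_interval[of 0 L r F d "deriv F r"] L r
        by (simp add: has_real_derivative_iff_has_vector_derivative)
      then show ?thesis using d by simp
    qed
  qed (use L e n sm in auto)
qed

section \<open>Sharpness\<close>

text \<open>A smoothing of |r - L/2|, off by at most \<eta>.\<close>

definition bump :: "real \<Rightarrow> real \<Rightarrow> real \<Rightarrow> real" where
  "bump L \<eta> r = sqrt ((r - L/2)\<^sup>2 + \<eta>\<^sup>2)"

text \<open>Normalised by the value of \<open>bump\<close> at 0, so that both end values are exactly
  1.\<close>

definition smoothed_tent :: "real \<Rightarrow> real \<Rightarrow> real \<Rightarrow> real" where
  "smoothed_tent L \<eta> r = 1 + bump L \<eta> 0 - bump L \<eta> r"

definition revolution_metric :: "(real \<Rightarrow> real) \<Rightarrow> 'n::finite metric" where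
  "revolution_metric h = (\<lambda>(r, p) (s, v) (t, w). s * t + (h r)\<^sup>2 * (v \<bullet> w))"

lemma revolution_metric: "revolution L h (revolution_metric h)"
  by (auto simp: revolution_def revolution_metric_def)

section \<open>Calculus of the smoothed tent\<close>

context
  fixes L \<eta> :: real
  assumes L: "L > 0" and \<eta>: "0 < \<eta>"
begin

lemma bump_pos: "bump L \<eta> r > 0"
  using \<eta> by (simp add: bump_def add_nonneg_pos)

lemma bump_ge: "\<bar>r - L/2\<bar> \<le> bump L \<eta> r"
  unfolding bump_def by (rule real_le_rsqrt) simp

lemma bump_le: "bump L \<eta> r \<le> \<bar>r - L/2\<bar> + \<eta>"
  unfolding bump_def using \<eta> by (intro real_le_lsqrt) (auto simp: power2_sum)

lemma bump_deriv: "(bump L \<eta> has_real_derivative (r - L/2) * inverse (bump L \<eta> r)) (at r)"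
proof -
  have "(r - L/2)\<^sup>2 + \<eta>\<^sup>2 > 0" using \<eta> by (simp add: add_nonneg_pos)
  then have d: "((\<lambda>r. sqrt ((r - L/2)\<^sup>2 + \<eta>\<^sup>2)) has_real_derivative
      2 * (r - L/2) * (inverse (sqrt ((r - L/2)\<^sup>2 + \<eta>\<^sup>2)) / 2)) (at r)"
    by (auto intro!: derivative_eq_intros)
  have eq: "2 * x * (y / 2) = x * y" for x y :: real by simp
  show ?thesis unfolding bump_def[abs_def] by (rule DERIV_cong[OF d eq])
qed

lemma inverse_bump_deriv:
  "((\<lambda>r. inverse (bump L \<eta> r)) has_real_derivative - (r - L/2) * inverse (bump L \<eta> r) ^ 3) (at r)"
proof (rule DERIV_cong)
  show "((\<lambda>r. inverse (bump L \<eta> r)) has_real_derivative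
      - (inverse (bump L \<eta> r) * ((r - L/2) * inverse (bump L \<eta> r)) * inverse (bump L \<eta> r))) (at r)"
    using bump_pos[of r] by (intro DERIV_inverse' bump_deriv) simp
  show "- (b * (x * b) * b) = - x * b ^ 3" for b x :: real by (simp add: power3_eq_cube)
qed

lemma centre_smooth: "Ck_on k UNIV (\<lambda>r. r - L/2)"
  by (intro Ck_on_diff Ck_on_const Ck_on_linear bounded_linear_ident open_UNIV)

text \<open>The derivative is a polynomial in r and in the function itself, so smoothness
  bootstraps.\<close>

lemma inverse_bump_smooth: "Ck_on k UNIV (\<lambda>r. inverse (bump L \<eta> r))"
proof (induction k)
  case 0
  show ?case
    using continuous_on_DERIV[OF inverse_bump_deriv] by simp
next
  case (Suc k)
  show ?case
    by (intro Ck_on_Suc_real[OF open_UNIV inverse_bump_deriv] Ck_on_mult Ck_on_power[OF _ Suc] Ck_on_uminus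
        centre_smooth open_UNIV)
qed

lemma smoothed_tent_smooth: "Ck_on k UNIV (smoothed_tent L \<eta>)"
proof -
  have "Ck_on (Suc k) UNIV (bump L \<eta>)"
    by (intro Ck_on_Suc_real[OF open_UNIV bump_deriv] Ck_on_mult centre_smooth inverse_bump_smooth open_UNIV)
  then have "Ck_on k UNIV (bump L \<eta>)" by (rule Ck_on_SucD)
  then show ?thesis
    unfolding smoothed_tent_def[abs_def] by (intro Ck_on_diff Ck_on_const open_UNIV)
qed

lemma smoothed_tent_deriv:
  "(smoothed_tent L \<eta> has_real_derivative - ((r - L/2) * inverse (bump L \<eta> r))) (at r)"
  unfolding smoothed_tent_def[abs_def] using bump_deriv by (auto intro!: derivative_eq_intros)

lemma deriv_smoothed_tent: "deriv (smoothed_tent L \<eta>) r = - ((r - L/2) * inverse (bump L \<eta> r))"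
  by (rule DERIV_imp_deriv[OF smoothed_tent_deriv])

text \<open>Shows that the smoothed tent is concave and that its second derivative is of order
  \<eta>^2 away from the tip; the supersolution uses both.\<close>

lemma smoothed_tent_second_deriv:
  "(deriv (smoothed_tent L \<eta>) has_real_derivative - (\<eta>\<^sup>2 * inverse (bump L \<eta> r) ^ 3)) (at r)"
proof -
  have "(bump L \<eta> r)\<^sup>2 = (r - L/2)\<^sup>2 + \<eta>\<^sup>2" by (simp add: bump_def)
  then have "inverse (bump L \<eta> r) = ((r - L/2)\<^sup>2 + \<eta>\<^sup>2) * inverse (bump L \<eta> r) ^ 3"
    using bump_pos[of r] by (simp add: power3_eq_cube field_simps power2_eq_square)
  moreover have "- (1 * b + - x * c * x) = - (e * c)" if "b = (x\<^sup>2 + e) * c" for b c e x :: real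
    unfolding that by (simp add: algebra_simps power2_eq_square)
  ultimately have eq: "- (1 * inverse (bump L \<eta> r) + - (r - L/2) * inverse (bump L \<eta> r) ^ 3 * (r - L/2))
      = - (\<eta>\<^sup>2 * inverse (bump L \<eta> r) ^ 3)"
    by blast
  have "((\<lambda>r. - ((r - L/2) * inverse (bump L \<eta> r))) has_real_derivative
      - (1 * inverse (bump L \<eta> r) + - (r - L/2) * inverse (bump L \<eta> r) ^ 3 * (r - L/2))) (at r)"
    by (intro DERIV_minus DERIV_mult inverse_bump_deriv) (auto intro!: derivative_eq_intros)
  then show ?thesis unfolding eq by (simp add: deriv_smoothed_tent[abs_def])
qed

lemma smoothed_tent_slope: "\<bar>deriv (smoothed_tent L \<eta>) r\<bar> \<le> 1"
proof -
  have "\<bar>deriv (smoothed_tent L \<eta>) r\<bar> = \<bar>r - L/2\<bar> / bump L \<eta> r"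
    unfolding deriv_smoothed_tent divide_inverse[of _ "bump L \<eta> r"] using bump_pos[of r]
    by (simp add: abs_mult)
  also have "\<dots> \<le> 1" using bump_ge[of r] bump_pos[of r] by simp
  finally show ?thesis .
qed

lemma bump_symmetric: "bump L \<eta> (L - r) = bump L \<eta> r"
  by (simp add: bump_def power2_commute[of r "L/2"] algebra_simps)

lemma smoothed_tent_ends: "smoothed_tent L \<eta> 0 = 1" "smoothed_tent L \<eta> L = 1"
  using bump_symmetric[of 0] by (simp_all add: smoothed_tent_def)

text \<open>With end values 1 and slope at most 1, the function stays positive within distance 1/2
  of the ends; this supplies the interval for \<open>unit_profile\<close>.\<close>

lemma smoothed_tent_pos: assumes "r \<in> {- 1/2..L + 1/2}" shows "smoothed_tent L \<eta> r > 0"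
proof -
  have "bump L \<eta> r \<le> bump L \<eta> 0 + 1/2"
    unfolding bump_def[of L \<eta> r]
  proof (rule real_le_lsqrt)
    have "(r - L/2)\<^sup>2 \<le> (L/2 + 1/2)\<^sup>2"
      using assms by (intro abs_le_square_iff[THEN iffD1]) (auto simp: abs_le_iff)
    moreover have "(bump L \<eta> 0)\<^sup>2 = (L/2)\<^sup>2 + \<eta>\<^sup>2" by (simp add: bump_def)
    moreover have "L/2 \<le> bump L \<eta> 0" using bump_ge[of 0] by simp
    ultimately show "(r - L/2)\<^sup>2 + \<eta>\<^sup>2 \<le> (bump L \<eta> 0 + 1/2)\<^sup>2"
      by (simp add: power2_sum)
  qed (use bump_pos[of 0] in simp)
  then show ?thesis by (simp add: smoothed_tent_def)
qed

lemma smoothed_tent_unit_profile: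
  assumes "CARD('n::finite) \<ge> 3"
  shows "unit_profile L (- 1/2) (L + 1/2) (real CARD('n) - 1) (smoothed_tent L \<eta>)
    (revolution_metric (smoothed_tent L \<eta>) :: 'n metric)"
proof unfold_locales
  show "Ck_on k {- 1/2<..<L + 1/2} (smoothed_tent L \<eta>)" for k
    by (rule Ck_on_subset[OF smoothed_tent_smooth]) simp
  show "continuous_on {- 1/2..L + 1/2} (smoothed_tent L \<eta>)"
    using smoothed_tent_smooth[of 0] continuous_on_subset by auto
qed (use L assms smoothed_tent_pos smoothed_tent_ends smoothed_tent_slope revolution_metric in auto)

lemma smoothed_tent_hypersurface:
  "hypersurface_of_revolution L (revolution_metric (smoothed_tent L \<eta>) :: 'n::finite metric)"
  unfolding hypersurface_of_revolution_def
proof (intro conjI exI[of _ "smoothed_tent L \<eta>"] L smoothed_tent_ends)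
  show "smooth_on {0..L} (smoothed_tent L \<eta>)"
    unfolding smooth_on_def
    by (intro exI[of _ UNIV] exI[of _ "smoothed_tent L \<eta>"]) (auto simp: smoothed_tent_smooth)
  show "\<forall>r\<in>{0..L}. smoothed_tent L \<eta> r > 0" using smoothed_tent_pos by auto
  show "\<forall>r\<in>{0..L}. \<exists>d. (smoothed_tent L \<eta> has_real_derivative d) (at r within {0..L}) \<and> \<bar>d\<bar> \<le> 1"
    using smoothed_tent_slope has_field_derivative_at_within[OF smoothed_tent_deriv]
    by (metis deriv_smoothed_tent)
  show "\<forall>(r, p)\<in>cylinder L. \<forall>(s, v)\<in>tangent (r, p). \<forall>(t, w)\<in>tangent (r, p).
      revolution_metric (smoothed_tent L \<eta>) (r, p) (s, v) (t, w)
        = s * t + (smoothed_tent L \<eta> r)\<^sup>2 * (v \<bullet> (w::real^'n))"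
    using revolution_metric[of L "smoothed_tent L \<eta>"] unfolding revolution_def .
qed

text \<open>Since the tent is at least 1, the additive error \<eta> is absorbed by the factor 1 -
  \<eta>, which passes through the integrand of the width.\<close>

lemma smoothed_tent_ge:
  assumes "\<eta> < 1" "r \<in> {0..L}"
  shows "r \<le> L/2 \<Longrightarrow> (1 - \<eta>) * (1 + r) \<le> smoothed_tent L \<eta> r"
    and "L/2 \<le> r \<Longrightarrow> (1 - \<eta>) * (1 + (L - r)) \<le> smoothed_tent L \<eta> r"
proof -
  have *: "1 + L/2 - \<bar>r - L/2\<bar> - \<eta> \<le> smoothed_tent L \<eta> r"
    using bump_ge[of 0] bump_le[of r] by (simp add: smoothed_tent_def)
  have "0 \<le> \<eta> * r" "0 \<le> \<eta> * (L - r)" using \<eta> assms by auto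
  then show "r \<le> L/2 \<Longrightarrow> (1 - \<eta>) * (1 + r) \<le> smoothed_tent L \<eta> r"
    "L/2 \<le> r \<Longrightarrow> (1 - \<eta>) * (1 + (L - r)) \<le> smoothed_tent L \<eta> r"
    using * by (auto simp: algebra_simps abs_if split: if_splits)
qed

text \<open>By \<open>smoothed_tent_ge\<close> the width is at most (1 - \<eta>)^(1 - n) times that
  of the tent.\<close>

lemma smoothed_tent_radial:
  fixes n defines "n \<equiv> CARD('n::finite)"
  assumes n: "n \<ge> 3" and \<eta>1: "\<eta> < 1"
  defines "W \<equiv> unit_profile.width TYPE('n) (- 1/2) (smoothed_tent L \<eta>)"
  shows "(1 - \<eta>) ^ (n - 1) * radial_bound n (1 + L/2) \<le> 2 / (W L - W 0)"
proof -
  interpret unit_profile L "- 1/2" "L + 1/2" "real CARD('n) - 1" "smoothed_tent L \<eta>"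
    "revolution_metric (smoothed_tent L \<eta>) :: 'n metric"
    using n unfolding n_def by (rule smoothed_tent_unit_profile)
  let ?h = "smoothed_tent L \<eta>"
  define c where "c = inverse ((1 - \<eta>) ^ (n - 1))"
  have c: "c > 0" using \<eta>1 by (simp add: c_def)
  have dw: "(W has_real_derivative inverse (?h r ^ (n - 1))) (at r)" if "r \<in> {0..L}" for r
    using width_deriv[OF interval[OF that]] by (simp add: n_def W_def inverse_eq_divide)
  have inv: "inverse (?h r ^ (n - 1)) \<le> c * inverse (x ^ (n - 1))"
    if "(1 - \<eta>) * x \<le> ?h r" "x > 0" for r x
  proof -
    have "inverse (?h r ^ (n - 1)) \<le> inverse (((1 - \<eta>) * x) ^ (n - 1))"
      using that \<eta>1 by (intro le_imp_inverse_le power_mono) auto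
    then show ?thesis by (simp add: c_def power_mult_distrib)
  qed
  have mid: "0 \<le> L/2" "L/2 \<le> L" using L by auto
  have "c * tent_width n 0 - W 0 \<le> c * tent_width n (L/2) - W (L/2)"
  proof (rule deriv_nonneg_mono[where f = "\<lambda>r. c * tent_width n r - W r"])
    fix r assume r: "r \<in> {0..L/2}"
    then have r': "r \<in> {0..L}" using L by auto
    show "((\<lambda>r. c * tent_width n r - W r) has_real_derivative
        c * inverse ((1 + r) ^ (n - 1)) - inverse (?h r ^ (n - 1))) (at r)"
      using r by (intro DERIV_diff DERIV_cmult dw[OF r'] tent_width_deriv n) auto
    show "0 \<le> c * inverse ((1 + r) ^ (n - 1)) - inverse (?h r ^ (n - 1))"
      using inv[OF smoothed_tent_ge(1)[OF \<eta>1 r']] r by simp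
  qed (use mid in auto)
  moreover have "c * - tent_width n (L - L/2) - W (L/2) \<le> c * - tent_width n (L - L) - W L"
  proof (rule deriv_nonneg_mono[where f = "\<lambda>r. c * - tent_width n (L - r) - W r"])
    fix r assume r: "r \<in> {L/2..L}"
    then have r': "r \<in> {0..L}" using L by auto
    show "((\<lambda>r. c * - tent_width n (L - r) - W r) has_real_derivative
        c * - (- inverse ((1 + (L - r)) ^ (n - 1))) - inverse (?h r ^ (n - 1))) (at r)"
      using r by (intro DERIV_diff DERIV_cmult DERIV_minus DERIV_reflect dw[OF r'] tent_width_deriv n) auto
    show "0 \<le> c * - (- inverse ((1 + (L - r)) ^ (n - 1))) - inverse (?h r ^ (n - 1))"
      using inv[OF smoothed_tent_ge(2)[OF \<eta>1 r']] r by simp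
  qed (use mid in auto)
  ultimately have "W L - W 0 \<le> 2 * c * (tent_width n (L/2) - tent_width n 0)" by (simp add: algebra_simps)
  moreover have "W 0 < W L" using width_strict_mono by (simp add: W_def)
  moreover define t where "t = tent_width n (L/2) - tent_width n 0"
  moreover have "t > 0" using tent_width_pos[OF n L] by (simp add: t_def)
  ultimately have "2 / (2 * c * t) \<le> 2 / (W L - W 0)"
    using c by (intro divide_left_mono) auto
  moreover have "2 / (2 * c * t) = (1 - \<eta>) ^ (n - 1) * (1 / t)" by (simp add: c_def inverse_eq_divide)
  ultimately show ?thesis using radial_bound_tent_width[OF n L] by (simp add: t_def)
qed

text \<open>The supersolution is \<open>G0 (h r) + \<theta>\<close>.  Where \<open>h\<close> has slope \<open>1\<close>, \<open>G0 (h r)\<close> is an exact solution; the constant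
  \<open>\<theta>\<close> absorbs the error caused by \<open>h''\<close> where \<open>h < \<mu>\<close>, and where \<open>h \<ge> \<mu>\<close> that error has the right sign
  because \<open>G0\<close> has its minimum at \<open>\<mu>\<close>.\<close>

lemma smoothed_tent_nonradial:
  fixes f :: "real \<times> (real^'n::finite) \<Rightarrow> real"
  defines "n \<equiv> CARD('n)" and "M \<equiv> 1 + L/2"
  assumes n: "n \<ge> 3" and \<mu>: "1 < \<mu>" "\<mu> < M" and \<theta>: "\<theta> > 0"
    and small: "2 * M\<^sup>2 * \<eta>\<^sup>2 \<le> (M - \<mu>) ^ 3 * \<theta>"
    and f: "steklov_eigenfunction L (revolution_metric (smoothed_tent L \<eta>)) \<sigma> f"
    and nonradial: "r0 \<in> {0..L}" "norm p = 1" "norm q = 1" "f (r0, p) > f (r0, q)"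
  defines "\<kappa> \<equiv> (real n - 1) / \<mu> ^ n"
  shows "(real n - 1 - \<kappa>) / (\<kappa> + 1 + \<theta>) * (L/2 / bump L \<eta> 0) \<le> \<sigma>"
proof -
  define m where "m = real n - 1"
  interpret unit_profile L "- 1/2" "L + 1/2" m "smoothed_tent L \<eta>"
    "revolution_metric (smoothed_tent L \<eta>) :: 'n metric"
    using n unfolding n_def m_def by (rule smoothed_tent_unit_profile)
  let ?h = "smoothed_tent L \<eta>"
  let ?h1 = "deriv (smoothed_tent L \<eta>)"
  have m: "m > 0" "real n = m + 1" using n by (simp_all add: m_def)
  have \<kappa>_eq: "\<kappa> = m / \<mu> ^ n" by (simp add: \<kappa>_def m_def)
  have \<mu>n: "\<mu> ^ n > 1" using \<mu> n by (intro one_less_power) auto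
  then have \<kappa>: "\<kappa> > 0" using m(1) by (simp add: \<kappa>_eq)
  have \<kappa>m: "\<kappa> \<le> m" using \<mu>n m(1) by (simp add: \<kappa>_eq pos_divide_le_eq)
  define G0 where "G0 x = \<kappa> * x + inverse (x ^ (n - 1))" for x
  define G1 where "G1 x = \<kappa> - m * inverse (x ^ n)" for x
  define h2 where "h2 r = - (\<eta>\<^sup>2 * inverse (bump L \<eta> r) ^ 3)" for r
  have h_ge: "?h r \<ge> 1" if "r \<in> {0..L}" for r
  proof -
    have "(r - L/2)\<^sup>2 \<le> (0 - L/2)\<^sup>2"
      using that by (intro abs_le_square_iff[THEN iffD1]) (auto simp: abs_if)
    then have "bump L \<eta> r \<le> bump L \<eta> 0" unfolding bump_def by simp
    then show ?thesis by (simp add: smoothed_tent_def)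
  qed
  have h_leM: "?h r \<le> M" if "r \<in> {0..L}" for r using h_le[OF that] by (auto simp: M_def)
  have dG0: "(G0 has_real_derivative G1 x) (at x)" if x: "x > 0" for x
  proof -
    have "(G0 has_real_derivative \<kappa> * 1 + - (real (n - 1) * 1 / x * inverse (x ^ (n - 1)))) (at x)"
      unfolding G0_def using x by (intro DERIV_add DERIV_cmult DERIV_ident DERIV_inverse_power) auto
    moreover have "x ^ n = x * x ^ (n - 1)" using n by (cases n) auto
    then have "\<kappa> * 1 + - (real (n - 1) * 1 / x * inverse (x ^ (n - 1))) = G1 x"
      using x n by (simp add: G1_def m_def divide_inverse)
    ultimately show ?thesis by simp
  qed
  have dG1: "(G1 has_real_derivative m * real n / x * inverse (x ^ n)) (at x)" if x: "x > 0" for x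
  proof -
    have "(G1 has_real_derivative 0 - m * - (real n * 1 / x * inverse (x ^ n))) (at x)"
      unfolding G1_def using x by (intro DERIV_diff DERIV_cmult DERIV_const DERIV_ident DERIV_inverse_power) auto
    then show ?thesis by (simp add: mult.assoc)
  qed
  have G_ode: "m * real n / x * inverse (x ^ n) + m / x * G1 x = m * G0 x / x\<^sup>2" if x: "x > 0" for x
  proof -
    have "x ^ n = x * x ^ (n - 1)" using n by (cases n) auto
    then show ?thesis using x by (simp add: G1_def G0_def m(2) field_simps power2_eq_square)
  qed
  \<comment> \<open>Adding \<theta> yields a surplus m \<theta>. As A is at most m M + 1 + \<theta>,
    the term \<delta> A takes at most half of it; the other half is left for h''.\<close>
  define \<delta> where "\<delta> = m * \<theta> / (2 * (m * M + 1 + \<theta>))"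
  have M: "M > 1" using \<mu> by simp
  have den: "m * M + 1 + \<theta> > 0" using m M \<theta> by (simp add: add_pos_pos)
  have \<delta>: "\<delta> > 0" "\<delta> * (m * M + 1 + \<theta>) = m * \<theta> / 2"
  proof -
    have "x / (2 * d) * d = x / 2" if "d > 0" for x d :: real using that by simp
    from this[OF den] show "\<delta> * (m * M + 1 + \<theta>) = m * \<theta> / 2" unfolding \<delta>_def .
    show "\<delta> > 0" using m(1) \<theta> den by (simp add: \<delta>_def)
  qed
  define A where "A r = G0 (?h r) + \<theta>" for r
  define A1 where "A1 r = G1 (?h r) * ?h1 r" for r
  define A2 where "A2 r = m * real n / ?h r * inverse (?h r ^ n) * ?h1 r * ?h1 r + h2 r * G1 (?h r)" for r
  have hp: "?h r > 0" if "r \<in> {0..L}" for r using h_ge[OF that] by simp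
  have dA: "(A has_real_derivative A1 r) (at r)" if "r \<in> {0..L}" for r
    unfolding A_def A1_def
    using DERIV_add[OF DERIV_chain2[where g = ?h, OF dG0[OF hp[OF that]] h_deriv[OF interval[OF that]]] DERIV_const[of \<theta>]]
    by simp
  have dA1: "(A1 has_real_derivative A2 r) (at r)" if r: "r \<in> {0<..<L}" for r
  proof -
    have r': "r \<in> {0..L}" using r by auto
    show ?thesis
      unfolding A1_def A2_def h2_def
      by (rule DERIV_mult[OF DERIV_chain2[where g = ?h, OF dG1[OF hp[OF r']] h_deriv[OF interval[OF r']]]
            smoothed_tent_second_deriv])
  qed
  show ?thesis
  proof (rule nonradial_eigenvalue_ge[OF f nonradial, where A = A and ?A1.0 = A1 and ?A2.0 = A2 and \<delta> = \<delta>])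
    \<comment> \<open>The slope of the smoothed tent at 0. It is slightly below 1 and enters the
      eigenvalue bound as a factor that tends to 1 with \<eta>.\<close>
    define X where "X = L/2 / bump L \<eta> 0"
    have ends: "?h1 0 = X" "?h1 L = - X"
      using bump_symmetric[of 0] bump_pos[of 0] by (simp_all add: X_def deriv_smoothed_tent field_simps)
    have one: "G1 1 = \<kappa> - m" "G0 1 = \<kappa> + 1" by (simp_all add: G1_def G0_def)
    have A_ends: "A 0 = \<kappa> + 1 + \<theta>" "A L = \<kappa> + 1 + \<theta>"
      by (simp_all add: A_def smoothed_tent_ends one)
    have "A1 0 = (\<kappa> - m) * X" "A1 L = (\<kappa> - m) * - X"
      by (simp_all only: A1_def smoothed_tent_ends ends one)
    then have A1_ends: "A1 0 = - ((m - \<kappa>) * X)" "A1 L = (m - \<kappa>) * X"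
      by (simp_all only: minus_mult_left minus_diff_eq mult_minus_right)
    have "\<kappa> + 1 + \<theta> \<noteq> 0" using \<kappa> \<theta> by simp
    then have "(real n - 1 - \<kappa>) / (\<kappa> + 1 + \<theta>) * X * (\<kappa> + 1 + \<theta>) = (m - \<kappa>) * X"
      by (simp add: m_def)
    then show "A1 0 \<le> - ((real n - 1 - \<kappa>) / (\<kappa> + 1 + \<theta>) * (L/2 / bump L \<eta> 0)) * A 0"
      "(real n - 1 - \<kappa>) / (\<kappa> + 1 + \<theta>) * (L/2 / bump L \<eta> 0) * A L \<le> A1 L"
      unfolding A_ends A1_ends X_def[symmetric] by (simp_all only: mult_minus_left order_refl)
    show "A r > 0" if "r \<in> {0..L}" for r
      using hp[OF that] \<kappa> \<theta> by (auto simp: A_def G0_def intro!: add_pos_pos mult_pos_pos)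
    fix r assume "r \<in> {0<..<L}"
    then have r: "r \<in> {0..L}" by auto
    let ?x = "?h r"
    have x: "?x \<ge> 1" "?x > 0" "?x \<le> M" using h_ge[OF r] h_leM[OF r] by auto
    have G0_pos: "G0 ?x > 0" using x \<kappa> by (auto simp: G0_def intro!: add_pos_pos mult_pos_pos)
    have "inverse (?x ^ (n - 1)) \<le> 1" using x by (simp add: inverse_le_1_iff)
    moreover have "\<kappa> * ?x \<le> m * M" using \<kappa> \<kappa>m x m by (intro mult_mono) auto
    ultimately have "G0 ?x + \<theta> \<le> m * M + 1 + \<theta>" by (simp add: G0_def)
    then have "\<delta> * (G0 ?x + \<theta>) \<le> \<delta> * (m * M + 1 + \<theta>)"
      using \<delta>(1) by (intro mult_left_mono) auto
    then have 1: "\<delta> * (G0 ?x + \<theta>) \<le> m * \<theta> / 2" unfolding \<delta>(2) .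
    have h2: "h2 r \<le> 0" using \<eta> bump_pos[of r] by (simp add: h2_def)
    have 2: "?x\<^sup>2 * (h2 r * G1 ?x) \<le> m * \<theta> / 2"
    proof (cases "?x \<ge> \<mu>")
      case True
      then have "\<mu> ^ n \<le> ?x ^ n" using \<mu> by (intro power_mono) auto
      then have "m / ?x ^ n \<le> m / \<mu> ^ n" using m \<mu>n by (intro divide_left_mono mult_pos_pos) auto
      then have "G1 ?x \<ge> 0" by (simp add: G1_def \<kappa>_eq divide_inverse)
      then have "?x\<^sup>2 * (h2 r * G1 ?x) \<le> 0" using h2 by (intro mult_nonneg_nonpos mult_nonpos_nonneg) auto
      also have "0 \<le> m * \<theta> / 2" using m \<theta> by simp
      finally show ?thesis .
    next
      case False
      have "inverse (?x ^ n) \<le> 1" using x by (simp add: inverse_le_1_iff)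
      then have "m * inverse (?x ^ n) \<le> m * 1" using m by (intro mult_left_mono) auto
      then have "- G1 ?x \<le> m" using \<kappa> by (simp add: G1_def)
      \<comment> \<open>Where h stays below \<mu>, r is far enough from the tip for the error to be
        of order \<eta>^2; \<open>small\<close> fits it into its half of the surplus.\<close>
      have b: "M - \<mu> \<le> bump L \<eta> r"
        using False bump_ge[of 0] by (simp add: smoothed_tent_def M_def)
      have "h2 r * G1 ?x = \<eta>\<^sup>2 * inverse (bump L \<eta> r) ^ 3 * - G1 ?x" by (simp add: h2_def)
      also have "\<dots> \<le> \<eta>\<^sup>2 * inverse (M - \<mu>) ^ 3 * m"
      proof -
        have "\<eta>\<^sup>2 * inverse (bump L \<eta> r) ^ 3 * - G1 ?x \<le> \<eta>\<^sup>2 * inverse (bump L \<eta> r) ^ 3 * m"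
          using \<open>- G1 ?x \<le> m\<close> bump_pos[of r] by (intro mult_left_mono) auto
        also have "\<dots> \<le> \<eta>\<^sup>2 * inverse (M - \<mu>) ^ 3 * m"
          using b \<mu> m bump_pos[of r] by (intro mult_right_mono mult_left_mono power_mono le_imp_inverse_le) auto
        finally show ?thesis .
      qed
      finally have "?x\<^sup>2 * (h2 r * G1 ?x) \<le> ?x\<^sup>2 * (\<eta>\<^sup>2 * inverse (M - \<mu>) ^ 3 * m)"
        by (intro mult_left_mono) auto
      also have "\<dots> \<le> M\<^sup>2 * (\<eta>\<^sup>2 * inverse (M - \<mu>) ^ 3 * m)"
        using x \<mu> m by (intro mult_right_mono power_mono) auto
      also have "\<dots> = (2 * M\<^sup>2 * \<eta>\<^sup>2) * (inverse (M - \<mu>) ^ 3 * m / 2)" by simp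
      also have "\<dots> \<le> ((M - \<mu>) ^ 3 * \<theta>) * (inverse (M - \<mu>) ^ 3 * m / 2)"
        using small \<mu> m by (intro mult_right_mono) auto
      also have "\<dots> = m * \<theta> / 2" using \<mu> by (simp add: power_inverse field_simps)
      finally show ?thesis .
    qed
    have "A2 r + m * ?h1 r / ?x * A1 r
        = (m * real n / ?x * inverse (?x ^ n) + m / ?x * G1 ?x) * (?h1 r)\<^sup>2 + h2 r * G1 ?x"
      by (simp add: A2_def A1_def algebra_simps power2_eq_square)
    also have "\<dots> = m * G0 ?x / ?x\<^sup>2 * (?h1 r)\<^sup>2 + h2 r * G1 ?x" by (simp only: G_ode[OF x(2)])
    \<comment> \<open>G0 is positive, so the squared slope may be replaced by its bound 1.\<close>
    also have "\<dots> \<le> m * G0 ?x / ?x\<^sup>2 * 1 + h2 r * G1 ?x"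
      using m G0_pos x smoothed_tent_slope[of r]
      by (intro add_right_mono mult_left_mono) (auto simp: abs_square_le_1)
    also have "\<dots> = (m * G0 ?x + ?x\<^sup>2 * (h2 r * G1 ?x)) / ?x\<^sup>2" using x by (simp add: field_simps)
    also have "\<dots> \<le> ((m - \<delta>) * A r) / ?x\<^sup>2"
      using 1 2 by (intro divide_right_mono) (auto simp: A_def algebra_simps)
    finally show "A2 r + m * ?h1 r / ?x * A1 r \<le> (m - \<delta>) * A r / ?x\<^sup>2" .
  qed (use dA dA1 \<delta> in auto)
qed

end

section \<open>Choice of the parameters\<close>

lemma isCont_greater:
  fixes F :: "real \<Rightarrow> real"
  assumes "isCont F x" "c < F x"
  obtains d where "d > 0" "\<And>y. \<bar>y - x\<bar> < d \<Longrightarrow> c < F y"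
proof -
  have "\<forall>\<^sub>F y in at x. c < F y"
    using assms order_tendstoD(1) unfolding isCont_def by blast
  then obtain d where d: "d > 0" "\<And>y. y \<noteq> x \<Longrightarrow> dist y x < d \<Longrightarrow> c < F y"
    unfolding eventually_at by blast
  show thesis
  proof (rule that[OF d(1)])
    show "c < F y" if "\<bar>y - x\<bar> < d" for y
      using d(2)[of y] that assms(2) by (cases "y = x") (auto simp: dist_real_def)
  qed
qed

text \<open>The parameters are chosen in the order \<mu>, \<theta>, \<eta>, each by continuity so
  that the bound for nonradial eigenfunctions stays above s (\<open>F1\<close>, \<open>F2\<close>,
  \<open>F3\<close>). In addition \<eta> keeps the radial eigenvalue above s (\<open>F4\<close>) and
  meets the smallness condition of the supersolution (\<open>F5\<close>).\<close>

lemma steklov_bound_sharp: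
  fixes n defines "n \<equiv> CARD('n::finite)"
  assumes n: "n \<ge> 3" and s: "s < steklov_bound n"
  shows "\<exists>L (g :: 'n metric). hypersurface_of_revolution L g \<and> s \<le> steklov_eigenvalue L g 1"
proof -
  define L where "L = critical_length n"
  define M where "M = 1 + L/2"
  define m where "m = real n - 1"
  have L: "L > 0" using critical_length(1)[OF n] by (simp add: L_def)
  have M: "M > 1" using L by (simp add: M_def)
  have B: "radial_bound n M = steklov_bound n" "first_mode_bound n M = steklov_bound n"
    using critical_length(2,3)[OF n] by (simp_all add: M_def L_def)
  have m: "m > 0" using n by (simp add: m_def)
  \<comment> \<open>The bound obtained from G0 with minimum at x, for end slope 1 and \<theta> = 0;
    at x = M it is the first-mode value of the tent.\<close>
  define F1 where "F1 x = (m - m / x ^ n) / (m / x ^ n + 1)" for x :: real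
  have F1M: "F1 M = steklov_bound n"
  proof -
    have "(m - m / u) / (m / u + 1) = m * (u - 1) / (u + m)" if "u > 0" for u
    proof -
      have "m - m / u = m * (u - 1) / u" "m / u + 1 = (u + m) / u"
        using that by (simp_all add: field_simps)
      then show ?thesis using that by simp
    qed
    from this[of "M ^ n"] have "F1 M = m * (M ^ n - 1) / (M ^ n + m)" using M by (simp add: F1_def)
    then show ?thesis using B(2) by (simp add: first_mode_bound_def m_def add_diff_eq)
  qed
  have pos: "m / x ^ n + 1 > 0" if "x > 0" for x using that m by (simp add: add_pos_pos)
  have "isCont F1 M"
    unfolding F1_def using M pos[of M] by (intro continuous_intros) auto
  then obtain d1 where d1: "d1 > 0" "\<And>x. \<bar>x - M\<bar> < d1 \<Longrightarrow> s < F1 x"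
    using isCont_greater s F1M by metis
  \<comment> \<open>The midpoint keeps \<mu> above 1, the second term keeps it within d1 of
    M.\<close>
  define \<mu> where "\<mu> = max ((1 + M) / 2) (M - d1 / 2)"
  have \<mu>: "1 < \<mu>" "\<mu> < M" and "M - d1 / 2 \<le> \<mu>"
    using M d1(1) by (auto simp: \<mu>_def less_max_iff_disj)
  then have \<mu>F: "s < F1 \<mu>" using d1(1) by (intro d1(2)) (simp add: abs_if)
  define \<kappa> where "\<kappa> = m / \<mu> ^ n"
  have \<kappa>: "\<kappa> > 0" using m \<mu> by (simp add: \<kappa>_def)
  define F2 where "F2 t = (m - \<kappa>) / (\<kappa> + 1 + t)" for t
  have "isCont F2 0" unfolding F2_def using \<kappa> by (intro continuous_intros) auto
  moreover have "s < F2 0" using \<mu>F by (simp add: F1_def F2_def \<kappa>_def)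
  ultimately obtain d2 where d2: "d2 > 0" "\<And>x. \<bar>x - 0\<bar> < d2 \<Longrightarrow> s < F2 x"
    using isCont_greater by metis
  define \<theta> where "\<theta> = d2 / 2"
  have \<theta>: "\<theta> > 0" "s < F2 \<theta>" using d2 by (auto simp: \<theta>_def)
  define F3 where "F3 \<eta> = F2 \<theta> * (L/2 / sqrt ((L/2)\<^sup>2 + \<eta>\<^sup>2))" for \<eta>
  have "isCont F3 0" unfolding F3_def using L by (intro continuous_intros) auto
  moreover have "s < F3 0" using \<theta>(2) L by (simp add: F3_def)
  ultimately obtain d3 where d3: "d3 > 0" "\<And>x. \<bar>x - 0\<bar> < d3 \<Longrightarrow> s < F3 x"
    using isCont_greater by metis
  define F4 where "F4 \<eta> = (1 - \<eta>) ^ (n - 1) * radial_bound n M" for \<eta> :: real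
  have "isCont F4 0" unfolding F4_def by (intro continuous_intros)
  moreover have "s < F4 0" using s B by (simp add: F4_def)
  ultimately obtain d4 where d4: "d4 > 0" "\<And>x. \<bar>x - 0\<bar> < d4 \<Longrightarrow> s < F4 x"
    using isCont_greater by metis
  define F5 where "F5 \<eta> = (M - \<mu>) ^ 3 * \<theta> - 2 * M\<^sup>2 * \<eta>\<^sup>2" for \<eta> :: real
  have "isCont F5 0" unfolding F5_def by (intro continuous_intros)
  moreover have "0 < F5 0" using \<theta> \<mu> by (simp add: F5_def)
  ultimately obtain d5 where d5: "d5 > 0" "\<And>x. \<bar>x - 0\<bar> < d5 \<Longrightarrow> 0 < F5 x"
    using isCont_greater by metis
  define \<eta> where "\<eta> = min (min (d3/2) (d4/2)) (min (d5/2) (1/2))"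
  have \<eta>: "0 < \<eta>" "\<eta> < 1" and "\<bar>\<eta> - 0\<bar> < d3" "\<bar>\<eta> - 0\<bar> < d4" "\<bar>\<eta> - 0\<bar> < d5"
    using d3 d4 d5 by (auto simp: \<eta>_def)
  then have F: "s < F3 \<eta>" "s < F4 \<eta>" "0 < F5 \<eta>" using d3 d4 d5 by auto
  let ?h = "smoothed_tent L \<eta>"
  let ?g = "revolution_metric ?h :: 'n metric"
  interpret unit_profile L "- 1/2" "L + 1/2" "real CARD('n) - 1" ?h ?g
    using n unfolding n_def by (rule smoothed_tent_unit_profile[OF L \<eta>(1)])
  have "s \<le> steklov_eigenvalue L ?g 1"
  proof (rule steklov_eigenvalue_ge)
    fix \<sigma> f z z'
    assume f: "steklov_eigenfunction L ?g \<sigma> f" and z: "z \<in> cylinder L" "z' \<in> cylinder L" "f z \<noteq> f z'"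
    show "s \<le> \<sigma>"
    proof (cases "\<forall>r\<in>{0..L}. \<forall>p q. norm p = 1 \<longrightarrow> norm q = 1 \<longrightarrow> f (r, p) = f (r, q)")
      case True
      then have "\<sigma> = 2 / (width L - width 0)" by (intro radial_eigenvalue[OF f _ z]) blast
      then have "(1 - \<eta>) ^ (n - 1) * radial_bound n M \<le> \<sigma>"
        using smoothed_tent_radial[where 'n = 'n, OF L \<eta>(1) _ \<eta>(2)] n by (simp add: n_def M_def)
      then show ?thesis using F(2) by (simp add: F4_def)
    next
      case False
      then obtain r p q where "r \<in> {0..L}" "norm p = 1" "norm q = 1" "f (r, p) \<noteq> f (r, q)" by blast
      then obtain p q where pq: "norm p = 1" "norm q = 1" "f (r, p) > f (r, q)"
        by (metis linorder_neqE_linordered_idom)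
      have "2 * M\<^sup>2 * \<eta>\<^sup>2 \<le> (M - \<mu>) ^ 3 * \<theta>" using F(3) by (simp add: F5_def)
      then have "(m - \<kappa>) / (\<kappa> + 1 + \<theta>) * (L/2 / bump L \<eta> 0) \<le> \<sigma>"
        using smoothed_tent_nonradial[OF L \<eta>(1) _ \<mu>(1) _ \<theta>(1) _ f \<open>r \<in> {0..L}\<close> pq] n \<mu>(2)
        by (simp add: M_def m_def n_def \<kappa>_def)
      then show ?thesis using F(1) by (simp add: F3_def F2_def bump_def)
    qed
  qed
  then show ?thesis using smoothed_tent_hypersurface[OF L \<eta>(1)] by blast
qed

theorem corollary4:
  fixes n :: nat
  assumes "n = CARD('n::finite)" and "n \<ge> 3"
  shows "(\<exists>!L::real. L > 0 \<and> critical_equation n L) \<and>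
    (\<forall>(L::real) (g :: 'n metric).
       hypersurface_of_revolution L g \<longrightarrow> steklov_eigenvalue L g 1 < steklov_bound n) \<and>
    (\<forall>\<epsilon>>0. \<exists>(L::real) (g :: 'n metric).
       hypersurface_of_revolution L g \<and> steklov_eigenvalue L g 1 > steklov_bound n - \<epsilon>)"
proof (intro conjI allI impI)
  show "\<exists>!L. L > 0 \<and> critical_equation n L" by (rule critical_equation_ex1[OF assms(2)])
next
  fix L :: real and g :: "'n metric"
  assume g: "hypersurface_of_revolution L g"
  have card: "CARD('n) \<ge> 3" using assms by simp
  obtain a b h where "unit_profile L a b (real CARD('n) - 1) h g"
    by (rule hypersurface_unit_profile[OF card g])
  then show "steklov_eigenvalue L g 1 < steklov_bound n"
    unfolding assms(1) by (rule unit_profile.steklov_eigenvalue_less)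
next
  fix \<epsilon> :: real assume "\<epsilon> > 0"
  \<comment> \<open>Half of \<epsilon>, because \<open>steklov_bound_sharp\<close> concludes with a
    weak inequality.\<close>
  then obtain L and g :: "'n metric" where g: "hypersurface_of_revolution L g"
    and "steklov_bound n - \<epsilon> / 2 \<le> steklov_eigenvalue L g 1"
    using steklov_bound_sharp[where 'n = 'n, of "steklov_bound n - \<epsilon> / 2"] assms by auto
  moreover have "steklov_bound n - \<epsilon> < steklov_bound n - \<epsilon> / 2" using \<open>\<epsilon> > 0\<close> by simp
  ultimately show "\<exists>L (g :: 'n metric). hypersurface_of_revolution L g \<and>
      steklov_eigenvalue L g 1 > steklov_bound n - \<epsilon>"
    by (meson less_le_trans)
qed

end
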